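(* Let $T$ be a forward expansive correspondence on a compact metric space $X$, let $\psi\in C(\Gamma_T,\mathbb{R})$, and assume that $(T,\psi)$ satisfies the $C^\omega$ Legendre assumptions and has unique linear equilibrium pairs. Suppose that the rotation interval $\mathcal{R}(\psi)$ is symmetric about $0$, that the linear pressure $P(y)=P(T,y\psi)$ is even, and that the response ratio $y/P'(y)$ is strictly increasing for $y>0$. Assume that, for some $a,b>0$ and some integer $k\ge1$, $$P'(y)=ay-by^{2k+1}+O(y^{2k+3})\qquad(y\to0).$$ For $\beta\ge0$ set $\mathcal{E}_\beta(\gamma)=\frac\beta2\bigl(\int_{\Gamma_T}\psi\,d\gamma\bigr)^2$ and $\Phi(\beta)=\Pi_{\mathrm{top}}^{\mathcal{E}_\beta}(T)$, and let $\beta_c=1/a$ (the critical inverse temperature). Then: (i) If $0\le\beta\le\beta_c$, the unique nonlinear equilibrium pair for $\mathcal{E}_\beta$ is the linear equilibrium pair at $y=0$ (i.e. for the potential $0\cdot\psi$), and its rotation value is zero. (ii) If $\beta>\beta_c$, there are exactly two nonlinear equilibrium pairs: the linear equilibrium pairs for the potentials $\pm y_\beta\psi$, where $y_\beta>0$ is the unique positive solution of $y_\beta=\beta P'(y_\beta)$. Their rotation values are $\pm z_\beta$, with $z_\beta=P'(y_\beta)$. (iii) As $\beta\downarrow\beta_c$, $$y_\beta\sim\Bigl(\frac{a^2}{b}\Bigr)^{1/(2k)}(\beta-\beta_c)^{1/(2k)},\qquad z_\beta\sim C(\beta-\beta_c)^{1/(2k)},\qquad C:=a\Bigl(\frac{a^2}{b}\Bigr)^{1/(2k)}.$$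 (iv) $\Phi(\beta)=P(0)$ for $0\le\beta\le\beta_c$ and $\Phi(\beta)=P(y_\beta)-\frac\beta2z_\beta^2$ for $\beta>\beta_c$; and, as $\beta\downarrow\beta_c$, with $A:=C^2/2$, $$\Phi'(\beta)\sim A(\beta-\beta_c)^{1/k},\qquad \Phi(\beta)-P(0)\sim\frac{k}{k+1}A(\beta-\beta_c)^{1+1/k}.$$ In particular, $\Phi$ is $C^1$ but not $C^2$ at $\beta=\beta_c$.
   Context: For a compact metric space $Y$, $\mathcal{M}(Y)$ is the set of Borel probability measures on $Y$ with the weak-star topology. Logarithms are natural. Correspondences. Let $(X,d)$ be a compact metric space. A correspondence $T$ on $X$ assigns to each $x\in X$ a nonempty closed set $T(x)\subset X$ such that $\Gamma_T=\{(x,y)\in X^2:y\in T(x)\}$ is closed in $X^2$. Set $\mathcal{O}_{n+1}(T)=\{(x_0,\dots,x_n)\in X^{n+1}:x_{j+1}\in T(x_j),\ 0\le j<n\}$ with metric $d_{n+1}(\boldsymbol{x},\boldsymbol{y})=\max_{0\le j\le n}d(x_j,y_j)$. The orbit space is $\Omega_T=\{(x_j)_{j\ge0}:x_{j+1}\in T(x_j)\ \forall j\ge 0\}$. $T$ is forward expansive if there is $\varepsilon_0>0$ such that any two distinct $\boldsymbol{x},\boldsymbol{y}\in\Omega_T$ satisfy $d(x_j,y_j)>\varepsilon_0$ for some $j\ge0$. Topological pressure. Let $\mathcal{E}:\mathcal{M}(\Gamma_T)\to\mathbb{R}$ be continuous. For $\boldsymbol{x}\in\mathcal{O}_{n+1}(T)$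 let $L_n(\boldsymbol{x})=\frac1n\sum_{j=0}^{n-1}\delta_{(x_j,x_{j+1})}$. A set $\mathcal{C}\subset\mathcal{O}_{n+1}(T)$ is $(n,\varepsilon)$-separated if $d_{n+1}(\boldsymbol{x},\boldsymbol{y})>\varepsilon$ for all distinct $\boldsymbol{x},\boldsymbol{y}\in\mathcal{C}$. Let $Z_n(T,\mathcal{E},\varepsilon)=\sup_{\mathcal{C}}\sum_{\boldsymbol{x}\in\mathcal{C}}\exp(n\mathcal{E}(L_n(\boldsymbol{x})))$ over $(n,\varepsilon)$-separated $\mathcal C$. The upper and lower pressures are $\lim_{\varepsilon\to0^+}\limsup_{n}\frac1n\log Z_n(T,\mathcal{E},\varepsilon)$ and $\lim_{\varepsilon\to0^+}\liminf_{n}\frac1n\log Z_n(T,\mathcal{E},\varepsilon)$; when they agree (as they do for the energies considered here) $\Pi_{\mathrm{top}}^{\mathcal{E}}(T)$ denotes the common value. Stationary transition pairs. $\mathcal{K}(X;T)$ is the set of Borel transition probability kernels $Q$ on $X$ with $\operatorname{supp}Q_x\subseteq T(x)$ for every $x$. $\mathcal{M}(X,Q)=\{\mu\in\mathcal{M}(X):\mu Q=\mu\}$, $(\mu Q)(A)=\int_XQ_x(A)\,d\mu(x)$. A stationary transition pair is $(\mu,Q)$ with $Q\in\mathcal{K}(X;T)$, $\mu\in\mathcal{M}(X,Q)$; its two-coordinate distribution is $\gamma_{\mu,Q}(dx,dy)=\mu(dx)Q_x(dy)$, an element of $\mathcal{M}(\Gamma_T)$, and its rotation value is $\int\psi\,d\gamma_{\mu,Q}$.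 Kernels agreeing $\mu$-almost everywhere are identified, and pairs are counted modulo this identification. Kernel entropy. Let $\mu Q^{[n-1]}$ be the law on $X^n$ of $(x_0,\dots,x_{n-1})$ for the Markov process with initial law $\mu$ and kernel $Q$. For a finite Borel partition $\mathcal{A}$ of $X$ with product partition $\mathcal{A}^{\times n}$, $h_\mu(Q,\mathcal{A})=\lim_{n}\frac1nH_{\mu Q^{[n-1]}}(\mathcal{A}^{\times n})$, where $H_\lambda(\mathcal{B})=-\sum_{B\in\mathcal{B}}\lambda(B)\log\lambda(B)$, and $h_\mu(Q)=\sup_{\mathcal{A}}h_\mu(Q,\mathcal{A})$. A nonlinear equilibrium pair for $\mathcal{E}$ is a stationary transition pair maximizing $h_\mu(Q)+\mathcal{E}(\gamma_{\mu,Q})$ among all stationary transition pairs. For $\varphi\in C(\Gamma_T,\mathbb{R})$, $P(T,\varphi)$ is the (linear) topological pressure, i.e. $\Pi_{\mathrm{top}}$ for the energy $\gamma\mapsto\int\varphi\,d\gamma$; for forward expansive $T$ it equals $\sup\{h_\mu(Q)+\int\varphi\,d\gamma_{\mu,Q}\}$ over stationary transition pairs, and $\mathsf{Eq}(T,\varphi)$ is the set of pairs attaining this supremum (linear equilibrium pairs). $(T,\psi)$ has unique linear equilibrium pairs if $\mathsf{Eq}(T,y\psi)$ consists of exactly one pair (modulo the identification above) for every $y\in\mathbb{R}$. Rotation set and localized entropy. $\mathcal{R}(\psi)=\{\int\psi\,d\gamma_{\mu,Q}:(\mu,Q)\text{ stationary transition pair}\}\subset\mathbb{R}$; for $z\in\mathcal{R}(\psi)$,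 $\mathfrak{h}(z)=\sup\{h_\mu(Q):\int\psi\,d\gamma_{\mu,Q}=z\}$. $C^\omega$ Legendre assumptions for $(T,\psi)$, with $P(y)=P(T,y\psi)$: (i) $\mathcal{R}(\psi)$ has nonempty interior; (ii) $\mathfrak{h}$ is finite and upper semicontinuous on $\mathcal{R}(\psi)$, and is real analytic and strictly concave on its interior; (iii) $P$ is real analytic and strictly convex, and $P':\mathbb{R}\to\operatorname{int}\mathcal{R}(\psi)$ is a homeomorphism such that it and its inverse are real analytic; (iv) $\mathfrak{h}(z)=\inf_{y\in\mathbb{R}}(P(y)-yz)$ for all $z\in\mathcal{R}(\psi)$. $f\sim g$ means $f/g\to1$. *)

theory Defs
  imports "HOL-Probability.Probability" "HOL-Library.Landau_Symbols"
begin

text \<open>The compact metric space \<open>X\<close> is a type \<open>'a :: metric_space\<close> with compact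
  universe; compactness is a hypothesis of the theorem.\<close>

section \<open>Correspondences\<close>

definition graph :: "('a \<Rightarrow> 'a set) \<Rightarrow> ('a \<times> 'a) set" where
  "graph T = {(x, y). y \<in> T x}"

definition correspondence :: "('a::metric_space \<Rightarrow> 'a set) \<Rightarrow> bool" where
  "correspondence T \<longleftrightarrow> (\<forall>x. T x \<noteq> {} \<and> closed (T x)) \<and> closed (graph T)"

text \<open>\<open>orbits T n\<close> is the set \<open>O\<^sub>n\<^sub>+\<^sub>1(T)\<close> of orbits \<open>(x\<^sub>0, ..., x\<^sub>n)\<close> with \<open>n\<close> steps;
  a tuple is a function that is \<open>undefined\<close> outside \<open>{..n}\<close>.\<close>

definition orbits :: "('a \<Rightarrow> 'a set) \<Rightarrow> nat \<Rightarrow> (nat \<Rightarrow> 'a) set" where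
  "orbits T n = {x \<in> PiE {..n} (\<lambda>_. UNIV). \<forall>j<n. x (Suc j) \<in> T (x j)}"

definition orbit_dist :: "nat \<Rightarrow> (nat \<Rightarrow> 'a::metric_space) \<Rightarrow> (nat \<Rightarrow> 'a) \<Rightarrow> real" where
  "orbit_dist n x y = (MAX j\<in>{..n}. dist (x j) (y j))"

definition orbit_space :: "('a \<Rightarrow> 'a set) \<Rightarrow> (nat \<Rightarrow> 'a) set" where
  "orbit_space T = {x. \<forall>j. x (Suc j) \<in> T (x j)}"

definition forward_expansive :: "('a::metric_space \<Rightarrow> 'a set) \<Rightarrow> bool" where
  "forward_expansive T \<longleftrightarrow>
     (\<exists>\<epsilon>>0. \<forall>x\<in>orbit_space T. \<forall>y\<in>orbit_space T. x \<noteq> y \<longrightarrow> (\<exists>j. dist (x j) (y j) > \<epsilon>))"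

section \<open>Topological pressure\<close>

text \<open>A probability measure on \<open>\<Gamma>\<^sub>T\<close> is a probability measure whose measurable space is
  \<open>restrict_space borel (graph T)\<close>. An energy is a real function of such measures.\<close>

text \<open>\<open>empirical T n x\<close> is \<open>1/n\<close> times the sum of the Dirac measures at
  \<open>(x\<^sub>j, x\<^sub>j\<^sub>+\<^sub>1)\<close>, \<open>j < n\<close>: the law of a step of the orbit chosen uniformly at random
  (for \<open>n \<ge> 1\<close>).\<close>

definition empirical ::
    "('a::metric_space \<Rightarrow> 'a set) \<Rightarrow> nat \<Rightarrow> (nat \<Rightarrow> 'a) \<Rightarrow> ('a \<times> 'a) measure" where
  "empirical T n x =
     distr (uniform_count_measure {..<n}) (restrict_space borel (graph T))
       (\<lambda>j. (x j, x (Suc j)))"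

definition separated ::
    "('a::metric_space \<Rightarrow> 'a set) \<Rightarrow> nat \<Rightarrow> real \<Rightarrow> (nat \<Rightarrow> 'a) set \<Rightarrow> bool" where
  "separated T n \<epsilon> C \<longleftrightarrow> C \<subseteq> orbits T n \<and>
     (\<forall>x\<in>C. \<forall>y\<in>C. x \<noteq> y \<longrightarrow> orbit_dist n x y > \<epsilon>)"

text \<open>On a compact space separated sets are finite, with a bound on the cardinality depending
  only on \<open>n\<close> and \<open>\<epsilon> > 0\<close>; so for an energy that is bounded on empirical measures the sums
  are genuine and the supremum is finite. It is positive because orbits exist.\<close>

definition partition_sum ::
    "('a::metric_space \<Rightarrow> 'a set) \<Rightarrow> (('a \<times> 'a) measure \<Rightarrow> real) \<Rightarrow> nat \<Rightarrow> real \<Rightarrow> real" where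
  "partition_sum T E n \<epsilon> =
     (SUP C\<in>{C. separated T n \<epsilon> C}. \<Sum>x\<in>C. exp (real n * E (empirical T n x)))"

definition upper_pressure ::
    "('a::metric_space \<Rightarrow> 'a set) \<Rightarrow> (('a \<times> 'a) measure \<Rightarrow> real) \<Rightarrow> ereal" where
  "upper_pressure T E =
     Lim (at_right 0) (\<lambda>\<epsilon>. limsup (\<lambda>n. ereal (1 / real n * ln (partition_sum T E n \<epsilon>))))"

definition lower_pressure ::
    "('a::metric_space \<Rightarrow> 'a set) \<Rightarrow> (('a \<times> 'a) measure \<Rightarrow> real) \<Rightarrow> ereal" where
  "lower_pressure T E =
     Lim (at_right 0) (\<lambda>\<epsilon>. liminf (\<lambda>n. ereal (1 / real n * ln (partition_sum T E n \<epsilon>))))"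

definition has_top_pressure ::
    "('a::metric_space \<Rightarrow> 'a set) \<Rightarrow> (('a \<times> 'a) measure \<Rightarrow> real) \<Rightarrow> real \<Rightarrow> bool" where
  "has_top_pressure T E p \<longleftrightarrow> upper_pressure T E = ereal p \<and> lower_pressure T E = ereal p"

definition top_pressure ::
    "('a::metric_space \<Rightarrow> 'a set) \<Rightarrow> (('a \<times> 'a) measure \<Rightarrow> real) \<Rightarrow> real" where
  "top_pressure T E = (THE p. has_top_pressure T E p)"

definition linear_pressure ::
    "('a::metric_space \<Rightarrow> 'a set) \<Rightarrow> ('a \<times> 'a \<Rightarrow> real) \<Rightarrow> real" where
  "linear_pressure T \<phi> = top_pressure T (\<lambda>\<gamma>. \<integral>p. \<phi> p \<partial>\<gamma>)"

section \<open>Stationary transition pairs\<close>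

definition msupport :: "'a::topological_space measure \<Rightarrow> 'a set" where
  "msupport M = {x. \<forall>U. open U \<and> x \<in> U \<longrightarrow> emeasure M U > 0}"

definition kernels :: "('a::metric_space \<Rightarrow> 'a set) \<Rightarrow> ('a \<Rightarrow> 'a measure) set" where
  "kernels T = {Q \<in> borel \<rightarrow>\<^sub>M prob_algebra borel. \<forall>x. msupport (Q x) \<subseteq> T x}"

definition stationary_pairs ::
    "('a::metric_space \<Rightarrow> 'a set) \<Rightarrow> ('a measure \<times> ('a \<Rightarrow> 'a measure)) set" where
  "stationary_pairs T =
     {(\<mu>, Q). Q \<in> kernels T \<and> \<mu> \<in> space (prob_algebra borel) \<and> Giry_Monad.bind \<mu> Q = \<mu>}"

text \<open>The measure \<open>\<mu>(dx) Q\<^sub>x(dy)\<close>, regarded as a measure on \<open>\<Gamma>\<^sub>T\<close>.\<close>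

definition pair_law ::
    "('a::metric_space \<Rightarrow> 'a set) \<Rightarrow> 'a measure \<times> ('a \<Rightarrow> 'a measure) \<Rightarrow> ('a \<times> 'a) measure" where
  "pair_law T = (\<lambda>(\<mu>, Q).
     restrict_space (Giry_Monad.bind \<mu> (\<lambda>x. distr (Q x) borel (\<lambda>y. (x, y)))) (graph T))"

definition rotation_value ::
    "('a::metric_space \<Rightarrow> 'a set) \<Rightarrow> ('a \<times> 'a \<Rightarrow> real) \<Rightarrow> 'a measure \<times> ('a \<Rightarrow> 'a measure) \<Rightarrow> real" where
  "rotation_value T \<psi> p = (\<integral>q. \<psi> q \<partial>(pair_law T p))"

definition pair_identification ::
    "('a::metric_space \<Rightarrow> 'a set) \<Rightarrow> ('a measure \<times> ('a \<Rightarrow> 'a measure)) rel" where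
  "pair_identification T =
     {((\<mu>, Q), (\<mu>', Q')). (\<mu>, Q) \<in> stationary_pairs T \<and> (\<mu>', Q') \<in> stationary_pairs T \<and>
        \<mu> = \<mu>' \<and> (AE x in \<mu>. Q x = Q' x)}"

text \<open>The number of pairs in \<open>S\<close> modulo almost everywhere equality of kernels; it is \<open>0\<close> if
  there are infinitely many, so it is only compared with positive numbers.\<close>

definition num_pairs ::
    "('a::metric_space \<Rightarrow> 'a set) \<Rightarrow> ('a measure \<times> ('a \<Rightarrow> 'a measure)) set \<Rightarrow> nat" where
  "num_pairs T S = card (S // pair_identification T)"

section \<open>Kernel entropy\<close>

text \<open>\<open>markov_law \<mu> Q n\<close> is \<open>\<mu>Q\<^sup>[\<^sup>n\<^sup>]\<close>, the law of \<open>(x\<^sub>0, ..., x\<^sub>n)\<close> on \<open>X\<^sup>n\<^sup>+\<^sup>1\<close>.\<close>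

primrec markov_law ::
    "'a::metric_space measure \<Rightarrow> ('a \<Rightarrow> 'a measure) \<Rightarrow> nat \<Rightarrow> (nat \<Rightarrow> 'a) measure" where
  "markov_law \<mu> Q 0 = distr \<mu> (PiM {..0} (\<lambda>_. borel)) (\<lambda>x. \<lambda>i\<in>{..0}. x)"
| "markov_law \<mu> Q (Suc n) =
     Giry_Monad.bind (markov_law \<mu> Q n)
       (\<lambda>\<omega>. distr (Q (\<omega> n)) (PiM {..Suc n} (\<lambda>_. borel)) (\<lambda>y. fun_upd \<omega> (Suc n) y))"

definition borel_partition :: "'a::topological_space set set \<Rightarrow> bool" where
  "borel_partition \<A> \<longleftrightarrow> finite \<A> \<and> partition_on UNIV \<A> \<and> \<A> \<subseteq> sets borel"

definition product_partition :: "'a set set \<Rightarrow> nat set \<Rightarrow> (nat \<Rightarrow> 'a) set set" where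
  "product_partition \<A> I = PiE I ` PiE I (\<lambda>_. \<A>)"

definition partition_entropy :: "'b measure \<Rightarrow> 'b set set \<Rightarrow> real" where
  "partition_entropy M \<B> = - (\<Sum>B\<in>\<B>. measure M B * ln (measure M B))"

text \<open>With \<open>n + 1\<close> in place of \<open>n\<close>, so that the sequence starts at its first term.\<close>

definition kernel_entropy_wrt ::
    "'a::metric_space measure \<times> ('a \<Rightarrow> 'a measure) \<Rightarrow> 'a set set \<Rightarrow> real" where
  "kernel_entropy_wrt = (\<lambda>(\<mu>, Q) \<A>.
     lim (\<lambda>n. 1 / real (Suc n) *
       partition_entropy (markov_law \<mu> Q n) (product_partition \<A> {..n})))"

definition kernel_entropy :: "'a::metric_space measure \<times> ('a \<Rightarrow> 'a measure) \<Rightarrow> ereal" where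
  "kernel_entropy p = (SUP \<A>\<in>{\<A>. borel_partition \<A>}. ereal (kernel_entropy_wrt p \<A>))"

section \<open>Equilibrium pairs\<close>

definition nonlinear_eq_pairs ::
    "('a::metric_space \<Rightarrow> 'a set) \<Rightarrow> (('a \<times> 'a) measure \<Rightarrow> real) \<Rightarrow>
     ('a measure \<times> ('a \<Rightarrow> 'a measure)) set" where
  "nonlinear_eq_pairs T E =
     {p \<in> stationary_pairs T. \<forall>q\<in>stationary_pairs T.
        kernel_entropy q + ereal (E (pair_law T q)) \<le> kernel_entropy p + ereal (E (pair_law T p))}"

definition linear_eq_pairs ::
    "('a::metric_space \<Rightarrow> 'a set) \<Rightarrow> ('a \<times> 'a \<Rightarrow> real) \<Rightarrow>
     ('a measure \<times> ('a \<Rightarrow> 'a measure)) set" where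
  "linear_eq_pairs T \<phi> =
     {p \<in> stationary_pairs T.
        kernel_entropy p + ereal (\<integral>r. \<phi> r \<partial>(pair_law T p)) =
        (SUP q\<in>stationary_pairs T. kernel_entropy q + ereal (\<integral>r. \<phi> r \<partial>(pair_law T q)))}"

definition unique_linear_eq_pairs ::
    "('a::metric_space \<Rightarrow> 'a set) \<Rightarrow> ('a \<times> 'a \<Rightarrow> real) \<Rightarrow> bool" where
  "unique_linear_eq_pairs T \<psi> \<longleftrightarrow>
     (\<forall>y::real. num_pairs T (linear_eq_pairs T (\<lambda>r. y * \<psi> r)) = 1)"

section \<open>Rotation set, localized entropy and the Legendre assumptions\<close>

definition rotation_set ::
    "('a::metric_space \<Rightarrow> 'a set) \<Rightarrow> ('a \<times> 'a \<Rightarrow> real) \<Rightarrow> real set" where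
  "rotation_set T \<psi> = rotation_value T \<psi> ` stationary_pairs T"

definition localized_entropy ::
    "('a::metric_space \<Rightarrow> 'a set) \<Rightarrow> ('a \<times> 'a \<Rightarrow> real) \<Rightarrow> real \<Rightarrow> ereal" where
  "localized_entropy T \<psi> z =
     (SUP p\<in>{p \<in> stationary_pairs T. rotation_value T \<psi> p = z}. kernel_entropy p)"

definition real_analytic_on :: "(real \<Rightarrow> real) \<Rightarrow> real set \<Rightarrow> bool" where
  "real_analytic_on f S \<longleftrightarrow>
     (\<forall>x\<in>S. \<exists>r>0. \<exists>c. \<forall>y. \<bar>y - x\<bar> < r \<longrightarrow> (\<lambda>n. c n * (y - x) ^ n) sums f y)"

definition strictly_convex_on :: "real set \<Rightarrow> (real \<Rightarrow> real) \<Rightarrow> bool" where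
  "strictly_convex_on S f \<longleftrightarrow> convex S \<and>
     (\<forall>x\<in>S. \<forall>y\<in>S. \<forall>t. x \<noteq> y \<and> 0 < t \<and> t < 1 \<longrightarrow>
        f ((1 - t) * x + t * y) < (1 - t) * f x + t * f y)"

definition strictly_concave_on :: "real set \<Rightarrow> (real \<Rightarrow> real) \<Rightarrow> bool" where
  "strictly_concave_on S f \<longleftrightarrow> strictly_convex_on S (\<lambda>x. - f x)"

definition upper_semicontinuous_on ::
    "'b::topological_space set \<Rightarrow> ('b \<Rightarrow> 'c::linorder) \<Rightarrow> bool" where
  "upper_semicontinuous_on S f \<longleftrightarrow>
     (\<forall>z\<in>S. \<forall>c. f z < c \<longrightarrow> (\<forall>\<^sub>F w in at z within S. f w < c))"

definition legendre_assumptions ::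
    "('a::metric_space \<Rightarrow> 'a set) \<Rightarrow> ('a \<times> 'a \<Rightarrow> real) \<Rightarrow> bool" where
  "legendre_assumptions T \<psi> \<longleftrightarrow>
     (let R = rotation_set T \<psi>; H = localized_entropy T \<psi>;
          P = (\<lambda>y. linear_pressure T (\<lambda>r. y * \<psi> r))
      in interior R \<noteq> {} \<and>
         (\<forall>z\<in>R. \<bar>H z\<bar> \<noteq> \<infinity>) \<and> upper_semicontinuous_on R H \<and>
         real_analytic_on (\<lambda>z. real_of_ereal (H z)) (interior R) \<and>
         strictly_concave_on (interior R) (\<lambda>z. real_of_ereal (H z)) \<and>
         real_analytic_on P UNIV \<and> strictly_convex_on UNIV P \<and>
         (\<exists>g. homeomorphism UNIV (interior R) (deriv P) g \<and>
              real_analytic_on (deriv P) UNIV \<and> real_analytic_on g (interior R)) \<and>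
         (\<forall>z\<in>R. H z = (INF y. ereal (P y - y * z))))"

section \<open>The quadratic energy and the self-consistency equation\<close>

definition quadratic_energy ::
    "('a::metric_space \<times> 'a \<Rightarrow> real) \<Rightarrow> real \<Rightarrow> ('a \<times> 'a) measure \<Rightarrow> real" where
  "quadratic_energy \<psi> \<beta> \<gamma> = \<beta> / 2 * (\<integral>r. \<psi> r \<partial>\<gamma>)\<^sup>2"

definition positive_solution :: "(real \<Rightarrow> real) \<Rightarrow> real \<Rightarrow> real" where
  "positive_solution P \<beta> = (THE y. 0 < y \<and> y = \<beta> * deriv P y)"

end

theory Submission
  imports Defs
begin

text \<open>
  The proof reduces the theorem to the maximization of the function
  \<open>P t - t\<^sup>2 / (2 * \<beta>)\<close> of one real variable, for the pressure and for the equilibrium pairs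
  separately. (For \<open>\<beta> = 0\<close> the maximum is replaced by the value \<open>P 0\<close>.)

  Pressure. For an orbit of length \<open>n\<close> on which \<open>\<psi>\<close> has mean \<open>m\<close>, the energy is
  \<open>\<beta> / 2 * m\<^sup>2 = max\<^sub>s (\<beta> * s * m - \<beta> * s\<^sup>2 / 2)\<close>. Hence the partition sum of the quadratic energy is bounded
  below by \<open>exp (- n * \<beta> * s\<^sup>2 / 2)\<close> times the partition sum of the linear potential \<open>\<beta> * s * \<psi>\<close>, for each
  \<open>s\<close>, and above, up to a small exponential error, by the sum of such products over a finite grid of
  values of \<open>s\<close> (\<open>quadratic_pressure_limit\<close>). So the pressure exists and equals the maximum of
  \<open>P (\<beta> * s) - \<beta> * s\<^sup>2 / 2\<close>, provided that the linear pressures \<open>P t\<close> exist as limits. That is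
  \<open>linear_pressure_limit\<close>: weighted covers by sets of small diameter are submultiplicative, which bounds
  the upper growth rate by the lower one at a finer resolution, and forward expansiveness makes the
  growth rates independent of the resolution, so that they stay finite as the resolution tends to \<open>0\<close>.

  Equilibrium pairs. By the Legendre formula a stationary pair with rotation value \<open>m\<close> has entropy at most
  \<open>P t - t * m\<close> for every \<open>t\<close>, with equality exactly on the linear equilibrium pairs at \<open>t\<close>, all of which
  have \<open>m = P' t\<close>. Taking \<open>t = \<beta> * m\<close> shows that the nonlinear equilibrium pairs are the linear ones at the
  maximizers of \<open>P t - t\<^sup>2 / (2 * \<beta>)\<close> (\<open>nonlinear_eq_pairs_eq\<close>).

  One variable. For \<open>t > 0\<close> the derivative of \<open>P t - t\<^sup>2 / (2 * \<beta>)\<close> has the sign of \<open>\<beta> - t / P' t\<close>, and the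
  response ratio \<open>t / P' t\<close> increases from \<open>1 / a\<close> to infinity. So the maximizer is \<open>0\<close> up to \<open>\<beta> = 1 / a\<close>,
  and there are two maximizers, the solutions \<open>\<plusminus>y\<close> of \<open>y = \<beta> * P' y\<close>, beyond it (\<open>objective_max\<close>).
  The expansion of \<open>P'\<close> gives \<open>t / P' t - 1 / a \<sim> (b / a\<^sup>2) * t ^ (2 * k)\<close>, and inverting this relation
  yields the asymptotics of \<open>y\<close> and of the rotation value. By an envelope argument (\<open>envelope\<close>) the
  pressure of the quadratic energy has derivative \<open>y\<^sup>2 / (2 * \<beta>\<^sup>2)\<close>, half of the squared rotation value, from which the remaining
  claims follow.
\<close>

section \<open>Separated sets and partition sums\<close>

text \<open>The partition sum with an arbitrary exponent \<open>f\<close> in place of \<open>n\<close> times the energy of the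
  empirical measure. The sums are bounded, so that this is a genuine supremum, if \<open>\<epsilon> > 0\<close>, the space is
  compact and \<open>f\<close> is bounded above on orbits.\<close>

definition sep_sup ::
    "('a::metric_space \<Rightarrow> 'a set) \<Rightarrow> nat \<Rightarrow> real \<Rightarrow> ((nat \<Rightarrow> 'a) \<Rightarrow> real) \<Rightarrow> real" where
  "sep_sup T n \<epsilon> f = (SUP C\<in>{C. separated T n \<epsilon> C}. \<Sum>x\<in>C. exp (f x))"

text \<open>The Birkhoff sum of \<open>\<phi>\<close> over the \<open>n\<close> steps of an orbit.\<close>

definition orbit_sum :: "('a \<times> 'a \<Rightarrow> real) \<Rightarrow> nat \<Rightarrow> (nat \<Rightarrow> 'a) \<Rightarrow> real" where
  "orbit_sum \<phi> n x = (\<Sum>j<n. \<phi> (x j, x (Suc j)))"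

lemma orbit_dist_le_iff: "orbit_dist n x y \<le> e \<longleftrightarrow> (\<forall>j\<le>n. dist (x j) (y j) \<le> e)"
  unfolding orbit_dist_def by (subst Max_le_iff) auto

lemma orbit_dist_gr_iff: "orbit_dist n x y > e \<longleftrightarrow> (\<exists>j\<le>n. dist (x j) (y j) > e)"
  using orbit_dist_le_iff[of n x y e] by (auto simp: not_le[symmetric])

lemma orbit_step_in_graph: "x \<in> orbits T n \<Longrightarrow> j < n \<Longrightarrow> (x j, x (Suc j)) \<in> graph T"
  by (auto simp: orbits_def graph_def)

lemma integral_empirical:
  assumes "continuous_on (graph T) \<phi>" "x \<in> orbits T n" "0 < n"
  shows "(\<integral>p. \<phi> p \<partial>empirical T n x) = orbit_sum \<phi> n x / n"
proof -
  have m: "(\<lambda>j. (x j, x (Suc j))) \<in>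
      measurable (uniform_count_measure {..<n}) (restrict_space borel (graph T))"
    using assms(2) by (auto simp: measurable_def space_uniform_count_measure
        sets_uniform_count_measure space_restrict_space orbit_step_in_graph)
  have "\<phi> \<in> borel_measurable (restrict_space borel (graph T))"
    by (rule borel_measurable_continuous_on_restrict[OF assms(1)])
  then have "(\<integral>p. \<phi> p \<partial>empirical T n x) =
      (\<integral>j. \<phi> (x j, x (Suc j)) \<partial>uniform_count_measure {..<n})"
    unfolding empirical_def by (rule integral_distr[OF m])
  also have "\<dots> = orbit_sum \<phi> n x / n"
    by (subst integral_uniform_count_measure) (auto simp: orbit_sum_def)
  finally show ?thesis .
qed

lemma partition_sum_eq_sep_sup:
  assumes "\<And>x. x \<in> orbits T n \<Longrightarrow> real n * E (empirical T n x) = f x"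
  shows "partition_sum T E n \<epsilon> = sep_sup T n \<epsilon> f"
proof -
  have "(\<Sum>x\<in>C. exp (real n * E (empirical T n x))) = (\<Sum>x\<in>C. exp (f x))"
    if "separated T n \<epsilon> C" for C
    using that assms by (intro sum.cong) (auto simp: separated_def)
  then show ?thesis unfolding partition_sum_def sep_sup_def by (intro SUP_cong) auto
qed

text \<open>Assigning to each point of an orbit a nearby point of a finite net is injective on a
  separated set.\<close>

lemma separated_finite:
  fixes T :: "'a::metric_space \<Rightarrow> 'a set"
  assumes "compact (UNIV :: 'a set)" "0 < \<epsilon>"
  obtains N where "\<And>C. separated T n \<epsilon> C \<Longrightarrow> finite C \<and> card C \<le> N"
proof -
  obtain K :: "'a set" where K: "finite K" "UNIV \<subseteq> (\<Union>k\<in>K. ball k (\<epsilon>/2))"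
    using assms(1) half_gt_zero[OF assms(2)] unfolding compact_eq_totally_bounded by blast
  then have "\<forall>x. \<exists>k\<in>K. dist k x < \<epsilon>/2" by fastforce
  then obtain c where c: "\<And>x. c x \<in> K" "\<And>x. dist (c x) x < \<epsilon>/2" by metis
  define F where "F = PiE {..n} (\<lambda>_. K)"
  have F: "finite F" unfolding F_def using K(1) by (intro finite_PiE) auto
  have "finite C \<and> card C \<le> card F" if C: "separated T n \<epsilon> C" for C
  proof -
    let ?g = "\<lambda>x::nat \<Rightarrow> 'a. restrict (c \<circ> x) {..n}"
    have inj: "inj_on ?g C"
    proof (rule inj_onI, rule ccontr)
      fix x y assume "x \<in> C" "y \<in> C" and eq: "?g x = ?g y" and "x \<noteq> y"
      then obtain j where j: "j \<le> n" "dist (x j) (y j) > \<epsilon>"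
        using C unfolding separated_def orbit_dist_gr_iff by blast
      then have "c (x j) = c (y j)" using fun_cong[OF eq, of j] by simp
      then show False using c(2)[of "x j"] c(2)[of "y j"] j(2)
          dist_triangle3[of "x j" "y j" "c (x j)"] by simp
    qed
    have "?g ` C \<subseteq> F" unfolding F_def
      by (intro image_subsetI) (simp only: restrict_PiE_iff, simp add: c(1))
    then show ?thesis
      using inj F by (metis card_inj_on_le inj_on_finite)
  qed
  then show ?thesis using that by blast
qed

lemma separated_singleton: "x \<in> orbits T n \<Longrightarrow> separated T n \<epsilon> {x}"
  by (auto simp: separated_def)

lemma sum_exp_le:
  assumes "finite C" "card C \<le> N" "\<And>x. x \<in> C \<Longrightarrow> f x \<le> B"
  shows "(\<Sum>x\<in>C. exp (f x)) \<le> real N * exp B"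
proof -
  have "(\<Sum>x\<in>C. exp (f x)) \<le> real (card C) * exp B"
    using assms(3) by (intro sum_bounded_above) auto
  also have "\<dots> \<le> real N * exp B" using assms(2) by (intro mult_right_mono) auto
  finally show ?thesis .
qed

lemma sep_sup_upper:
  fixes T :: "'a::metric_space \<Rightarrow> 'a set"
  assumes "compact (UNIV :: 'a set)" "0 < \<epsilon>" "\<And>x. x \<in> orbits T n \<Longrightarrow> f x \<le> B"
    and "separated T n \<epsilon> C"
  shows "(\<Sum>x\<in>C. exp (f x)) \<le> sep_sup T n \<epsilon> f"
proof -
  obtain N where N: "\<And>C. separated T n \<epsilon> C \<Longrightarrow> finite C \<and> card C \<le> N"
    using separated_finite[OF assms(1,2)] by blast
  have "bdd_above ((\<lambda>C. \<Sum>x\<in>C. exp (f x)) ` {C. separated T n \<epsilon> C})"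
  proof (rule bdd_aboveI2)
    fix C assume "C \<in> {C. separated T n \<epsilon> C}"
    then show "(\<Sum>x\<in>C. exp (f x)) \<le> real N * exp B"
      using N assms(3) by (intro sum_exp_le) (auto simp: separated_def)
  qed
  then show ?thesis unfolding sep_sup_def using assms(4) by (intro cSUP_upper) auto
qed

lemma sep_sup_least:
  assumes "\<And>C. separated T n \<epsilon> C \<Longrightarrow> (\<Sum>x\<in>C. exp (f x)) \<le> W"
  shows "sep_sup T n \<epsilon> f \<le> W"
proof -
  have "separated T n \<epsilon> {}" by (simp add: separated_def)
  then show ?thesis unfolding sep_sup_def using assms by (intro cSUP_least) auto
qed

lemma sep_sup_ge:
  fixes T :: "'a::metric_space \<Rightarrow> 'a set"
  assumes "compact (UNIV :: 'a set)" "0 < \<epsilon>" "\<And>x. x \<in> orbits T n \<Longrightarrow> f x \<le> B"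
    and "x \<in> orbits T n"
  shows "exp (f x) \<le> sep_sup T n \<epsilon> f"
  using sep_sup_upper[OF assms(1-3) separated_singleton[OF assms(4)]] by simp

lemma sep_sup_mono:
  fixes T :: "'a::metric_space \<Rightarrow> 'a set"
  assumes "compact (UNIV :: 'a set)" "0 < \<eta>" "\<eta> \<le> \<epsilon>"
    and "\<And>x. x \<in> orbits T n \<Longrightarrow> g x \<le> B" and "\<And>x. x \<in> orbits T n \<Longrightarrow> f x \<le> g x"
  shows "sep_sup T n \<epsilon> f \<le> sep_sup T n \<eta> g"
proof (rule sep_sup_least)
  fix C assume C: "separated T n \<epsilon> C"
  then have "separated T n \<eta> C" using assms(3) unfolding separated_def by fastforce
  then have "(\<Sum>x\<in>C. exp (g x)) \<le> sep_sup T n \<eta> g"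
    by (intro sep_sup_upper[OF assms(1,2), of T n g B] assms(4))
  moreover have "(\<Sum>x\<in>C. exp (f x)) \<le> (\<Sum>x\<in>C. exp (g x))"
    using C assms(5) by (intro sum_mono) (auto simp: separated_def)
  ultimately show "(\<Sum>x\<in>C. exp (f x)) \<le> sep_sup T n \<eta> g" by linarith
qed

lemma sep_sup_add_const:
  assumes "\<And>x. x \<in> orbits T n \<Longrightarrow> f x = c + g x"
    and "compact (UNIV :: 'a::metric_space set)" "0 < \<epsilon>"
    and "\<And>x. x \<in> orbits T n \<Longrightarrow> g x \<le> B"
  shows "sep_sup T n \<epsilon> f \<le> exp c * sep_sup (T :: 'a \<Rightarrow> 'a set) n \<epsilon> g"
proof (rule sep_sup_least)
  fix C assume C: "separated T n \<epsilon> C"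
  have "(\<Sum>x\<in>C. exp (f x)) = exp c * (\<Sum>x\<in>C. exp (g x))"
    using C assms(1) unfolding sum_distrib_left
    by (intro sum.cong) (auto simp: separated_def exp_add subset_iff)
  also have "\<dots> \<le> exp c * sep_sup T n \<epsilon> g"
    using sep_sup_upper[OF assms(2-4) C] by simp
  finally show "(\<Sum>x\<in>C. exp (f x)) \<le> exp c * sep_sup T n \<epsilon> g" .
qed

section \<open>Finite and infinite orbits\<close>

lemma orbit_extend:
  assumes "correspondence T" "x \<in> orbits T n"
  obtains \<omega> where "\<omega> \<in> orbit_space T" "\<And>j. j \<le> n \<Longrightarrow> \<omega> j = x j"
proof -
  have "\<forall>x. \<exists>y. y \<in> T x" using assms(1) unfolding correspondence_def by auto
  then obtain s where s: "\<And>x. s x \<in> T x" by metis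
  define \<omega> where "\<omega> j = (if j \<le> n then x j else (s ^^ (j - n)) (x n))" for j
  have "\<omega> (Suc j) \<in> T (\<omega> j)" for j
  proof (cases "j < n")
    case True then show ?thesis using assms(2) by (auto simp: \<omega>_def orbits_def)
  next
    case False
    then have "\<omega> (Suc j) = s (\<omega> j)"
      by (cases "j = n") (auto simp: \<omega>_def Suc_diff_le)
    then show ?thesis using s by simp
  qed
  then have "\<omega> \<in> orbit_space T" by (simp add: orbit_space_def)
  then show ?thesis using that[of \<omega>] by (simp add: \<omega>_def)
qed

lemma orbit_truncate: "\<omega> \<in> orbit_space T \<Longrightarrow> restrict \<omega> {..n} \<in> orbits T n"
  by (auto simp: orbit_space_def orbits_def)

lemma orbits_nonempty:
  assumes "correspondence T" obtains x where "x \<in> orbits T n"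
proof -
  have "(\<lambda>j\<in>{..0::nat}. undefined) \<in> orbits T 0" by (simp add: orbits_def)
  then obtain \<omega> where "\<omega> \<in> orbit_space T" using orbit_extend[OF assms] by blast
  then show ?thesis using orbit_truncate that by blast
qed

lemma orbit_sum_bound:
  assumes "\<forall>p\<in>graph T. \<bar>\<phi> p\<bar> \<le> M" "x \<in> orbits T n"
  shows "\<bar>orbit_sum \<phi> n x\<bar> \<le> n * M"
proof -
  have "\<bar>orbit_sum \<phi> n x\<bar> \<le> (\<Sum>j<n. \<bar>\<phi> (x j, x (Suc j))\<bar>)"
    unfolding orbit_sum_def by (rule sum_abs)
  also have "\<dots> \<le> (\<Sum>j<n. M)"
    using assms by (intro sum_mono) (auto intro: orbit_step_in_graph)
  finally show ?thesis by simp
qed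

lemma sep_sup_orbit_sum_ge:
  fixes T :: "'a::metric_space \<Rightarrow> 'a set"
  assumes "compact (UNIV :: 'a set)" "correspondence T" "0 < \<epsilon>"
    and "\<forall>p\<in>graph T. \<bar>\<phi> p\<bar> \<le> M"
  shows "exp (- (n * M)) \<le> sep_sup T n \<epsilon> (orbit_sum \<phi> n)"
proof -
  obtain x where x: "x \<in> orbits T n" using orbits_nonempty[OF assms(2)] .
  have b: "\<bar>orbit_sum \<phi> n x\<bar> \<le> n * M" if "x \<in> orbits T n" for x
    using orbit_sum_bound[OF assms(4) that] by simp
  then have "exp (orbit_sum \<phi> n x) \<le> sep_sup T n \<epsilon> (orbit_sum \<phi> n)"
    using x by (intro sep_sup_ge[OF assms(1,3), of T n _ "n * M"]) fastforce+
  moreover have "exp (- (n * M)) \<le> exp (orbit_sum \<phi> n x)" using b[OF x] by simp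
  ultimately show ?thesis by linarith
qed

lemma compact_fun_UNIV:
  assumes "compact (UNIV :: 'a::metric_space set)"
  shows "compact (UNIV :: (nat \<Rightarrow> 'a) set)"
proof -
  have "compact_space (product_topology (\<lambda>_. euclidean :: 'a topology) (UNIV :: nat set))"
    unfolding compact_space_product_topology using assms
    by (simp add: compact_space_def)
  then show ?thesis by (simp add: euclidean_product_topology compact_space_def)
qed

lemma compact_graph:
  fixes T :: "'a::metric_space \<Rightarrow> 'a set"
  assumes "compact (UNIV :: 'a set)" "correspondence T"
  shows "compact (graph T)"
proof -
  have "compact (UNIV :: ('a \<times> 'a) set)"
    using compact_Times[OF assms(1) assms(1)] by simp
  then show ?thesis
    using assms(2) compact_Int_closed unfolding correspondence_def by fastforce
qed

lemma closed_orbit_space: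
  fixes T :: "'a::metric_space \<Rightarrow> 'a set"
  assumes "correspondence T"
  shows "closed (orbit_space T)"
proof -
  have "orbit_space T = (\<Inter>j. (\<lambda>x. (x j, x (Suc j))) -` graph T)"
    by (auto simp: orbit_space_def graph_def)
  moreover have "closed ((\<lambda>x::nat \<Rightarrow> 'a. (x j, x (Suc j))) -` graph T)" for j
    using assms unfolding correspondence_def
    by (intro closed_vimage continuous_on_Pair continuous_on_product_coordinates) auto
  ultimately show ?thesis by auto
qed

text \<open>By compactness of the space of pairs of infinite orbits, expansiveness is uniform: two orbits
  that stay \<open>\<epsilon>\<close>-close during a suitable number \<open>m\<close> of steps start \<open>\<eta>\<close>-close, where \<open>\<epsilon>\<close> is an
  expansivity constant and \<open>\<eta>\<close> is arbitrary.\<close>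

lemma expansive_uniform:
  fixes T :: "'a::metric_space \<Rightarrow> 'a set"
  assumes "compact (UNIV :: 'a set)" "correspondence T" "0 < \<eta>"
    and exp: "\<forall>x\<in>orbit_space T. \<forall>y\<in>orbit_space T. x \<noteq> y \<longrightarrow> (\<exists>j. dist (x j) (y j) > \<epsilon>)"
  obtains m where "\<forall>x\<in>orbit_space T. \<forall>y\<in>orbit_space T.
      (\<forall>j\<le>m. dist (x j) (y j) \<le> \<epsilon>) \<longrightarrow> dist (x 0) (y 0) \<le> \<eta>"
proof -
  let ?\<Omega> = "orbit_space T"
  define G where "G m = {p :: (nat \<Rightarrow> 'a) \<times> (nat \<Rightarrow> 'a).
      dist (fst p m) (snd p m) \<le> \<epsilon> \<and> \<eta> \<le> dist (fst p 0) (snd p 0)}" for m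
  have c1: "continuous_on UNIV (\<lambda>p :: (nat \<Rightarrow> 'a) \<times> (nat \<Rightarrow> 'a). fst p j)" for j
    using continuous_on_compose[OF continuous_on_fst[OF continuous_on_id]
        continuous_on_subset[OF continuous_on_product_coordinates[of j] subset_UNIV]]
    by (simp add: o_def)
  have c2: "continuous_on UNIV (\<lambda>p :: (nat \<Rightarrow> 'a) \<times> (nat \<Rightarrow> 'a). snd p j)" for j
    using continuous_on_compose[OF continuous_on_snd[OF continuous_on_id]
        continuous_on_subset[OF continuous_on_product_coordinates[of j] subset_UNIV]]
    by (simp add: o_def)
  have cont: "continuous_on UNIV (\<lambda>p :: (nat \<Rightarrow> 'a) \<times> (nat \<Rightarrow> 'a). dist (fst p j) (snd p j))" for j
    by (intro continuous_on_dist c1 c2)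
  have clG: "closed (G m)" for m
    unfolding G_def by (intro closed_Collect_conj closed_Collect_le cont continuous_on_const)
  have "compact (UNIV :: ((nat \<Rightarrow> 'a) \<times> (nat \<Rightarrow> 'a)) set)"
    using compact_Times[OF compact_fun_UNIV[OF assms(1)] compact_fun_UNIV[OF assms(1)]] by simp
  then have "compact (UNIV \<inter> (?\<Omega> \<times> ?\<Omega>))"
    by (rule compact_Int_closed[OF _ closed_Times])
      (rule closed_orbit_space[OF assms(2)])+
  then have cp: "compact (?\<Omega> \<times> ?\<Omega>)" by simp
  have "(?\<Omega> \<times> ?\<Omega>) \<inter> (\<Inter>m\<in>UNIV. G m) = {}"
  proof (rule ccontr)
    assume "(?\<Omega> \<times> ?\<Omega>) \<inter> (\<Inter>m\<in>UNIV. G m) \<noteq> {}"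
    then obtain x y where "x \<in> ?\<Omega>" "y \<in> ?\<Omega>" and *: "\<And>m. (x, y) \<in> G m" by auto
    then have "\<And>j. dist (x j) (y j) \<le> \<epsilon>" "\<eta> \<le> dist (x 0) (y 0)" by (auto simp: G_def)
    moreover from this have "x \<noteq> y" using assms(3) by auto
    ultimately show False
      using exp \<open>x \<in> ?\<Omega>\<close> \<open>y \<in> ?\<Omega>\<close> by (meson not_le)
  qed
  then obtain I where I: "finite I" "(?\<Omega> \<times> ?\<Omega>) \<inter> (\<Inter>m\<in>I. G m) = {}"
    using compact_imp_fip_image[OF cp, of UNIV G] clG by blast
  define m where "m = Max (insert 0 I)"
  show ?thesis
  proof (rule that[of m], intro ballI impI, rule ccontr)
    fix x y assume xy: "x \<in> ?\<Omega>" "y \<in> ?\<Omega>" "\<forall>j\<le>m. dist (x j) (y j) \<le> \<epsilon>"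
      and "\<not> dist (x 0) (y 0) \<le> \<eta>"
    then have "(x, y) \<in> (\<Inter>i\<in>I. G i)"
      using I(1) by (auto simp: G_def m_def)
    then show False using I(2) xy by blast
  qed
qed

lemma orbit_sum_cong:
  assumes "\<And>j. j \<le> n \<Longrightarrow> x j = y j" shows "orbit_sum \<phi> n x = orbit_sum \<phi> n y"
  using assms unfolding orbit_sum_def by (intro sum.cong) auto

lemma orbit_sum_add: "orbit_sum \<phi> (n + m) x = orbit_sum \<phi> n x + orbit_sum \<phi> m (\<lambda>j. x (n + j))"
  unfolding orbit_sum_def by (induction m) (auto simp: add.assoc)

text \<open>Extending the orbits of an \<open>\<eta>\<close>-separated set by \<open>m\<close> steps makes it \<open>\<epsilon>\<close>-separated. So on an
  exponential scale the partition sums do not depend on the resolution below an expansivity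
  constant.\<close>

lemma sep_sup_refine:
  fixes T :: "'a::metric_space \<Rightarrow> 'a set"
  assumes "compact (UNIV :: 'a set)" "correspondence T" "0 < \<epsilon>"
    and M: "\<forall>p\<in>graph T. \<bar>\<phi> p\<bar> \<le> M"
    and m: "\<forall>x\<in>orbit_space T. \<forall>y\<in>orbit_space T.
      (\<forall>j\<le>m. dist (x j) (y j) \<le> \<epsilon>) \<longrightarrow> dist (x 0) (y 0) \<le> \<eta>"
  shows "sep_sup T n \<eta> (orbit_sum \<phi> n) \<le>
    exp (m * M) * sep_sup T (n + m) \<epsilon> (orbit_sum \<phi> (n + m))"
proof (rule sep_sup_least)
  fix C assume C: "separated T n \<eta> C"
  have "\<exists>\<omega>. \<omega> \<in> orbit_space T \<and> (\<forall>j\<le>n. \<omega> j = x j)" if "x \<in> C" for x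
  proof -
    have "x \<in> orbits T n" using C that by (auto simp: separated_def)
    then show ?thesis by (rule orbit_extend[OF assms(2)]) blast
  qed
  then obtain e where e: "\<And>x. x \<in> C \<Longrightarrow> e x \<in> orbit_space T"
      "\<And>x j. x \<in> C \<Longrightarrow> j \<le> n \<Longrightarrow> e x j = x j" by metis
  define g where "g x = restrict (e x) {..n + m}" for x
  have sep: "orbit_dist (n + m) (g x) (g y) > \<epsilon>" if xy: "x \<in> C" "y \<in> C" "x \<noteq> y" for x y
  proof (rule ccontr)
    assume "\<not> orbit_dist (n + m) (g x) (g y) > \<epsilon>"
    then have le: "dist (e x j) (e y j) \<le> \<epsilon>" if "j \<le> n + m" for j
      using that by (simp add: orbit_dist_le_iff not_less g_def)
    obtain j where j: "j \<le> n" "dist (x j) (y j) > \<eta>"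
      using C xy unfolding separated_def orbit_dist_gr_iff by blast
    have sh: "(\<lambda>i. e z (j + i)) \<in> orbit_space T" if "z \<in> C" for z
      using e(1)[OF that] by (simp add: orbit_space_def)
    have "dist (e x (j + 0)) (e y (j + 0)) \<le> \<eta>"
      using m sh[OF xy(1)] sh[OF xy(2)] le j(1) by fastforce
    then show False using j e(2)[OF xy(1)] e(2)[OF xy(2)] by simp
  qed
  have inj: "inj_on g C"
  proof (rule inj_onI, rule ccontr)
    fix x y assume "x \<in> C" "y \<in> C" "g x = g y" "x \<noteq> y"
    then show False using sep[of x y] assms(3) by (auto simp: orbit_dist_gr_iff)
  qed
  have sepg: "separated T (n + m) \<epsilon> (g ` C)"
    unfolding separated_def using sep e(1) by (auto simp: g_def intro: orbit_truncate)
  have b: "orbit_sum \<phi> k x \<le> k * M" if "x \<in> orbits T k" for x k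
    using orbit_sum_bound[OF M that] by simp
  have "orbit_sum \<phi> n x \<le> m * M + orbit_sum \<phi> (n + m) (g x)" if x: "x \<in> C" for x
  proof -
    have "orbit_sum \<phi> (n + m) (g x) = orbit_sum \<phi> (n + m) (e x)"
      by (intro orbit_sum_cong) (simp add: g_def)
    also have "\<dots> = orbit_sum \<phi> n (e x) + orbit_sum \<phi> m (\<lambda>j. e x (n + j))"
      by (rule orbit_sum_add)
    also have "orbit_sum \<phi> n (e x) = orbit_sum \<phi> n x"
      using e(2)[OF x] by (intro orbit_sum_cong) simp
    also have "orbit_sum \<phi> m (\<lambda>j. e x (n + j)) =
        orbit_sum \<phi> m (restrict (\<lambda>j. e x (n + j)) {..m})"
      by (intro orbit_sum_cong) simp
    finally show ?thesis
      using orbit_sum_bound[OF M orbit_truncate, of "\<lambda>j. e x (n + j)" m] e(1)[OF x]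
      by (simp add: orbit_space_def)
  qed
  then have "(\<Sum>x\<in>C. exp (orbit_sum \<phi> n x)) \<le>
      (\<Sum>x\<in>C. exp (m * M) * exp (orbit_sum \<phi> (n + m) (g x)))"
    by (intro sum_mono) (simp flip: exp_add)
  also have "\<dots> = exp (m * M) * (\<Sum>x\<in>g ` C. exp (orbit_sum \<phi> (n + m) x))"
    by (simp add: sum_distrib_left sum.reindex[OF inj])
  also have "\<dots> \<le> exp (m * M) * sep_sup T (n + m) \<epsilon> (orbit_sum \<phi> (n + m))"
    using sep_sup_upper[OF assms(1,3), of T "n + m" "orbit_sum \<phi> (n + m)", OF b sepg] by simp
  finally show "(\<Sum>x\<in>C. exp (orbit_sum \<phi> n x)) \<le>
      exp (m * M) * sep_sup T (n + m) \<epsilon> (orbit_sum \<phi> (n + m))" .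
qed

section \<open>Weighted covers of the orbit space\<close>

text \<open>A bound for a partition sum over orbits of length \<open>n + m\<close> by a product of partition sums has to
  replace the two pieces of each orbit by nearby orbits of separated sets, which changes the resolution
  and costs a factor at each step. Covers are submultiplicative at a fixed resolution:
  \<open>c\<close> sorts the orbits of length \<open>n\<close> into finitely many classes of diameter at most \<open>\<epsilon>\<close>, labelled by
  natural numbers in \<open>I\<close>, and \<open>w i\<close> bounds the exponential of the Birkhoff sum on class \<open>i\<close>.\<close>

definition weighted_cover ::
    "('a::metric_space \<Rightarrow> 'a set) \<Rightarrow> ('a \<times> 'a \<Rightarrow> real) \<Rightarrow> real \<Rightarrow> nat \<Rightarrow>
     ((nat \<Rightarrow> 'a) \<Rightarrow> nat) \<Rightarrow> (nat \<Rightarrow> real) \<Rightarrow> nat set \<Rightarrow> bool" where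
  "weighted_cover T \<phi> \<epsilon> n c w I \<longleftrightarrow>
     finite I \<and> (\<forall>i\<in>I. 0 \<le> w i) \<and>
     (\<forall>x\<in>orbits T n. c x \<in> I \<and> exp (orbit_sum \<phi> n x) \<le> w (c x)) \<and>
     (\<forall>x\<in>orbits T n. \<forall>y\<in>orbits T n. c x = c y \<longrightarrow> orbit_dist n x y \<le> \<epsilon>)"

text \<open>There is a weighted cover of total weight at most \<open>W\<close>.\<close>

definition orbit_cover ::
    "('a::metric_space \<Rightarrow> 'a set) \<Rightarrow> ('a \<times> 'a \<Rightarrow> real) \<Rightarrow> real \<Rightarrow> nat \<Rightarrow> real \<Rightarrow> bool" where
  "orbit_cover T \<phi> \<epsilon> n W \<longleftrightarrow> (\<exists>c w I. weighted_cover T \<phi> \<epsilon> n c w I \<and> sum w I \<le> W)"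

lemma weighted_coverD:
  assumes "weighted_cover T \<phi> \<epsilon> n c w I"
  shows "finite I" "i \<in> I \<Longrightarrow> 0 \<le> w i"
    "x \<in> orbits T n \<Longrightarrow> c x \<in> I" "x \<in> orbits T n \<Longrightarrow> exp (orbit_sum \<phi> n x) \<le> w (c x)"
    "x \<in> orbits T n \<Longrightarrow> y \<in> orbits T n \<Longrightarrow> c x = c y \<Longrightarrow> orbit_dist n x y \<le> \<epsilon>"
  using assms unfolding weighted_cover_def by simp_all

text \<open>A separated set contains at most one orbit of each class.\<close>

lemma orbit_cover_bounds_sep_sup:
  assumes "orbit_cover T \<phi> \<epsilon> n W"
  shows "sep_sup T n \<epsilon> (orbit_sum \<phi> n) \<le> W"
proof (rule sep_sup_least)
  fix C assume C: "separated T n \<epsilon> C"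
  obtain c w I where cov: "weighted_cover T \<phi> \<epsilon> n c w I" "sum w I \<le> W"
    using assms unfolding orbit_cover_def by blast
  note c = weighted_coverD[OF cov(1)]
  have CO: "\<And>x. x \<in> C \<Longrightarrow> x \<in> orbits T n" using C by (auto simp: separated_def)
  have inj: "inj_on c C"
    using C c(5) CO unfolding separated_def inj_on_def by (meson not_le)
  have "(\<Sum>x\<in>C. exp (orbit_sum \<phi> n x)) \<le> (\<Sum>x\<in>C. w (c x))"
    using c(4) CO by (intro sum_mono) auto
  also have "\<dots> = sum w (c ` C)" by (simp add: sum.reindex[OF inj])
  also have "\<dots> \<le> sum w I" using c(1,2,3) CO by (intro sum_mono2) auto
  finally show "(\<Sum>x\<in>C. exp (orbit_sum \<phi> n x)) \<le> W" using cov(2) by linarith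
qed

text \<open>Classify an orbit of length \<open>n + m\<close> by the classes of its two pieces.\<close>

lemma orbit_cover_mult:
  assumes "orbit_cover T \<phi> \<epsilon> n W" "orbit_cover T \<phi> \<epsilon> m V"
  shows "orbit_cover T \<phi> \<epsilon> (n + m) (W * V)"
proof -
  obtain c w I where cov1: "weighted_cover T \<phi> \<epsilon> n c w I" "sum w I \<le> W"
    using assms(1) unfolding orbit_cover_def by blast
  note c = weighted_coverD[OF cov1(1)]
  obtain d v J where cov2: "weighted_cover T \<phi> \<epsilon> m d v J" "sum v J \<le> V"
    using assms(2) unfolding orbit_cover_def by blast
  note d = weighted_coverD[OF cov2(1)]
  define h t where "h x = restrict x {..n}" and "t x = restrict (\<lambda>j. x (n + j)) {..m}"
    for x :: "nat \<Rightarrow> 'a"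
  have h: "h x \<in> orbits T n" and t: "t x \<in> orbits T m" if "x \<in> orbits T (n + m)" for x
  proof -
    have "\<forall>j<n + m. x (Suc j) \<in> T (x j)" using that by (simp add: orbits_def)
    then have "\<And>j. j < n \<Longrightarrow> x (Suc j) \<in> T (x j)" "\<And>j. j < m \<Longrightarrow> x (n + Suc j) \<in> T (x (n + j))"
      by simp_all
    then show "h x \<in> orbits T n" "t x \<in> orbits T m"
      unfolding orbits_def h_def t_def mem_Collect_eq restrict_PiE_iff
      by (simp_all add: Suc_le_eq)
  qed
  define c' where "c' x = prod_encode (c (h x), d (t x))" for x
  define w' where "w' i = (case prod_decode i of (a, b) \<Rightarrow> w a * v b)" for i
  have "sum w' (prod_encode ` (I \<times> J)) = (\<Sum>i\<in>I \<times> J. w' (prod_encode i))"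
    by (simp add: sum.reindex[OF inj_on_subset[OF inj_prod_encode subset_UNIV]])
  also have "\<dots> = (\<Sum>(a,b)\<in>I \<times> J. w a * v b)"
    by (intro sum.cong) (auto simp: w'_def)
  also have "\<dots> = sum w I * sum v J"
    unfolding sum_product sum.cartesian_product ..
  also have "\<dots> \<le> W * V"
  proof (rule mult_mono)
    have "0 \<le> sum w I" using c(2) by (rule sum_nonneg)
    then show "0 \<le> W" using cov1(2) by linarith
    show "0 \<le> sum v J" using d(2) by (rule sum_nonneg)
  qed (fact cov1(2) cov2(2))+
  finally have s: "sum w' (prod_encode ` (I \<times> J)) \<le> W * V" .
  have e: "exp (orbit_sum \<phi> (n + m) x) \<le> w' (c' x)" if x: "x \<in> orbits T (n + m)" for x
  proof -
    have "orbit_sum \<phi> (n + m) x = orbit_sum \<phi> n (h x) + orbit_sum \<phi> m (t x)"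
      unfolding orbit_sum_add by (intro arg_cong2[of _ _ _ _ "(+)"] orbit_sum_cong) (auto simp: h_def t_def)
    then have "exp (orbit_sum \<phi> (n + m) x) = exp (orbit_sum \<phi> n (h x)) * exp (orbit_sum \<phi> m (t x))"
      by (simp add: exp_add)
    also have "\<dots> \<le> w (c (h x)) * v (d (t x))"
      using c(4)[OF h[OF x]] d(4)[OF t[OF x]] c(2)[OF c(3)[OF h[OF x]]] by (intro mult_mono) auto
    finally show ?thesis by (simp add: w'_def c'_def)
  qed
  have dd: "orbit_dist (n + m) x y \<le> \<epsilon>"
    if x: "x \<in> orbits T (n + m)" and y: "y \<in> orbits T (n + m)" and eq: "c' x = c' y" for x y
  proof -
    have "c (h x) = c (h y)" "d (t x) = d (t y)" using eq by (auto simp: c'_def prod_encode_eq)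
    then have "orbit_dist n (h x) (h y) \<le> \<epsilon>" "orbit_dist m (t x) (t y) \<le> \<epsilon>"
      using c(5) d(5) h t x y by auto
    then have A: "\<And>j. j \<le> n \<Longrightarrow> dist (x j) (y j) \<le> \<epsilon>"
      and B: "\<And>j. j \<le> m \<Longrightarrow> dist (x (n + j)) (y (n + j)) \<le> \<epsilon>"
      by (auto simp: orbit_dist_le_iff h_def t_def)
    show ?thesis unfolding orbit_dist_le_iff
    proof (intro allI impI)
      fix j assume "j \<le> n + m"
      then show "dist (x j) (y j) \<le> \<epsilon>"
        using A[of j] B[of "j - n"] by (cases "j \<le> n") auto
    qed
  qed
  have "weighted_cover T \<phi> \<epsilon> (n + m) c' w' (prod_encode ` (I \<times> J))"
    unfolding weighted_cover_def
  proof (intro conjI ballI impI)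
    show "finite (prod_encode ` (I \<times> J))" using c(1) d(1) by simp
    show "0 \<le> w' i" if "i \<in> prod_encode ` (I \<times> J)" for i
      using that c(2) d(2) by (auto simp: w'_def)
    show "c' x \<in> prod_encode ` (I \<times> J)" if "x \<in> orbits T (n + m)" for x
      using c(3)[OF h[OF that]] d(3)[OF t[OF that]] by (auto simp: c'_def)
    show "exp (orbit_sum \<phi> (n + m) x) \<le> w' (c' x)" if "x \<in> orbits T (n + m)" for x
      by (rule e[OF that])
    show "orbit_dist (n + m) x y \<le> \<epsilon>"
      if "x \<in> orbits T (n + m)" "y \<in> orbits T (n + m)" "c' x = c' y" for x y
      by (rule dd[OF that])
  qed
  then show ?thesis using s unfolding orbit_cover_def by blast
qed

lemma orbit_cover_power:
  assumes "orbit_cover T \<phi> \<epsilon> r V" "orbit_cover T \<phi> \<epsilon> n W"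
  shows "orbit_cover T \<phi> \<epsilon> (r + k * n) (V * W ^ k)"
proof (induction k)
  case (Suc k)
  have "r + Suc k * n = r + k * n + n" "V * W ^ Suc k = V * W ^ k * W" by simp_all
  then show ?case using orbit_cover_mult[OF Suc assms(2)] by (simp only:)
qed (use assms(1) in simp)

text \<open>A separated set of maximal cardinality is spanning, so it provides a cover whose weight is at most a
  partition sum at half the resolution, up to the oscillation \<open>\<omega>\<close> of \<open>\<phi>\<close> at each step.\<close>

lemma orbit_cover_exists:
  fixes T :: "'a::metric_space \<Rightarrow> 'a set"
  assumes "compact (UNIV :: 'a set)" "0 < \<epsilon>"
    and M: "\<forall>p\<in>graph T. \<bar>\<phi> p\<bar> \<le> M"
    and \<omega>: "\<And>x y x' y'. (x, y) \<in> graph T \<Longrightarrow> (x', y') \<in> graph T \<Longrightarrow>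
        dist x x' \<le> \<epsilon> / 2 \<Longrightarrow> dist y y' \<le> \<epsilon> / 2 \<Longrightarrow> \<phi> (x, y) \<le> \<omega> + \<phi> (x', y')"
  shows "orbit_cover T \<phi> \<epsilon> n (exp (n * \<omega>) * sep_sup T n (\<epsilon> / 2) (orbit_sum \<phi> n))"
proof -
  obtain N where N: "\<And>C. separated T n (\<epsilon> / 2) C \<Longrightarrow> finite C \<and> card C \<le> N"
    using separated_finite[OF assms(1), of "\<epsilon> / 2" T n] assms(2) by auto
  have "separated T n (\<epsilon> / 2) {}" by (simp add: separated_def)
  then obtain F where F: "separated T n (\<epsilon> / 2) F"
    and max: "\<And>C. separated T n (\<epsilon> / 2) C \<Longrightarrow> card C \<le> card F"
    using ex_has_greatest_nat[of "separated T n (\<epsilon> / 2)" "{}" card "Suc N"] N le_imp_less_Suc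
    by blast
  have fF: "finite F" using F N by blast
  have "\<exists>u\<in>F. orbit_dist n x u \<le> \<epsilon> / 2" if x: "x \<in> orbits T n" for x
  proof (rule ccontr)
    assume neg: "\<not> (\<exists>u\<in>F. orbit_dist n x u \<le> \<epsilon> / 2)"
    have sym: "orbit_dist n y x = orbit_dist n x y" for y
      by (simp add: orbit_dist_def dist_commute)
    have "orbit_dist n x x \<le> \<epsilon> / 2" using assms(2) unfolding orbit_dist_le_iff by simp
    then have "x \<notin> F" using neg by blast
    moreover have "separated T n (\<epsilon> / 2) (insert x F)"
      unfolding separated_def
    proof (intro conjI ballI impI)
      show "insert x F \<subseteq> orbits T n" using F x by (simp add: separated_def)
      fix y z assume "y \<in> insert x F" "z \<in> insert x F" "y \<noteq> z"
      then consider "y \<in> F" "z \<in> F" | "y = x" "z \<in> F" | "y \<in> F" "z = x" by blast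
      then show "\<epsilon> / 2 < orbit_dist n y z"
      proof cases
        case 1 then show ?thesis using F \<open>y \<noteq> z\<close> by (simp add: separated_def)
      next
        case 2 then show ?thesis using neg by (meson not_le)
      next
        case 3 then show ?thesis using neg sym[of y] by (metis not_le)
      qed
    qed
    ultimately show False using max[of "insert x F"] fF by simp
  qed
  then obtain u where u: "\<And>x. x \<in> orbits T n \<Longrightarrow> u x \<in> F"
    "\<And>x. x \<in> orbits T n \<Longrightarrow> orbit_dist n x (u x) \<le> \<epsilon> / 2" by metis
  let ?c = "to_nat_on F" and ?f = "from_nat_into F"
  have cF: "countable F" using fF by (rule countable_finite)
  have inj: "inj_on ?c F" using cF by (rule inj_on_to_nat_on)
  have fc: "?f (?c v) = v" if "v \<in> F" for v using from_nat_into_to_nat_on[OF cF that] .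
  have FO: "v \<in> orbits T n" if "v \<in> F" for v using F that by (auto simp: separated_def)
  have le: "exp (orbit_sum \<phi> n x) \<le> exp (n * \<omega>) * exp (orbit_sum \<phi> n (u x))"
    if x: "x \<in> orbits T n" for x
  proof -
    have d: "\<And>j. j \<le> n \<Longrightarrow> dist (x j) (u x j) \<le> \<epsilon> / 2"
      using u(2)[OF x] unfolding orbit_dist_le_iff by blast
    have "orbit_sum \<phi> n x \<le> (\<Sum>j<n. \<omega> + \<phi> (u x j, u x (Suc j)))"
      unfolding orbit_sum_def using d x FO[OF u(1)[OF x]]
      by (intro sum_mono \<omega>) (auto intro: orbit_step_in_graph)
    also have "\<dots> = n * \<omega> + orbit_sum \<phi> n (u x)"
      by (simp add: sum.distrib orbit_sum_def)
    finally show ?thesis by (simp flip: exp_add)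
  qed
  have b: "orbit_sum \<phi> n x \<le> n * M" if "x \<in> orbits T n" for x
    using orbit_sum_bound[OF M that] by simp
  have h2: "0 < \<epsilon> / 2" using assms(2) by simp
  define w where "w i = exp (n * \<omega>) * exp (orbit_sum \<phi> n (?f i))" for i
  have cov: "weighted_cover T \<phi> \<epsilon> n (\<lambda>x. ?c (u x)) w (?c ` F)"
    unfolding weighted_cover_def
  proof (intro conjI ballI impI)
    show "orbit_dist n x y \<le> \<epsilon>"
      if x: "x \<in> orbits T n" and y: "y \<in> orbits T n" and eq: "?c (u x) = ?c (u y)" for x y
    proof -
      have "u x = u y" using inj eq u(1) x y by (auto dest: inj_onD)
      then have "\<And>j. j \<le> n \<Longrightarrow> dist (x j) (u x j) \<le> \<epsilon> / 2" "\<And>j. j \<le> n \<Longrightarrow> dist (y j) (u x j) \<le> \<epsilon> / 2"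
        using u(2)[OF x] u(2)[OF y] unfolding orbit_dist_le_iff by auto
      then have "dist (x j) (y j) \<le> \<epsilon>" if "j \<le> n" for j
        using dist_triangle2[of "x j" "y j" "u x j"] that by fastforce
      then show ?thesis by (simp add: orbit_dist_le_iff)
    qed
    show "exp (orbit_sum \<phi> n x) \<le> w (?c (u x))" if "x \<in> orbits T n" for x
      using le[OF that] fc[OF u(1)[OF that]] by (simp add: w_def)
  qed (use fF u(1) in \<open>simp_all add: w_def\<close>)
  have "(\<Sum>i\<in>?c ` F. w i) = exp (n * \<omega>) * (\<Sum>v\<in>F. exp (orbit_sum \<phi> n v))"
    using fc by (simp add: w_def sum.reindex[OF inj] sum_distrib_left)
  also have "\<dots> \<le> exp (n * \<omega>) * sep_sup T n (\<epsilon> / 2) (orbit_sum \<phi> n)"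
    using sep_sup_upper[OF assms(1) h2, of T n "orbit_sum \<phi> n", OF b F] by simp
  finally have "(\<Sum>i\<in>?c ` F. w i) \<le> exp (n * \<omega>) * sep_sup T n (\<epsilon> / 2) (orbit_sum \<phi> n)" .
  then show ?thesis using cov unfolding orbit_cover_def by blast
qed

section \<open>The linear pressure as a limit\<close>

lemma bounded_seq_liminf:
  fixes a :: "nat \<Rightarrow> real"
  assumes "\<forall>n\<ge>1. \<bar>a n\<bar> \<le> B"
  shows "\<exists>p. (\<forall>\<kappa>>0. \<forall>\<^sub>F n in sequentially. p - \<kappa> < a n) \<and>
             (\<forall>\<kappa>>0. \<exists>\<^sub>F n in sequentially. a n < p + \<kappa>)"
proof -
  define S where "S = {q. \<forall>\<^sub>F n in sequentially. q \<le> a n}"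
  have ev: "\<forall>\<^sub>F n in sequentially. \<bar>a n\<bar> \<le> B"
    using assms eventually_sequentially by blast
  have "- B \<in> S" unfolding S_def mem_Collect_eq by (rule eventually_mono[OF ev]) linarith
  moreover have "q \<le> B" if "q \<in> S" for q
  proof -
    have "\<forall>\<^sub>F n in sequentially. q \<le> a n \<and> \<bar>a n\<bar> \<le> B"
      using that ev unfolding S_def by (simp add: eventually_conj)
    from eventually_happens'[OF sequentially_bot this] obtain n where "q \<le> a n \<and> \<bar>a n\<bar> \<le> B" ..
    then show ?thesis by linarith
  qed
  ultimately have ne: "S \<noteq> {}" and bdd: "bdd_above S" by (auto simp: bdd_above_def)
  show ?thesis
  proof (intro exI[of _ "Sup S"] conjI allI impI)
    fix \<kappa> :: real assume k: "0 < \<kappa>"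
    obtain q where "q \<in> S" "Sup S - \<kappa> < q"
      using less_cSupD[OF ne, of "Sup S - \<kappa>"] k by auto
    then show "\<forall>\<^sub>F n in sequentially. Sup S - \<kappa> < a n"
      unfolding S_def by (auto elim: eventually_mono)
  next
    fix \<kappa> :: real assume k: "0 < \<kappa>"
    show "\<exists>\<^sub>F n in sequentially. a n < Sup S + \<kappa>"
    proof (rule ccontr)
      assume "\<not> (\<exists>\<^sub>F n in sequentially. a n < Sup S + \<kappa>)"
      then have "Sup S + \<kappa> \<in> S" by (simp add: S_def frequently_def not_less)
      then show False using cSup_upper[OF _ bdd] k by fastforce
    qed
  qed
qed

text \<open>Concatenating copies of one cover of length \<open>n\<close>, preceded by a cover of length \<open>N mod n\<close>,
  bounds the growth rate at resolution \<open>\<epsilon>\<close> by any single term at resolution \<open>\<epsilon> / 2\<close>.\<close>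

lemma sep_sup_growth_bound:
  fixes T :: "'a::metric_space \<Rightarrow> 'a set"
  assumes "compact (UNIV :: 'a set)" "correspondence T" "0 < \<epsilon>"
    and M: "\<forall>p\<in>graph T. \<bar>\<phi> p\<bar> \<le> M"
    and \<omega>: "\<And>x y x' y'. (x, y) \<in> graph T \<Longrightarrow> (x', y') \<in> graph T \<Longrightarrow>
        dist x x' \<le> \<epsilon> / 2 \<Longrightarrow> dist y y' \<le> \<epsilon> / 2 \<Longrightarrow> \<phi> (x, y) \<le> \<omega> + \<phi> (x', y')"
    and n: "0 < n"
  obtains K where "\<And>N. 0 < N \<Longrightarrow> ln (sep_sup T N \<epsilon> (orbit_sum \<phi> N)) / N \<le>
     \<omega> + ln (sep_sup T n (\<epsilon> / 2) (orbit_sum \<phi> n)) / n + K / N"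
proof -
  define V where "V r = exp (real r * \<omega>) * sep_sup T r (\<epsilon> / 2) (orbit_sum \<phi> r)" for r
  have h: "0 < \<epsilon> / 2" using assms(3) by simp
  have pos: "0 < sep_sup T r e (orbit_sum \<phi> r)" if "0 < e" for r e
    using sep_sup_orbit_sum_ge[OF assms(1,2) that M, of r] exp_gt_zero by (rule less_le_trans[rotated])
  have Vpos: "0 < V r" for r using pos[OF h] by (simp add: V_def)
  have cov: "orbit_cover T \<phi> \<epsilon> r (V r)" for r
    unfolding V_def using orbit_cover_exists[OF assms(1,3) M \<omega>] by blast
  define L where "L = (\<Sum>r<n. \<bar>ln (V r)\<bar>) + \<bar>ln (V n)\<bar>"
  show ?thesis
  proof (rule that[of L])
    fix N :: nat assume N: "0 < N"
    define k r where "k = N div n" and "r = N mod n"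
    have Nkr: "N = r + k * n" by (simp add: k_def r_def)
    have r: "r < n" using n by (simp add: r_def)
    have "sep_sup T N \<epsilon> (orbit_sum \<phi> N) \<le> V r * V n ^ k"
      using orbit_cover_bounds_sep_sup[OF orbit_cover_power[OF cov cov, of r k n]] Nkr by simp
    then have "ln (sep_sup T N \<epsilon> (orbit_sum \<phi> N)) \<le> ln (V r * V n ^ k)"
      using pos[OF assms(3), of N] Vpos by (subst ln_le_cancel_iff) simp_all
    also have "\<dots> = ln (V r) + real k * ln (V n)"
      using Vpos[of r] Vpos[of n] by (simp add: ln_mult ln_realpow)
    finally have 1: "ln (sep_sup T N \<epsilon> (orbit_sum \<phi> N)) \<le> ln (V r) + real k * ln (V n)" .
    have "\<bar>ln (V r)\<bar> \<le> (\<Sum>r<n. \<bar>ln (V r)\<bar>)"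
      using r by (intro member_le_sum) auto
    then have 2: "ln (V r) \<le> (\<Sum>r<n. \<bar>ln (V r)\<bar>)" by linarith
    have "real k * ln (V n) = real N * (ln (V n) / n) - real r * (ln (V n) / n)"
      using n Nkr by (simp add: field_simps)
    moreover have "- (real r * (ln (V n) / n)) \<le> \<bar>ln (V n)\<bar>"
    proof -
      have "\<bar>real r * (ln (V n) / n)\<bar> = (real r / n) * \<bar>ln (V n)\<bar>" by (simp add: abs_mult)
      also have "\<dots> \<le> 1 * \<bar>ln (V n)\<bar>" using r n by (intro mult_right_mono) auto
      finally show ?thesis by linarith
    qed
    ultimately have "ln (sep_sup T N \<epsilon> (orbit_sum \<phi> N)) \<le> L + real N * (ln (V n) / n)"
      using 1 2 unfolding L_def by linarith
    then have "ln (sep_sup T N \<epsilon> (orbit_sum \<phi> N)) / N \<le> (L + real N * (ln (V n) / n)) / N"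
      by (intro divide_right_mono) auto
    also have "\<dots> = ln (V n) / n + L / N" using N by (simp add: field_simps)
    also have "ln (V n) / n = \<omega> + ln (sep_sup T n (\<epsilon> / 2) (orbit_sum \<phi> n)) / n"
      unfolding V_def using n pos[OF h, of n] by (simp add: ln_mult field_simps)
    finally show "ln (sep_sup T N \<epsilon> (orbit_sum \<phi> N)) / N \<le>
       \<omega> + ln (sep_sup T n (\<epsilon> / 2) (orbit_sum \<phi> n)) / n + L / N" .
  qed
qed

lemma graph_modulus:
  fixes T :: "'a::metric_space \<Rightarrow> 'a set" and \<phi> :: "'a \<times> 'a \<Rightarrow> real"
  assumes "compact (graph T)" "continuous_on (graph T) \<phi>" "0 < \<omega>"
  obtains d where "0 < d" "\<And>x y x' y'. (x, y) \<in> graph T \<Longrightarrow> (x', y') \<in> graph T \<Longrightarrow>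
        dist x x' \<le> d \<Longrightarrow> dist y y' \<le> d \<Longrightarrow> \<phi> (x, y) \<le> \<omega> + \<phi> (x', y')"
proof -
  have "uniformly_continuous_on (graph T) \<phi>"
    by (rule compact_uniformly_continuous[OF assms(2,1)])
  then obtain e where e: "0 < e" "\<And>p q. p \<in> graph T \<Longrightarrow> q \<in> graph T \<Longrightarrow> dist q p < e \<Longrightarrow>
      dist (\<phi> q) (\<phi> p) < \<omega>"
    unfolding uniformly_continuous_on_def using assms(3) by metis
  show ?thesis
  proof (rule that[of "e / 3"])
    fix x y x' y' assume g: "(x, y) \<in> graph T" "(x', y') \<in> graph T"
      and d: "dist x x' \<le> e / 3" "dist y y' \<le> e / 3"
    have "dist (x, y) (x', y') \<le> dist x x' + dist y y'"
      unfolding dist_Pair_Pair by (rule sqrt_sum_squares_le_sum) auto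
    also have "\<dots> < e" using d e(1) by linarith
    finally show "\<phi> (x, y) \<le> \<omega> + \<phi> (x', y')"
      using e(2)[OF g(2,1)] by (simp add: dist_real_def)
  qed (use e(1) in simp)
qed

lemma graph_bound:
  fixes T :: "'a::metric_space \<Rightarrow> 'a set" and \<phi> :: "'a \<times> 'a \<Rightarrow> real"
  assumes "compact (graph T)" "continuous_on (graph T) \<phi>"
  obtains M where "0 \<le> M" "\<forall>p\<in>graph T. \<bar>\<phi> p\<bar> \<le> M"
proof -
  have "bounded (\<phi> ` graph T)"
    using compact_continuous_image[OF assms(2,1)] by (rule compact_imp_bounded)
  then obtain M where "\<forall>x\<in>\<phi> ` graph T. norm x \<le> M" unfolding bounded_iff by blast
  then have "\<forall>p\<in>graph T. \<bar>\<phi> p\<bar> \<le> max 0 M" by fastforce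
  then show ?thesis using that[of "max 0 M"] by simp
qed

text \<open>Let \<open>p\<close> be the limit inferior at resolution \<open>\<epsilon>\<^sub>0\<close>. It is an asymptotic lower bound at all finer
  resolutions by monotonicity. For the upper bound choose a resolution \<open>d\<close> at which \<open>\<phi>\<close> oscillates
  little, and a length \<open>n\<close> at which the term with resolution \<open>d / 2\<close> is close to \<open>p\<close>; such \<open>n\<close> exist
  because of expansiveness.\<close>

proposition linear_pressure_limit:
  fixes T :: "'a::metric_space \<Rightarrow> 'a set"
  assumes cpt: "compact (UNIV :: 'a set)" and corr: "correspondence T"
    and e0: "0 < \<epsilon>\<^sub>0" "\<forall>x\<in>orbit_space T. \<forall>y\<in>orbit_space T. x \<noteq> y \<longrightarrow> (\<exists>j. dist (x j) (y j) > \<epsilon>\<^sub>0)"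
    and \<phi>: "continuous_on (graph T) \<phi>"
  shows "\<exists>p. \<forall>\<epsilon>. 0 < \<epsilon> \<and> \<epsilon> \<le> \<epsilon>\<^sub>0 \<longrightarrow>
    (\<lambda>n. ln (sep_sup T n \<epsilon> (orbit_sum \<phi> n)) / n) \<longlonglongrightarrow> p"
proof -
  note cg = compact_graph[OF cpt corr]
  obtain M where M: "0 \<le> M" "\<forall>p\<in>graph T. \<bar>\<phi> p\<bar> \<le> M" by (rule graph_bound[OF cg \<phi>])
  define a where "a \<epsilon> n = ln (sep_sup T n \<epsilon> (orbit_sum \<phi> n)) / real n" for \<epsilon> n
  have pos: "0 < sep_sup T n \<epsilon> (orbit_sum \<phi> n)" if "0 < \<epsilon>" for n \<epsilon>
    using sep_sup_orbit_sum_ge[OF cpt corr that M(2), of n] exp_gt_zero by (rule less_le_trans[rotated])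
  have mono: "a \<epsilon> n \<le> a \<eta> n" if "0 < \<eta>" "\<eta> \<le> \<epsilon>" for \<epsilon> \<eta> n
  proof -
    have "orbit_sum \<phi> n x \<le> n * M" if "x \<in> orbits T n" for x
      using orbit_sum_bound[OF M(2) that] by simp
    then have "sep_sup T n \<epsilon> (orbit_sum \<phi> n) \<le> sep_sup T n \<eta> (orbit_sum \<phi> n)"
      by (intro sep_sup_mono[OF cpt that, of T n "orbit_sum \<phi> n" "n * M"]) simp_all
    then show ?thesis unfolding a_def
      using pos[of \<epsilon> n] pos[of \<eta> n] that by (intro divide_right_mono) simp_all
  qed
  have low: "- M \<le> a \<epsilon> n" if "0 < \<epsilon>" "1 \<le> n" for \<epsilon> n
  proof -
    have "- (n * M) \<le> ln (sep_sup T n \<epsilon> (orbit_sum \<phi> n))"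
      using sep_sup_orbit_sum_ge[OF cpt corr that(1) M(2), of n] pos[OF that(1)]
      by (simp add: ln_ge_iff)
    then show ?thesis using that(2) by (simp add: a_def field_simps)
  qed
  have sub: "\<exists>d0>0. \<forall>d. 0 < d \<and> d \<le> d0 \<longrightarrow> (\<forall>n>0. \<exists>K. \<forall>N>0. a d N \<le> \<omega> + a (d/2) n + K / N)"
    if w: "0 < \<omega>" for \<omega>
  proof -
    obtain d0 where d0: "0 < d0" "\<And>x y x' y'. (x, y) \<in> graph T \<Longrightarrow> (x', y') \<in> graph T \<Longrightarrow>
        dist x x' \<le> d0 \<Longrightarrow> dist y y' \<le> d0 \<Longrightarrow> \<phi> (x, y) \<le> \<omega> + \<phi> (x', y')"
      using graph_modulus[OF cg \<phi> w] by metis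
    have "\<exists>K. \<forall>N>0. a d N \<le> \<omega> + a (d/2) n + K / N" if d: "0 < d" "d \<le> d0" and n: "0 < n" for d n
    proof -
      have "\<phi> (x, y) \<le> \<omega> + \<phi> (x', y')"
        if "(x, y) \<in> graph T" "(x', y') \<in> graph T" "dist x x' \<le> d / 2" "dist y y' \<le> d / 2"
        for x y x' y' using d0(2)[OF that(1,2)] that(3,4) d by linarith
      then obtain K where "\<And>N. 0 < N \<Longrightarrow> a d N \<le> \<omega> + a (d/2) n + K / N"
        unfolding a_def using sep_sup_growth_bound[OF cpt corr d(1) M(2) _ n, of \<omega>] by blast
      then show ?thesis by blast
    qed
    then show ?thesis using d0(1) by blast
  qed
  have bdd: "\<exists>B. \<forall>n\<ge>1. \<bar>a \<epsilon> n\<bar> \<le> B" if "0 < \<epsilon>" for \<epsilon>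
  proof -
    obtain d0 where d0: "0 < d0" "\<And>d n. 0 < d \<Longrightarrow> d \<le> d0 \<Longrightarrow> 0 < n \<Longrightarrow>
        \<exists>K. \<forall>N>0. a d N \<le> 1 + a (d/2) n + K / N" using sub[of 1] by auto
    define d where "d = min d0 \<epsilon>"
    have d: "0 < d" "d \<le> d0" "d \<le> \<epsilon>" using d0(1) that by (auto simp: d_def)
    obtain K where K: "\<And>N. 0 < N \<Longrightarrow> a d N \<le> 1 + a (d/2) 1 + K / N"
      using d0(2)[OF d(1,2), of 1] by auto
    have "\<bar>a \<epsilon> n\<bar> \<le> M + \<bar>1 + a (d/2) 1\<bar> + \<bar>K\<bar>" if n: "1 \<le> n" for n
    proof -
      have "K / n \<le> \<bar>K\<bar> / 1" using n by (intro frac_le) auto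
      then show ?thesis using K[of n] n mono[OF d(1,3), of n] low[OF \<open>0 < \<epsilon>\<close> n] M(1) by linarith
    qed
    then show ?thesis by blast
  qed
  obtain B where B: "\<forall>n\<ge>1. \<bar>a \<epsilon>\<^sub>0 n\<bar> \<le> B" using bdd[OF e0(1)] by blast
  obtain p where p: "\<And>\<kappa>. 0 < \<kappa> \<Longrightarrow> \<forall>\<^sub>F n in sequentially. p - \<kappa> < a \<epsilon>\<^sub>0 n"
    "\<And>\<kappa>. 0 < \<kappa> \<Longrightarrow> \<exists>\<^sub>F n in sequentially. a \<epsilon>\<^sub>0 n < p + \<kappa>"
    using bounded_seq_liminf[OF B] by blast
  have "(\<lambda>n. a \<epsilon> n) \<longlonglongrightarrow> p" if \<epsilon>: "0 < \<epsilon>" "\<epsilon> \<le> \<epsilon>\<^sub>0" for \<epsilon>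
  proof (rule order_tendstoI)
    fix q assume "q < p"
    then have "\<forall>\<^sub>F n in sequentially. p - (p - q) < a \<epsilon>\<^sub>0 n" by (intro p(1)) simp
    then show "\<forall>\<^sub>F n in sequentially. q < a \<epsilon> n"
      by (rule eventually_mono) (use mono[OF \<epsilon>] in \<open>smt (verit)\<close>)
  next
    fix q assume "p < q"
    define \<kappa> where "\<kappa> = (q - p) / 4"
    have k: "0 < \<kappa>" using \<open>p < q\<close> by (simp add: \<kappa>_def)
    obtain d0 where d0: "0 < d0" "\<And>d n. 0 < d \<Longrightarrow> d \<le> d0 \<Longrightarrow> 0 < n \<Longrightarrow>
        \<exists>K. \<forall>N>0. a d N \<le> \<kappa> + a (d/2) n + K / N" using sub[OF k] by auto
    define d where "d = min d0 \<epsilon>"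
    have d: "0 < d" "d \<le> d0" "d \<le> \<epsilon>" using d0(1) \<epsilon> by (auto simp: d_def)
    have d2: "0 < d / 2" using d by simp
    obtain m where m: "\<forall>x\<in>orbit_space T. \<forall>y\<in>orbit_space T.
      (\<forall>j\<le>m. dist (x j) (y j) \<le> \<epsilon>\<^sub>0) \<longrightarrow> dist (x 0) (y 0) \<le> d / 2"
      using expansive_uniform[OF cpt corr d2 e0(2)] by blast
    \<comment> \<open>the error, at length \<open>n\<close>, of replacing resolution \<open>d / 2\<close> by \<open>\<epsilon>\<^sub>0\<close> is at most \<open>c / n\<close>\<close>
    define c where "c = m * M + m * (\<bar>p\<bar> + \<kappa>)"
    have ref: "a (d/2) n \<le> a \<epsilon>\<^sub>0 (n + m) + c / n" if n: "0 < n" and le: "a \<epsilon>\<^sub>0 (n + m) < p + \<kappa>" for n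
    proof -
      have "ln (sep_sup T n (d/2) (orbit_sum \<phi> n)) \<le>
          ln (exp (m * M) * sep_sup T (n + m) \<epsilon>\<^sub>0 (orbit_sum \<phi> (n + m)))"
        using sep_sup_refine[OF cpt corr e0(1) M(2) m, of n] pos[OF d2]
        by (subst ln_le_cancel_iff) (simp_all add: pos[OF e0(1)] mult_pos_pos)
      also have "\<dots> = m * M + (n + m) * a \<epsilon>\<^sub>0 (n + m)"
        using n pos[OF e0(1), of "n + m"] by (simp add: ln_mult a_def)
      also have "\<dots> = m * M + m * a \<epsilon>\<^sub>0 (n + m) + n * a \<epsilon>\<^sub>0 (n + m)" by (simp add: algebra_simps)
      also have "m * a \<epsilon>\<^sub>0 (n + m) \<le> m * (\<bar>p\<bar> + \<kappa>)" using le by (intro mult_left_mono) auto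
      finally have "ln (sep_sup T n (d/2) (orbit_sum \<phi> n)) \<le> c + n * a \<epsilon>\<^sub>0 (n + m)"
        unfolding c_def by simp
      then have "a (d/2) n \<le> (c + n * a \<epsilon>\<^sub>0 (n + m)) / n"
        unfolding a_def[of "d/2"] by (intro divide_right_mono) auto
      also have "\<dots> = a \<epsilon>\<^sub>0 (n + m) + c / n" using n by (simp add: field_simps)
      finally show ?thesis .
    qed
    have "(\<lambda>n. c / real n) \<longlonglongrightarrow> 0" by (rule lim_const_over_n)
    from order_tendstoD(2)[OF this k]
    obtain n1 where n1: "\<And>n. n1 \<le> n \<Longrightarrow> c / real n < \<kappa>"
      unfolding eventually_sequentially by blast
    obtain n' where n': "n' \<ge> n1 + m + 1" "a \<epsilon>\<^sub>0 n' < p + \<kappa>"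
      using p(2)[OF k] unfolding frequently_sequentially by blast
    define n where "n = n' - m"
    have n: "0 < n" "n1 \<le> n" "n' = n + m" using n'(1) by (auto simp: n_def)
    have an: "a (d/2) n < p + 2 * \<kappa>" using ref[of n] n n1[of n] n'(2) by simp
    obtain K where K: "\<And>N. 0 < N \<Longrightarrow> a d N \<le> \<kappa> + a (d/2) n + K / N"
      using d0(2)[OF d(1,2) n(1)] by auto
    have "(\<lambda>n. K / real n) \<longlonglongrightarrow> 0" by (rule lim_const_over_n)
    from order_tendstoD(2)[OF this k] have "\<forall>\<^sub>F N in sequentially. K / real N < \<kappa>" .
    from this show "\<forall>\<^sub>F N in sequentially. a \<epsilon> N < q"
      using eventually_gt_at_top[of "0::nat"]
    proof eventually_elim
      case (elim N)
      then show ?case using K[of N] mono[OF d(1,3), of N] an unfolding \<kappa>_def by argo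
    qed
  qed
  then show ?thesis unfolding a_def by blast
qed

section \<open>The pressure of the quadratic energy\<close>

lemma has_top_pressureI:
  assumes "0 < \<epsilon>\<^sub>0"
    and lim: "\<And>\<epsilon>. 0 < \<epsilon> \<Longrightarrow> \<epsilon> \<le> \<epsilon>\<^sub>0 \<Longrightarrow> (\<lambda>n. ln (sep_sup T n \<epsilon> (f n)) / n) \<longlonglongrightarrow> p"
    and E: "\<And>n x. 0 < n \<Longrightarrow> x \<in> orbits T n \<Longrightarrow> real n * E (empirical T n x) = f n x"
  shows "has_top_pressure T E p"
proof -
  have l: "(\<lambda>n. ereal (1 / real n * ln (partition_sum T E n \<epsilon>))) \<longlonglongrightarrow> ereal p"
    if "0 < \<epsilon>" "\<epsilon> \<le> \<epsilon>\<^sub>0" for \<epsilon>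
  proof -
    have "\<forall>\<^sub>F n in sequentially. ln (sep_sup T n \<epsilon> (f n)) / n = 1 / real n * ln (partition_sum T E n \<epsilon>)"
      using eventually_gt_at_top[of "0::nat"]
    proof eventually_elim
      case (elim n)
      have "partition_sum T E n \<epsilon> = sep_sup T n \<epsilon> (f n)"
        by (rule partition_sum_eq_sep_sup) (rule E[OF elim])
      then show ?case by simp
    qed
    then show ?thesis using Lim_transform_eventually[OF lim[OF that]] by simp
  qed
  have ev: "\<forall>\<^sub>F \<epsilon> in at_right 0. F \<epsilon> = ereal p"
    if "\<And>\<epsilon>. 0 < \<epsilon> \<Longrightarrow> \<epsilon> \<le> \<epsilon>\<^sub>0 \<Longrightarrow> F \<epsilon> = ereal p" for F
    unfolding eventually_at_right_field using that assms(1) by (intro exI[of _ \<epsilon>\<^sub>0]) auto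
  have "upper_pressure T E = ereal p" unfolding upper_pressure_def
    by (intro tendsto_Lim tendsto_eventually ev lim_imp_Limsup[OF _ l]) auto
  moreover have "lower_pressure T E = ereal p" unfolding lower_pressure_def
    by (intro tendsto_Lim tendsto_eventually ev lim_imp_Liminf[OF _ l]) auto
  ultimately show ?thesis by (simp add: has_top_pressure_def)
qed

lemma top_pressure_eq: "has_top_pressure T E p \<Longrightarrow> top_pressure T E = p"
  unfolding top_pressure_def by (rule the_equality) (auto simp: has_top_pressure_def)

lemma orbit_sum_scale: "orbit_sum (\<lambda>r. s * \<psi> r) n x = s * orbit_sum \<psi> n x"
  by (simp add: orbit_sum_def sum_distrib_left)

text \<open>With \<open>m\<close> the mean of \<open>\<psi>\<close> along the orbit,
  \<open>\<beta> / 2 * m\<^sup>2 = \<beta> * s * m - \<beta> * s\<^sup>2 / 2 + \<beta> * (m - s)\<^sup>2 / 2\<close> for every \<open>s\<close>. Dropping the last term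
  bounds the quadratic energy from below by a linear one; for the upper bound, \<open>s\<close> runs through a
  finite grid that comes close to each possible mean, and the finitely many partition sums add
  up. No information on the distribution of the means is needed.\<close>

proposition quadratic_pressure_limit:
  fixes T :: "'a::metric_space \<Rightarrow> 'a set"
  assumes cpt: "compact (UNIV :: 'a set)" and corr: "correspondence T" and e: "0 < \<epsilon>"
    and M: "\<forall>p\<in>graph T. \<bar>\<psi> p\<bar> \<le> M" "0 \<le> M" and \<beta>: "0 \<le> \<beta>"
    and lin: "\<And>s. (\<lambda>n. ln (sep_sup T n \<epsilon> (orbit_sum (\<lambda>r. s * \<psi> r) n)) / n) \<longlonglongrightarrow> P s"
    and V: "\<And>s. P (\<beta> * s) - \<beta> * s\<^sup>2 / 2 \<le> V" "P (\<beta> * s0) - \<beta> * s0\<^sup>2 / 2 = V"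
  shows "(\<lambda>n. ln (sep_sup T n \<epsilon> (\<lambda>x. \<beta> / 2 * (orbit_sum \<psi> n x)\<^sup>2 / n)) / n) \<longlonglongrightarrow> V"
proof -
  define f where "f n x = \<beta> / 2 * (orbit_sum \<psi> n x)\<^sup>2 / real n" for n x
  define Z where "Z s n = sep_sup T n \<epsilon> (orbit_sum (\<lambda>r. s * \<psi> r) n)" for s n
  define Y where "Y n = sep_sup T n \<epsilon> (f n)" for n
  have Ms: "\<forall>p\<in>graph T. \<bar>s * \<psi> p\<bar> \<le> \<bar>s\<bar> * M" for s
    using M(1) by (auto simp: abs_mult intro: mult_left_mono)
  have bl: "orbit_sum (\<lambda>r. s * \<psi> r) n x \<le> n * (\<bar>s\<bar> * M)" if "x \<in> orbits T n" for s n x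
    using orbit_sum_bound[OF Ms that] by (rule abs_le_D1)
  have Zpos: "0 < Z s n" for s n
    unfolding Z_def using sep_sup_orbit_sum_ge[OF cpt corr e Ms[of s], of n] exp_gt_zero
    by (rule less_le_trans[rotated])
  have sq: "f n x = n * (\<beta> / 2) * (orbit_sum \<psi> n x / n)\<^sup>2" if "0 < n" for n x
    using that by (simp add: f_def power2_eq_square)
  have avg: "\<bar>orbit_sum \<psi> n x / n\<bar> \<le> M" if "x \<in> orbits T n" "0 < n" for n x
    using orbit_sum_bound[OF M(1) that(1)] that(2) by (simp add: field_simps)
  have bf: "f n x \<le> n * (\<beta> / 2) * M\<^sup>2" if "x \<in> orbits T n" "0 < n" for n x
    unfolding sq[OF that(2)] using avg[OF that] \<beta>
    by (intro mult_left_mono) (auto simp: abs_le_square_iff[symmetric])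
  have exp_eq: "f n x = n * (\<beta> * ((orbit_sum \<psi> n x / n) - s)\<^sup>2 / 2 - \<beta> * s\<^sup>2 / 2) +
      orbit_sum (\<lambda>r. \<beta> * s * \<psi> r) n x" if "0 < n" for n x s
    unfolding sq[OF that] orbit_sum_scale[of "\<beta> * s"] using that
    by (simp add: field_simps power2_eq_square)
  have low: "Z (\<beta> * s0) n \<le> exp (n * (\<beta> * s0\<^sup>2 / 2)) * Y n" if n: "0 < n" for n
  proof -
    have "orbit_sum (\<lambda>r. \<beta> * s0 * \<psi> r) n x \<le> n * (\<beta> * s0\<^sup>2 / 2) + f n x" for x
    proof -
      have "0 \<le> n * (\<beta> * ((orbit_sum \<psi> n x / n) - s0)\<^sup>2 / 2)" using \<beta> by simp
      then show ?thesis unfolding exp_eq[OF n, of x s0] right_diff_distrib by linarith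
    qed
    then have "Z (\<beta> * s0) n \<le> sep_sup T n \<epsilon> (\<lambda>x. n * (\<beta> * s0\<^sup>2 / 2) + f n x)"
      unfolding Z_def using bf[OF _ n]
      by (intro sep_sup_mono[OF cpt e order_refl,
          of T n _ "n * (\<beta> * s0\<^sup>2 / 2) + n * (\<beta> / 2) * M\<^sup>2"] add_left_mono) auto
    also have "\<dots> \<le> exp (n * (\<beta> * s0\<^sup>2 / 2)) * Y n"
      unfolding Y_def by (intro sep_sup_add_const[OF _ cpt e bf[OF _ n]]) auto
    finally show ?thesis .
  qed
  have Ypos: "0 < Y n" if "0 < n" for n
  proof -
    have "0 < exp (n * (\<beta> * s0\<^sup>2 / 2)) * Y n" using low[OF that] Zpos[of "\<beta> * s0" n] by linarith
    then show ?thesis by (simp add: zero_less_mult_iff)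
  qed
  have lowln: "ln (Z (\<beta> * s0) n) / n - \<beta> * s0\<^sup>2 / 2 \<le> ln (Y n) / n" if n: "0 < n" for n
  proof -
    have "ln (Z (\<beta> * s0) n) \<le> ln (exp (n * (\<beta> * s0\<^sup>2 / 2)) * Y n)"
      using low[OF n] Zpos[of "\<beta> * s0" n] Ypos[OF n] by (subst ln_le_cancel_iff) simp_all
    also have "\<dots> = n * (\<beta> * s0\<^sup>2 / 2) + ln (Y n)" using Ypos[OF n] by (simp add: ln_mult)
    finally have "ln (Z (\<beta> * s0) n) / n \<le> (n * (\<beta> * s0\<^sup>2 / 2) + ln (Y n)) / n"
      by (intro divide_right_mono) auto
    also have "\<dots> = \<beta> * s0\<^sup>2 / 2 + ln (Y n) / n" using n by (simp add: add_divide_distrib)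
    finally show ?thesis by linarith
  qed
  have "(\<lambda>n. ln (Y n) / n) \<longlonglongrightarrow> V"
  proof (rule order_tendstoI)
    fix q assume "q < V"
    have "(\<lambda>n. ln (Z (\<beta> * s0) n) / n - \<beta> * s0\<^sup>2 / 2) \<longlonglongrightarrow> V"
      unfolding V(2)[symmetric] Z_def by (intro tendsto_diff lin tendsto_const)
    then have "\<forall>\<^sub>F n in sequentially. q < ln (Z (\<beta> * s0) n) / n - \<beta> * s0\<^sup>2 / 2"
      using \<open>q < V\<close> by (rule order_tendstoD)
    then show "\<forall>\<^sub>F n in sequentially. q < ln (Y n) / n"
      using eventually_gt_at_top[of "0::nat"]
    proof eventually_elim
      case (elim n)
      then show ?case using lowln[of n] by linarith
    qed
  next
    fix q assume q: "V < q"
    define \<kappa> where "\<kappa> = (q - V) / 4"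
    have k: "0 < \<kappa>" using q by (simp add: \<kappa>_def)
    \<comment> \<open>a mesh of the grid that makes the last term of the identity at most \<open>\<kappa>\<close>\<close>
    define \<eta> where "\<eta> = min 1 (\<kappa> / (\<beta> + 1))"
    have \<eta>: "0 < \<eta>" "\<eta> \<le> 1" "\<eta> \<le> \<kappa> / (\<beta> + 1)" using k \<beta> by (auto simp: \<eta>_def)
    have \<eta>2: "\<beta> * \<eta>\<^sup>2 / 2 \<le> \<kappa>"
    proof -
      have "\<eta>\<^sup>2 \<le> \<eta>" using \<eta>(1,2) by (simp add: power2_eq_square mult_left_le)
      then have "\<beta> * \<eta>\<^sup>2 \<le> (\<beta> + 1) * \<eta>" using \<beta> \<eta>(1) by (intro mult_mono) auto
      also have "\<dots> \<le> \<kappa>" using \<eta>(3) \<beta> by (simp add: field_simps)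
      finally show ?thesis using k by linarith
    qed
    obtain G where G: "finite G" "{- M..M} \<subseteq> (\<Union>g\<in>G. ball g \<eta>)"
      using compact_Icc[of "-M" M] \<eta>(1) unfolding compact_eq_totally_bounded by blast
    have Gne: "G \<noteq> {}" using G(2) M(2) by (auto simp: subset_iff)
    have "\<forall>\<^sub>F n in sequentially. \<forall>g\<in>G. ln (Z (\<beta> * g) n) / n < P (\<beta> * g) + \<kappa>"
      using lin k unfolding Z_def
      by (intro eventually_ball_finite G(1) ballI order_tendstoD(2)[OF lin]) simp
    moreover
    have lc: "(\<lambda>n. ln (card G) / real n) \<longlonglongrightarrow> 0"
      by (rule lim_const_over_n)
    have "\<forall>\<^sub>F n in sequentially. ln (card G) / real n < \<kappa>"
      by (rule order_tendstoD(2)[OF lc k])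
    ultimately show "\<forall>\<^sub>F n in sequentially. ln (Y n) / n < q"
      using eventually_gt_at_top[of "0::nat"]
    proof eventually_elim
      case (elim n)
      note n = elim(3)
      have up: "exp (f n x) \<le> (\<Sum>g\<in>G. exp (n * (\<kappa> - \<beta> * g\<^sup>2 / 2)) * exp (orbit_sum (\<lambda>r. \<beta> * g * \<psi> r) n x))"
        if x: "x \<in> orbits T n" for x
      proof -
        have "orbit_sum \<psi> n x / n \<in> {- M..M}" using avg[OF x n] unfolding abs_le_iff atLeastAtMost_iff by linarith
        then obtain g where g: "g \<in> G" "orbit_sum \<psi> n x / n \<in> ball g \<eta>" using G(2) by blast
        then have g': "\<bar>orbit_sum \<psi> n x / n - g\<bar> < \<eta>"
          by (simp add: dist_real_def abs_minus_commute)
        have sq_le: "(orbit_sum \<psi> n x / n - g)\<^sup>2 \<le> \<eta>\<^sup>2" using g' \<eta>(1) by (intro iffD1[OF abs_le_square_iff]) linarith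
        have "\<beta> * (orbit_sum \<psi> n x / n - g)\<^sup>2 / 2 \<le> \<kappa>"
          using \<eta>2 mult_left_mono[OF sq_le \<beta>] by linarith
        then have "f n x \<le> n * (\<kappa> - \<beta> * g\<^sup>2 / 2) + orbit_sum (\<lambda>r. \<beta> * g * \<psi> r) n x"
          unfolding exp_eq[OF n, of x g] by (intro add_right_mono mult_left_mono) auto
        then have "exp (f n x) \<le> exp (n * (\<kappa> - \<beta> * g\<^sup>2 / 2)) * exp (orbit_sum (\<lambda>r. \<beta> * g * \<psi> r) n x)"
          by (simp flip: exp_add)
        also have "\<dots> \<le> (\<Sum>g\<in>G. exp (n * (\<kappa> - \<beta> * g\<^sup>2 / 2)) * exp (orbit_sum (\<lambda>r. \<beta> * g * \<psi> r) n x))"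
          using G(1) g(1) by (intro member_le_sum[of g]) auto
        finally show ?thesis .
      qed
      have "Y n \<le> (\<Sum>g\<in>G. exp (n * (\<kappa> - \<beta> * g\<^sup>2 / 2)) * Z (\<beta> * g) n)" unfolding Y_def
      proof (rule sep_sup_least)
        fix C assume C: "separated T n \<epsilon> C"
        have "(\<Sum>x\<in>C. exp (f n x)) \<le>
            (\<Sum>x\<in>C. \<Sum>g\<in>G. exp (n * (\<kappa> - \<beta> * g\<^sup>2 / 2)) * exp (orbit_sum (\<lambda>r. \<beta> * g * \<psi> r) n x))"
          using C by (intro sum_mono up) (auto simp: separated_def)
        also have "\<dots> = (\<Sum>g\<in>G. exp (n * (\<kappa> - \<beta> * g\<^sup>2 / 2)) *
            (\<Sum>x\<in>C. exp (orbit_sum (\<lambda>r. \<beta> * g * \<psi> r) n x)))"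
          by (subst sum.swap) (simp add: sum_distrib_left)
        also have "\<dots> \<le> (\<Sum>g\<in>G. exp (n * (\<kappa> - \<beta> * g\<^sup>2 / 2)) * Z (\<beta> * g) n)"
          unfolding Z_def using bl C
          by (intro sum_mono mult_left_mono sep_sup_upper[OF cpt e]) auto
        finally show "(\<Sum>x\<in>C. exp (f n x)) \<le> (\<Sum>g\<in>G. exp (n * (\<kappa> - \<beta> * g\<^sup>2 / 2)) * Z (\<beta> * g) n)" .
      qed
      also have "\<dots> \<le> (\<Sum>g\<in>G. exp (n * (V + 2 * \<kappa>)))"
      proof (rule sum_mono)
        fix g assume "g \<in> G"
        then have "ln (Z (\<beta> * g) n) / n < P (\<beta> * g) + \<kappa>" by (rule bspec[OF elim(1)])
        then have "ln (Z (\<beta> * g) n) \<le> n * (P (\<beta> * g) + \<kappa>)" using n by (simp add: field_simps)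
        then have "Z (\<beta> * g) n \<le> exp (n * (P (\<beta> * g) + \<kappa>))"
          using Zpos[of "\<beta> * g" n] by (metis exp_le_cancel_iff exp_ln)
        then have "exp (n * (\<kappa> - \<beta> * g\<^sup>2 / 2)) * Z (\<beta> * g) n \<le>
            exp (n * (\<kappa> - \<beta> * g\<^sup>2 / 2)) * exp (n * (P (\<beta> * g) + \<kappa>))" by simp
        also have "\<dots> = exp (n * ((P (\<beta> * g) - \<beta> * g\<^sup>2 / 2) + 2 * \<kappa>))"
          by (simp add: algebra_simps flip: exp_add)
        also have "\<dots> \<le> exp (n * (V + 2 * \<kappa>))" using V(1)[of g] by (simp add: mult_left_mono)
        finally show "exp (n * (\<kappa> - \<beta> * g\<^sup>2 / 2)) * Z (\<beta> * g) n \<le> exp (n * (V + 2 * \<kappa>))" .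
      qed
      finally have "Y n \<le> card G * exp (n * (V + 2 * \<kappa>))" by simp
      moreover have cG: "0 < real (card G)" using G(1) Gne by (simp add: card_gt_0_iff)
      ultimately have "ln (Y n) \<le> ln (card G * exp (n * (V + 2 * \<kappa>)))"
        using Ypos[OF n] by (subst ln_le_cancel_iff) simp_all
      also have "\<dots> = ln (card G) + n * (V + 2 * \<kappa>)" using cG by (simp add: ln_mult)
      finally have "ln (Y n) / n \<le> (ln (card G) + n * (V + 2 * \<kappa>)) / n" by (intro divide_right_mono) auto
      also have "\<dots> = ln (card G) / n + (V + 2 * \<kappa>)" using n by (simp add: field_simps)
      also have "\<dots> < q" using elim(2) q unfolding \<kappa>_def by argo
      finally show ?case .
    qed
  qed
  then show ?thesis unfolding Y_def f_def .
qed

proposition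
  fixes T :: "'a::metric_space \<Rightarrow> 'a set"
  assumes cpt: "compact (UNIV :: 'a set)" and corr: "correspondence T"
    and fe: "forward_expansive T" and \<psi>: "continuous_on (graph T) \<psi>"
    and P: "P = (\<lambda>t. linear_pressure T (\<lambda>r. t * \<psi> r))"
  shows linear_pressure_growth: "\<exists>M. \<forall>t. P t \<le> P 0 + M * \<bar>t\<bar>"
    and quadratic_pressure: "\<And>\<beta> V s0. 0 \<le> \<beta> \<Longrightarrow> (\<And>s. P (\<beta> * s) - \<beta> * s\<^sup>2 / 2 \<le> V) \<Longrightarrow>
      P (\<beta> * s0) - \<beta> * s0\<^sup>2 / 2 = V \<Longrightarrow> has_top_pressure T (quadratic_energy \<psi> \<beta>) V"
proof -
  obtain \<epsilon>\<^sub>0 where e0: "0 < \<epsilon>\<^sub>0" "\<forall>x\<in>orbit_space T. \<forall>y\<in>orbit_space T. x \<noteq> y \<longrightarrow> (\<exists>j. dist (x j) (y j) > \<epsilon>\<^sub>0)"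
    using fe unfolding forward_expansive_def by blast
  note cg = compact_graph[OF cpt corr]
  obtain M where M: "0 \<le> M" "\<forall>p\<in>graph T. \<bar>\<psi> p\<bar> \<le> M" by (rule graph_bound[OF cg \<psi>])
  have cs: "continuous_on (graph T) (\<lambda>r. s * \<psi> r)" for s
    using \<psi> by (intro continuous_intros)
  have "\<exists>p. \<forall>\<epsilon>. 0 < \<epsilon> \<and> \<epsilon> \<le> \<epsilon>\<^sub>0 \<longrightarrow>
      (\<lambda>n. ln (sep_sup T n \<epsilon> (orbit_sum (\<lambda>r. s * \<psi> r) n)) / n) \<longlonglongrightarrow> p" for s
    by (rule linear_pressure_limit[OF cpt corr e0 cs])
  then obtain L where L: "\<And>s \<epsilon>. 0 < \<epsilon> \<Longrightarrow> \<epsilon> \<le> \<epsilon>\<^sub>0 \<Longrightarrow>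
      (\<lambda>n. ln (sep_sup T n \<epsilon> (orbit_sum (\<lambda>r. s * \<psi> r) n)) / n) \<longlonglongrightarrow> L s" by metis
  have PL: "P s = L s" for s unfolding P linear_pressure_def
  proof (rule top_pressure_eq, rule has_top_pressureI[OF e0(1) L])
    fix n x assume "0 < n" "x \<in> orbits T n"
    then show "real n * integral\<^sup>L (empirical T n x) (\<lambda>r. s * \<psi> r) = orbit_sum (\<lambda>r. s * \<psi> r) n x"
      by (subst integral_empirical[OF cs]) auto
  qed
  have bl: "\<bar>orbit_sum \<psi> n x\<bar> \<le> n * M" if "x \<in> orbits T n" for n x
    using orbit_sum_bound[OF M(2) that] .
  have "P t \<le> P 0 + M * \<bar>t\<bar>" for t
  proof -
    have "ln (sep_sup T n \<epsilon>\<^sub>0 (orbit_sum (\<lambda>r. t * \<psi> r) n)) / n \<le>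
        ln (sep_sup T n \<epsilon>\<^sub>0 (orbit_sum (\<lambda>r. 0 * \<psi> r) n)) / n + M * \<bar>t\<bar>" if n: "1 \<le> n" for n
    proof -
      define W where "W s = sep_sup T n \<epsilon>\<^sub>0 (orbit_sum (\<lambda>r. s * \<psi> r) n)" for s
      have Wpos: "0 < W s" for s
      proof -
        have "\<forall>p\<in>graph T. \<bar>s * \<psi> p\<bar> \<le> \<bar>s\<bar> * M"
          using M(2) by (auto simp: abs_mult intro: mult_left_mono)
        from sep_sup_orbit_sum_ge[OF cpt corr e0(1) this, of n] show ?thesis
          unfolding W_def using exp_gt_zero by (rule less_le_trans[rotated])
      qed
      have le: "t * orbit_sum \<psi> n x \<le> n * (M * \<bar>t\<bar>)" if "x \<in> orbits T n" for x
      proof -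
        have "t * orbit_sum \<psi> n x \<le> \<bar>t\<bar> * \<bar>orbit_sum \<psi> n x\<bar>" by (metis abs_ge_self abs_mult)
        also have "\<dots> \<le> \<bar>t\<bar> * (n * M)" using bl[OF that] by (intro mult_left_mono) auto
        finally show ?thesis by (simp add: mult_ac)
      qed
      have "W t \<le> sep_sup T n \<epsilon>\<^sub>0 (\<lambda>x. n * (M * \<bar>t\<bar>) + orbit_sum (\<lambda>r. 0 * \<psi> r) n x)"
        unfolding W_def using le
        by (intro sep_sup_mono[OF cpt e0(1) order_refl, of T n _ "n * (M * \<bar>t\<bar>)"])
          (auto simp: orbit_sum_scale orbit_sum_scale[of 0, simplified])
      also have "\<dots> \<le> exp (n * (M * \<bar>t\<bar>)) * W 0"
        unfolding W_def by (intro sep_sup_add_const[OF _ cpt e0(1), of _ _ _ _ _ 0])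
          (auto simp: orbit_sum_scale[of 0, simplified])
      finally have "ln (W t) \<le> ln (exp (n * (M * \<bar>t\<bar>)) * W 0)"
        using Wpos[of t] Wpos[of 0] by (subst ln_le_cancel_iff) simp_all
      also have "\<dots> = n * (M * \<bar>t\<bar>) + ln (W 0)" using Wpos[of 0] by (simp add: ln_mult)
      finally have "ln (W t) / n \<le> (n * (M * \<bar>t\<bar>) + ln (W 0)) / n" by (intro divide_right_mono) auto
      also have "\<dots> = ln (W 0) / n + M * \<bar>t\<bar>" using n by (simp add: add_divide_distrib)
      finally show ?thesis unfolding W_def .
    qed
    then have "L t \<le> L 0 + M * \<bar>t\<bar>"
      by (intro LIMSEQ_le[OF L[OF e0(1) order_refl] tendsto_add[OF L[OF e0(1) order_refl] tendsto_const]]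
          exI[of _ 1]) blast
    then show ?thesis by (simp add: PL)
  qed
  then show "\<exists>M. \<forall>t. P t \<le> P 0 + M * \<bar>t\<bar>" by blast
  fix \<beta> V s0 :: real
  assume b: "0 \<le> \<beta>" and V: "\<And>s. P (\<beta> * s) - \<beta> * s\<^sup>2 / 2 \<le> V" "P (\<beta> * s0) - \<beta> * s0\<^sup>2 / 2 = V"
  show "has_top_pressure T (quadratic_energy \<psi> \<beta>) V"
  proof (rule has_top_pressureI[OF e0(1)])
    fix \<epsilon> assume e: "0 < \<epsilon>" "\<epsilon> \<le> \<epsilon>\<^sub>0"
    show "(\<lambda>n. ln (sep_sup T n \<epsilon> (\<lambda>x. \<beta> / 2 * (orbit_sum \<psi> n x)\<^sup>2 / n)) / n) \<longlonglongrightarrow> V"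
      by (rule quadratic_pressure_limit[OF cpt corr e(1) M(2,1) b L[OF e] V[unfolded PL]])
  next
    fix n :: nat and x assume "0 < n" "x \<in> orbits T n"
    then show "real n * quadratic_energy \<psi> \<beta> (empirical T n x) = \<beta> / 2 * (orbit_sum \<psi> n x)\<^sup>2 / n"
      unfolding quadratic_energy_def
      by (subst integral_empirical[OF \<psi>]) (auto simp: power2_eq_square)
  qed
qed

section \<open>Counting stationary pairs\<close>

text \<open>A compact metric space is second countable, although its type need not be an instance of the
  corresponding class: the balls of radius \<open>1 / (n + 1)\<close> around the points of finite nets form a base.\<close>

lemma open_in_sets_pair_measure:
  fixes S :: "('a::metric_space \<times> 'a) set"
  assumes "compact (UNIV :: 'a set)" "open S"
  shows "S \<in> sets (borel \<Otimes>\<^sub>M borel)"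
proof -
  have "\<exists>K :: 'a set. finite K \<and> UNIV \<subseteq> (\<Union>k\<in>K. ball k (1 / real (Suc n)))" for n
  proof -
    have "0 < 1 / real (Suc n)" by simp
    then show ?thesis using assms(1) unfolding compact_eq_totally_bounded by blast
  qed
  then obtain K :: "nat \<Rightarrow> 'a set" where K: "\<And>n. finite (K n)"
    "\<And>n. UNIV \<subseteq> (\<Union>k\<in>K n. ball k (1 / real (Suc n)))" by metis
  have near: "\<exists>k\<in>K n. dist k x < 1 / real (Suc n)" for n x
  proof -
    have "x \<in> (\<Union>k\<in>K n. ball k (1 / real (Suc n)))" using K(2) by blast
    then show ?thesis by (simp only: UN_iff mem_ball)
  qed
  define B where "B = (\<lambda>(n, k, l). ball k (1 / real (Suc n)) \<times> ball l (1 / real (Suc n)) :: ('a \<times> 'a) set)"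
  define I where "I = {i \<in> (SIGMA n:UNIV. K n \<times> K n). B i \<subseteq> S}"
  have cI: "countable I"
  proof -
    have "countable (K n \<times> K n)" for n
      using K(1) by (intro countable_finite finite_cartesian_product)
    then have "countable (SIGMA n:UNIV. K n \<times> K n)" by (rule countable_SIGMA[OF countableI_type])
    then show ?thesis unfolding I_def by (rule countable_subset[rotated]) auto
  qed
  have "S = (\<Union>i\<in>I. B i)"
  proof (rule antisym; rule subsetI)
    fix p assume "p \<in> S"
    obtain x y where p: "p = (x, y)" by (cases p)
    then obtain e where e: "0 < e" "\<And>q. dist q (x, y) < e \<Longrightarrow> q \<in> S"
      using assms(2) \<open>p \<in> S\<close> unfolding open_dist by metis
    obtain n where n: "1 / real (Suc n) < e / 4" using nat_approx_posE[of "e / 4"] e(1) by auto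
    obtain k where k: "k \<in> K n" "dist k x < 1 / real (Suc n)" using near by blast
    obtain l where l: "l \<in> K n" "dist l y < 1 / real (Suc n)" using near by blast
    have "B (n, k, l) \<subseteq> S"
    proof
      fix q assume "q \<in> B (n, k, l)"
      then obtain u v where q: "q = (u, v)" "dist k u < 1 / real (Suc n)" "dist l v < 1 / real (Suc n)"
        by (auto simp: B_def)
      have "dist (u, v) (x, y) \<le> dist u x + dist v y"
        unfolding dist_Pair_Pair by (rule sqrt_sum_squares_le_sum) auto
      also have "\<dots> < e"
        using dist_triangle3[of u x k] dist_triangle3[of v y l] q k l n by linarith
      finally show "q \<in> S" using e(2) q(1) by blast
    qed
    then have "(n, k, l) \<in> I" using k l by (simp add: I_def)
    moreover have "p \<in> B (n, k, l)" using k l p by (simp add: B_def)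
    ultimately show "p \<in> (\<Union>i\<in>I. B i)" by blast
  qed (auto simp: I_def)
  moreover have "(\<Union>i\<in>I. B i) \<in> sets (borel \<Otimes>\<^sub>M borel)"
    using cI by (intro sets.countable_UN') (auto simp: B_def intro!: pair_measureI)
  ultimately show ?thesis by simp
qed

text \<open>The rotation value depends only on the class of a pair. The Borel sets of the square have to be
  product measurable here, so that the law of a step is a measurable function of its starting
  point.\<close>

lemma rotation_value_cong:
  fixes T :: "'a::metric_space \<Rightarrow> 'a set"
  assumes "compact (UNIV :: 'a set)" and pq: "(p, q) \<in> pair_identification T"
  shows "rotation_value T \<psi> p = rotation_value T \<psi> q"
proof -
  obtain \<mu> Q Q' where p: "p = (\<mu>, Q)" and q: "q = (\<mu>, Q')"
    and st: "(\<mu>, Q) \<in> stationary_pairs T" "(\<mu>, Q') \<in> stationary_pairs T"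
    and ae: "AE x in \<mu>. Q x = Q' x"
    using pq unfolding pair_identification_def by auto
  have s: "sets \<mu> = sets borel" using st(1) by (auto simp: stationary_pairs_def space_prob_algebra)
  have id: "(\<lambda>(x, y). (x, y)) \<in> (borel :: 'a measure) \<Otimes>\<^sub>M (borel :: 'a measure) \<rightarrow>\<^sub>M borel"
    by (rule borel_measurableI) (use open_in_sets_pair_measure[OF assms(1)] in \<open>simp add: space_pair_measure\<close>)
  have m: "(\<lambda>x. distr (R x) borel (Pair x)) \<in> \<mu> \<rightarrow>\<^sub>M subprob_algebra borel"
    if "(\<mu>, R) \<in> stationary_pairs T" for R
  proof -
    have "R \<in> borel \<rightarrow>\<^sub>M subprob_algebra borel"
      using that by (auto simp: stationary_pairs_def kernels_def intro: measurable_prob_algebraD)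
    then have "(\<lambda>x. distr (R x) borel (Pair x)) \<in> borel \<rightarrow>\<^sub>M subprob_algebra borel"
      by (rule measurable_distr2[OF id])
    then show ?thesis using measurable_cong_sets[OF s refl] by blast
  qed
  have "\<mu> \<bind> (\<lambda>x. distr (Q x) borel (Pair x)) = \<mu> \<bind> (\<lambda>x. distr (Q' x) borel (Pair x))"
    using ae by (intro bind_cong_AE[OF refl m[OF st(1)] m[OF st(2)]]) (auto elim!: eventually_mono)
  then show ?thesis by (simp add: p q rotation_value_def pair_law_def)
qed

lemma pair_identification_refl:
  "p \<in> stationary_pairs T \<Longrightarrow> (p, p) \<in> pair_identification T"
  by (cases p) (auto simp: pair_identification_def)

lemma num_pairs_union:
  fixes T :: "'a::metric_space \<Rightarrow> 'a set"
  assumes cpt: "compact (UNIV :: 'a set)"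
    and sub: "A \<subseteq> stationary_pairs T" "B \<subseteq> stationary_pairs T"
    and one: "num_pairs T A = 1" "num_pairs T B = 1"
    and rot: "\<And>p. p \<in> A \<Longrightarrow> rotation_value T \<psi> p = u" "\<And>p. p \<in> B \<Longrightarrow> rotation_value T \<psi> p = v"
    and "u \<noteq> v"
  shows "num_pairs T (A \<union> B) = 2"
proof -
  let ?r = "pair_identification T"
  obtain c where c: "A // ?r = {c}" using one(1) unfolding num_pairs_def by (rule card_1_singletonE)
  obtain d where d: "B // ?r = {d}" using one(2) unfolding num_pairs_def by (rule card_1_singletonE)
  obtain p where p: "p \<in> A" "c = ?r `` {p}" using c by (metis insertI1 quotientE)
  obtain q where q: "q \<in> B" "d = ?r `` {q}" using d by (metis insertI1 quotientE)
  have "c \<noteq> d"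
  proof
    assume "c = d"
    moreover have "q \<in> d" using q sub(2) pair_identification_refl[of q T] by auto
    ultimately have "(p, q) \<in> ?r" using p(2) by auto
    then show False using rotation_value_cong[OF cpt] rot(1)[OF p(1)] rot(2)[OF q(1)] \<open>u \<noteq> v\<close> by metis
  qed
  moreover have "(A \<union> B) // ?r = {c, d}" using c d by (auto simp: quotient_def)
  ultimately show ?thesis by (simp add: num_pairs_def)
qed

section \<open>Linear and nonlinear equilibrium pairs\<close>

lemma real_analytic_imp_differentiable:
  assumes "real_analytic_on f UNIV"
  shows "(f has_real_derivative deriv f x) (at x)"
proof -
  obtain r c where r: "0 < r" and s: "\<And>y. \<bar>y - x\<bar> < r \<Longrightarrow> (\<lambda>n. c n * (y - x) ^ n) sums f y"
    using assms unfolding real_analytic_on_def by blast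
  have "summable (\<lambda>n. c n * z ^ n)" if "norm z < r" for z
    using s[of "x + z"] that by (auto simp: sums_iff)
  then have "((\<lambda>z. \<Sum>n. c n * z ^ n) has_real_derivative (\<Sum>n. diffs c n * 0 ^ n)) (at 0)"
    using r by (intro termdiffs_strong'[where K = r]) auto
  then have d: "((\<lambda>z. \<Sum>n. c n * z ^ n) has_real_derivative (\<Sum>n. diffs c n * 0 ^ n)) (at (x - x))" by simp
  have "((\<lambda>y. \<Sum>n. c n * (y - x) ^ n) has_real_derivative (\<Sum>n. diffs c n * 0 ^ n) * 1) (at x)"
    by (rule DERIV_chain2[where g = "\<lambda>y. y - x", OF d]) (auto intro!: derivative_eq_intros)
  then have "(f has_real_derivative (\<Sum>n. diffs c n * 0 ^ n) * 1) (at x)"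
  proof (rule has_field_derivative_transform_within_open[where S = "ball x r"])
    fix y assume "y \<in> ball x r"
    then show "(\<Sum>n. c n * (y - x) ^ n) = f y"
      using s[of y] by (simp add: dist_real_def abs_minus_commute sums_iff)
  qed (use r in auto)
  then show ?thesis using DERIV_imp_deriv by metis
qed

lemma strictly_convex_tangent:
  assumes "strictly_convex_on UNIV f" "(f has_real_derivative d) (at t)"
  shows "f t + d * (s - t) \<le> f s"
proof -
  have "convex_on UNIV f"
  proof (rule convex_onI)
    fix t x y :: real assume t: "0 < t" "t < 1"
    show "f ((1 - t) *\<^sub>R x + t *\<^sub>R y) \<le> (1 - t) * f x + t * f y"
    proof (cases "x = y")
      case True then show ?thesis by (simp add: algebra_simps)
    next
      case False
      then show ?thesis using assms(1) t unfolding strictly_convex_on_def by (fastforce intro: less_imp_le)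
    qed
  qed simp
  then have "d * (s - t) \<le> f s - f t"
    using assms(2) by (intro convex_on_imp_above_tangent[of UNIV]) auto
  then show ?thesis by linarith
qed

text \<open>In this context \<open>Eq t\<close> is the set of linear equilibrium pairs for the potential \<open>t\<psi>\<close>.\<close>

locale legendre_pair =
  fixes T :: "'a::metric_space \<Rightarrow> 'a set" and \<psi> :: "'a \<times> 'a \<Rightarrow> real" and P :: "real \<Rightarrow> real"
  assumes leg: "legendre_assumptions T \<psi>" and uniq: "unique_linear_eq_pairs T \<psi>"
    and P_def: "P = (\<lambda>t. linear_pressure T (\<lambda>r. t * \<psi> r))"
begin

abbreviation "rot \<equiv> rotation_value T \<psi>"
abbreviation "Eq t \<equiv> linear_eq_pairs T (\<lambda>r. t * \<psi> r)"

lemmas legendre = leg[unfolded legendre_assumptions_def Let_def P_def[symmetric]]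

lemma P_deriv: "(P has_real_derivative deriv P t) (at t)"
  using legendre by (intro real_analytic_imp_differentiable) blast

lemma P_tangent: "P t + deriv P t * (s - t) \<le> P s"
  using legendre by (intro strictly_convex_tangent P_deriv) blast

lemma deriv_P_homeo:
  shows "continuous_on UNIV (deriv P)" "inj (deriv P)" "deriv P t \<in> rotation_set T \<psi>"
proof -
  obtain g where g: "homeomorphism UNIV (interior (rotation_set T \<psi>)) (deriv P) g"
    using legendre by blast
  then show "continuous_on UNIV (deriv P)" "inj (deriv P)"
    unfolding homeomorphism_def inj_def by (blast, metis UNIV_I)
  have "deriv P t \<in> interior (rotation_set T \<psi>)" using g unfolding homeomorphism_def by blast
  then show "deriv P t \<in> rotation_set T \<psi>" using interior_subset by blast
qed

lemma entropy_le:
  assumes "p \<in> stationary_pairs T"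
  shows "kernel_entropy p \<le> ereal (P t - t * rot p)"
proof -
  have "kernel_entropy p \<le> localized_entropy T \<psi> (rot p)"
    unfolding localized_entropy_def using assms by (intro SUP_upper) simp
  also have "rot p \<in> rotation_set T \<psi>" using assms by (simp add: rotation_set_def)
  then have "localized_entropy T \<psi> (rot p) = (INF y. ereal (P y - y * rot p))"
    using legendre by blast
  also have "\<dots> \<le> ereal (P t - t * rot p)" by (intro INF_lower) simp
  finally show ?thesis .
qed

text \<open>The linear variational principle follows from the Legendre formula for the localized entropy: the
  infimum in that formula at \<open>deriv P t\<close> is attained at \<open>t\<close>, as \<open>P\<close> lies above its tangents.\<close>

lemma variational: "(SUP q\<in>stationary_pairs T. kernel_entropy q + ereal (t * rot q)) = ereal (P t)"
proof (rule antisym)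
  show "(SUP q\<in>stationary_pairs T. kernel_entropy q + ereal (t * rot q)) \<le> ereal (P t)"
  proof (rule SUP_least)
    fix q assume "q \<in> stationary_pairs T"
    from add_right_mono[OF entropy_le[OF this, of t], of "ereal (t * rot q)"]
    show "kernel_entropy q + ereal (t * rot q) \<le> ereal (P t)" by simp
  qed
  let ?S = "SUP q\<in>stationary_pairs T. kernel_entropy q + ereal (t * rot q)"
  let ?z = "deriv P t"
  have "localized_entropy T \<psi> ?z = (INF y. ereal (P y - y * ?z))"
    using legendre deriv_P_homeo(3)[of t] by blast
  moreover have "ereal (P t - t * ?z) \<le> (INF y. ereal (P y - y * ?z))"
  proof (rule INF_greatest)
    fix y show "ereal (P t - t * ?z) \<le> ereal (P y - y * ?z)"
      using P_tangent[of t y] by (simp add: algebra_simps)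
  qed
  moreover have "localized_entropy T \<psi> ?z \<le> ?S - ereal (t * ?z)"
    unfolding localized_entropy_def
  proof (rule SUP_least)
    fix p assume "p \<in> {p \<in> stationary_pairs T. rot p = ?z}"
    then have "kernel_entropy p + ereal (t * ?z) \<le> ?S"
      by (intro SUP_upper2[of p]) auto
    then show "kernel_entropy p \<le> ?S - ereal (t * ?z)" by (subst ereal_le_minus) auto
  qed
  ultimately have "ereal (P t - t * ?z) \<le> ?S - ereal (t * ?z)" by simp
  then have "ereal (P t - t * ?z) + ereal (t * ?z) \<le> ?S" by (subst (asm) ereal_le_minus) auto
  then show "ereal (P t) \<le> ?S" by simp
qed

lemma Eq_iff: "p \<in> Eq t \<longleftrightarrow> p \<in> stationary_pairs T \<and> kernel_entropy p = ereal (P t - t * rot p)"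
proof -
  have i: "(\<integral>r. t * \<psi> r \<partial>(pair_law T q)) = t * rot q" for q
    by (simp add: rotation_value_def)
  have "kernel_entropy p + ereal (t * rot p) = ereal (P t) \<longleftrightarrow> kernel_entropy p = ereal (P t - t * rot p)"
    by (cases "kernel_entropy p") auto
  then show ?thesis unfolding linear_eq_pairs_def i variational by simp
qed

text \<open>For a pair in \<open>Eq t\<close> the function \<open>P s - s * rot p\<close> of \<open>s\<close> is minimal at \<open>t\<close>.\<close>

lemma Eq_rotation: assumes "p \<in> Eq t" shows "rot p = deriv P t"
proof -
  have p: "p \<in> stationary_pairs T" "kernel_entropy p = ereal (P t - t * rot p)"
    using assms Eq_iff by blast+
  have "P t - t * rot p \<le> P s - s * rot p" for s
    using entropy_le[OF p(1), of s] p(2) by simp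
  moreover have "((\<lambda>s. P s - s * rot p) has_real_derivative deriv P t - rot p) (at t)"
    by (auto intro!: derivative_eq_intros P_deriv)
  ultimately have "deriv P t - rot p = 0" by (intro DERIV_local_min[of _ _ t 1]) auto
  then show ?thesis by simp
qed

lemma Eq_num: "num_pairs T (Eq t) = 1"
  using uniq unfolding unique_linear_eq_pairs_def by blast

lemma Eq_nonempty: obtains p where "p \<in> Eq t"
proof -
  have "Eq t \<noteq> {}" using Eq_num[of t] by (auto simp: num_pairs_def quotient_def)
  then show ?thesis using that by blast
qed

text \<open>A stationary pair with rotation value \<open>m\<close> has entropy at most \<open>P t - t * m\<close>, with equality
  exactly on \<open>Eq t\<close>. The choice \<open>t = \<beta> * m\<close> bounds the nonlinear functional by
  \<open>P (\<beta> * m) - \<beta> * m\<^sup>2 / 2\<close>; so the maximizing pairs are the linear equilibrium pairs at the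
  maximizers \<open>\<beta> * m\<close>, which are \<open>\<plusminus>y\<close> by assumption.\<close>

lemma nonlinear_eq_pairs_eq:
  assumes \<beta>: "0 \<le> \<beta>" and y: "y = \<beta> * deriv P y" and odd: "deriv P (- y) = - deriv P y"
    and even: "P (- y) = P y"
    and max: "\<And>s. P (\<beta> * s) - \<beta> * s\<^sup>2 / 2 \<le> P y - \<beta> * (deriv P y)\<^sup>2 / 2"
    and max_eq: "\<And>s. P (\<beta> * s) - \<beta> * s\<^sup>2 / 2 = P y - \<beta> * (deriv P y)\<^sup>2 / 2 \<Longrightarrow> \<bar>\<beta> * s\<bar> = \<bar>y\<bar>"
  shows "nonlinear_eq_pairs T (quadratic_energy \<psi> \<beta>) = Eq y \<union> Eq (- y)"
proof -
  define V where "V = P y - \<beta> * (deriv P y)\<^sup>2 / 2"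
  define F where "F q = kernel_entropy q + ereal (\<beta> / 2 * (rot q)\<^sup>2)" for q
  have F: "kernel_entropy q + ereal (quadratic_energy \<psi> \<beta> (pair_law T q)) = F q" for q
    by (simp add: F_def quadratic_energy_def rotation_value_def)
  have sum: "ereal (P (\<beta> * z) - \<beta> * z * z) + ereal (\<beta> / 2 * z\<^sup>2) = ereal (P (\<beta> * z) - \<beta> * z\<^sup>2 / 2)" for z
    by (simp add: power2_eq_square)
  have F_le: "F q \<le> ereal (P (\<beta> * rot q) - \<beta> * (rot q)\<^sup>2 / 2)" if "q \<in> stationary_pairs T" for q
    unfolding F_def sum[symmetric] by (intro add_right_mono entropy_le that)
  then have F_V: "F q \<le> ereal V" if "q \<in> stationary_pairs T" for q
    using that max[of "rot q"] unfolding V_def by (meson ereal_less_eq(3) order_trans)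
  have attain: "F p = ereal V" if p: "p \<in> Eq y \<union> Eq (- y)" for p
  proof -
    obtain t where t: "p \<in> Eq t" "t = y \<or> t = - y" using p by blast
    have r: "rot p = deriv P t" by (rule Eq_rotation[OF t(1)])
    have h: "kernel_entropy p = ereal (P t - t * rot p)" using t(1) Eq_iff by blast
    have "P t = P y" using t(2) even by auto
    moreover have "(rot p)\<^sup>2 = (deriv P y)\<^sup>2" "t * rot p = y * deriv P y" using t(2) r odd by auto
    moreover have "y * deriv P y = \<beta> * (deriv P y)\<^sup>2"
      using y by (metis mult.assoc power2_eq_square)
    ultimately show ?thesis unfolding F_def h V_def by simp
  qed
  obtain p0 where p0: "p0 \<in> Eq y" by (rule Eq_nonempty)
  have nl: "p \<in> nonlinear_eq_pairs T (quadratic_energy \<psi> \<beta>) \<longleftrightarrow> p \<in> stationary_pairs T \<and> F p = ereal V" for p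
  proof -
    have "p0 \<in> stationary_pairs T" using p0 Eq_iff by blast
    then show ?thesis unfolding nonlinear_eq_pairs_def F mem_Collect_eq
      using F_V attain[of p0] p0 by (metis UnI1 antisym)
  qed
  show ?thesis
  proof (rule set_eqI)
    fix p
    show "p \<in> nonlinear_eq_pairs T (quadratic_energy \<psi> \<beta>) \<longleftrightarrow> p \<in> Eq y \<union> Eq (- y)"
    proof
      assume "p \<in> Eq y \<union> Eq (- y)"
      then show "p \<in> nonlinear_eq_pairs T (quadratic_energy \<psi> \<beta>)" using nl attain Eq_iff by blast
    next
      assume "p \<in> nonlinear_eq_pairs T (quadratic_energy \<psi> \<beta>)"
      then have p: "p \<in> stationary_pairs T" "F p = ereal V" using nl by blast+
      let ?t = "\<beta> * rot p"
      have "V \<le> P ?t - \<beta> * (rot p)\<^sup>2 / 2" using F_le[OF p(1)] p(2) by simp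
      then have eq: "P ?t - \<beta> * (rot p)\<^sup>2 / 2 = V" using max[of "rot p"] unfolding V_def by linarith
      then have "?t = y \<or> ?t = - y" using max_eq[of "rot p"] unfolding V_def by linarith
      moreover have "kernel_entropy p = ereal (P ?t - ?t * rot p)"
        using p(2) unfolding F_def eq[symmetric] by (cases "kernel_entropy p") (auto simp: power2_eq_square)
      then have "p \<in> Eq ?t" using p(1) Eq_iff by blast
      ultimately show "p \<in> Eq y \<union> Eq (- y)" by auto
    qed
  qed
qed

end

section \<open>The self-consistency equation\<close>

text \<open>The assumptions on the pressure \<open>P\<close> and its derivative \<open>D\<close> that matter for the one-variable
  problem of maximizing \<open>P t - t\<^sup>2 / (2 * \<beta>)\<close>. The tangent inequality is the convexity of \<open>P\<close>; the
  linear growth of \<open>P\<close> makes \<open>D\<close> bounded.\<close>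

locale response_ratio =
  fixes P D :: "real \<Rightarrow> real" and a b M :: real and k :: nat
  assumes deriv: "(P has_real_derivative D t) (at t)"
    and contD: "continuous_on UNIV D"
    and tangent: "P t + D t * (s - t) \<le> P s"
    and injD: "inj D"
    and even: "P (- t) = P t"
    and ratio_mono: "strict_mono_on {0<..} (\<lambda>t. t / D t)"
    and a: "0 < a" and b: "0 < b" and k: "1 \<le> k"
    and expansion: "(\<lambda>t. D t - (a * t - b * t ^ (2 * k + 1))) \<in> O[at 0](\<lambda>t. t ^ (2 * k + 3))"
    and growth: "P t \<le> P 0 + M * \<bar>t\<bar>"
begin

abbreviation \<rho> :: "real \<Rightarrow> real" where "\<rho> t \<equiv> t / D t"

lemma D_odd: "D (- t) = - D t"
proof -
  have "((\<lambda>x. P (- x)) has_real_derivative D (- (- t)) * (- 1)) (at (- t))"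
    by (rule DERIV_chain2[where f = P and g = uminus]) (auto intro!: derivative_eq_intros deriv)
  then have "(P has_real_derivative - D t) (at (- t))" by (simp add: even)
  then show ?thesis using DERIV_unique[OF deriv] by blast
qed

lemma D_zero: "D 0 = 0" using D_odd[of 0] by simp

lemma D_pos: assumes "0 < t" shows "0 < D t"
proof -
  have "P t + D t * (0 - t) \<le> P 0" "P 0 + D 0 * (t - 0) \<le> P t" by (rule tangent)+
  then have "0 \<le> D t * t" using D_zero by simp
  then have "0 \<le> D t" using assms by (simp add: zero_le_mult_iff)
  moreover have "D t \<noteq> 0" using injD D_zero assms unfolding inj_def by (metis less_irrefl)
  ultimately show ?thesis by simp
qed

lemma ratio_less: "0 < s \<Longrightarrow> s < t \<Longrightarrow> \<rho> s < \<rho> t"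
  using ratio_mono by (auto simp: strict_mono_on_def)

lemma ratio_cont: "0 < t \<Longrightarrow> isCont \<rho> t"
  using contD D_pos[of t] by (intro continuous_intros) (auto simp: continuous_on_eq_continuous_at)

lemma remainder_smallo: "(\<lambda>t. D t - (a * t - b * t ^ (2 * k + 1))) \<in> o[at_right 0](\<lambda>t. t ^ (2 * k + 1))"
proof -
  have "(\<lambda>t. D t - (a * t - b * t ^ (2 * k + 1))) \<in> O[at_right 0](\<lambda>t. t ^ (2 * k + 3))"
    using expansion by (rule landau_o.big.filter_mono[rotated]) (simp add: at_le)
  also have "(\<lambda>t::real. t ^ (2 * k + 3)) \<in> o[at_right 0](\<lambda>t. t ^ (2 * k + 1))"
  proof (rule smalloI_tendsto)
    have "((\<lambda>t::real. t ^ 2) \<longlongrightarrow> 0 ^ 2) (at_right 0)" by (intro tendsto_intros)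
    then have "((\<lambda>t::real. t ^ 2) \<longlongrightarrow> 0) (at_right 0)" by simp
    then show "((\<lambda>t::real. t ^ (2 * k + 3) / t ^ (2 * k + 1)) \<longlongrightarrow> 0) (at_right 0)"
      by (rule Lim_transform_eventually)
        (auto simp: eventually_at_right_field power_add power2_eq_square power3_eq_cube intro!: exI[of _ 1])
    show "\<forall>\<^sub>F t in at_right 0. t ^ (2 * k + 1) \<noteq> (0::real)"
      by (auto simp: eventually_at_right_field intro!: exI[of _ 1])
  qed
  finally show ?thesis .
qed

lemma pow_smallo: "(\<lambda>t::real. t ^ (2 * k + 1)) \<in> o[at_right 0](\<lambda>t. t)"
proof (rule smalloI_tendsto)
  have "((\<lambda>t::real. t ^ (2 * k)) \<longlongrightarrow> 0 ^ (2 * k)) (at_right 0)" by (intro tendsto_intros)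
  then have "((\<lambda>t::real. t ^ (2 * k)) \<longlongrightarrow> 0) (at_right 0)" using k by simp
  then show "((\<lambda>t::real. t ^ (2 * k + 1) / t) \<longlongrightarrow> 0) (at_right 0)"
    by (rule Lim_transform_eventually) (auto simp: eventually_at_right_field intro!: exI[of _ 1])
  show "\<forall>\<^sub>F t in at_right 0. t \<noteq> (0::real)"
    by (auto simp: eventually_at_right_field intro!: exI[of _ 1])
qed

lemma D_asymp: "D \<sim>[at_right 0] (\<lambda>t. a * t)"
proof (rule smallo_imp_asymp_equiv)
  have "(\<lambda>t. D t - (a * t - b * t ^ (2 * k + 1))) \<in> o[at_right 0](\<lambda>t. t)"
    using remainder_smallo pow_smallo by (rule landau_o.small_trans)
  moreover have "(\<lambda>t. b * t ^ (2 * k + 1)) \<in> o[at_right 0](\<lambda>t. t)"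
    using pow_smallo b by simp
  ultimately have "(\<lambda>t. D t - (a * t - b * t ^ (2 * k + 1)) - b * t ^ (2 * k + 1)) \<in> o[at_right 0](\<lambda>t. t)"
    by (rule sum_in_smallo)
  then show "(\<lambda>t. D t - a * t) \<in> o[at_right 0](\<lambda>t. a * t)" using a by simp
qed

lemma ev_pos: "\<forall>\<^sub>F t in at_right (0::real). 0 < t"
  by (auto simp: eventually_at_right_field intro!: exI[of _ 1])

lemma ratio_asymp: "(\<lambda>t. \<rho> t - 1 / a) \<sim>[at_right 0] (\<lambda>t. b / a\<^sup>2 * t ^ (2 * k))"
proof -
  have 1: "(\<lambda>t. a * t - D t) \<sim>[at_right 0] (\<lambda>t. b * t ^ (2 * k + 1))"
  proof (rule smallo_imp_asymp_equiv)
    have "(\<lambda>t. - (D t - (a * t - b * t ^ (2 * k + 1)))) \<in> o[at_right 0](\<lambda>t. b * t ^ (2 * k + 1))"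
      using remainder_smallo b by (simp only: landau_o.small.uminus_in_iff) simp
    then show "(\<lambda>t. a * t - D t - b * t ^ (2 * k + 1)) \<in> o[at_right 0](\<lambda>t. b * t ^ (2 * k + 1))"
      by (simp add: algebra_simps)
  qed
  have "(\<lambda>t. (a * t - D t) / (a * D t)) \<sim>[at_right 0] (\<lambda>t. (b * t ^ (2 * k + 1)) / (a * (a * t)))"
    by (intro asymp_equiv_intros 1 D_asymp)
  then show ?thesis
  proof (rule asymp_equiv_transfer)
    show "\<forall>\<^sub>F t in at_right 0. (a * t - D t) / (a * D t) = \<rho> t - 1 / a"
      using ev_pos
    proof eventually_elim
      case (elim t) then show ?case using D_pos[of t] a by (simp add: field_simps)
    qed
    show "\<forall>\<^sub>F t in at_right 0. b * t ^ (2 * k + 1) / (a * (a * t)) = b / a\<^sup>2 * t ^ (2 * k)"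
      using ev_pos by eventually_elim (simp add: power2_eq_square)
  qed
qed

lemma ratio_tendsto: "(\<rho> \<longlongrightarrow> 1 / a) (at_right 0)"
proof -
  have "(\<lambda>t. t / D t) \<sim>[at_right 0] (\<lambda>t. t / (a * t))"
    by (intro asymp_equiv_intros D_asymp)
  then have "\<rho> \<sim>[at_right 0] (\<lambda>t. 1 / a)"
    by (rule asymp_equiv_transfer) (use ev_pos a in \<open>auto elim!: eventually_mono\<close>)
  then show ?thesis by (rule asymp_equivD_const)
qed

lemma ratio_gt: assumes "0 < t" shows "1 / a < \<rho> t"
proof -
  have "\<forall>\<^sub>F s in at_right 0. \<rho> s \<le> \<rho> (t / 2)"
    unfolding eventually_at_right_field
  proof (intro exI[of _ "t / 2"] conjI allI impI)
    show "\<rho> s \<le> \<rho> (t / 2)" if "0 < s" "s < t / 2" for s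
      using ratio_less[OF that] by (rule less_imp_le)
  qed (use assms in simp)
  then have "1 / a \<le> \<rho> (t / 2)" by (intro tendsto_upperbound[OF ratio_tendsto]) auto
  also have "\<dots> < \<rho> t" using assms by (intro ratio_less) auto
  finally show ?thesis .
qed

lemma D_bound: assumes "0 < t" shows "D t \<le> 2 * \<bar>M\<bar>"
proof -
  have "P t + D t * (2 * t - t) \<le> P (2 * t)" "P 0 + D 0 * (t - 0) \<le> P t" by (rule tangent)+
  moreover have "P (2 * t) \<le> P 0 + M * (2 * t)" using growth[of "2 * t"] assms by simp
  ultimately have "D t * t \<le> (2 * M) * t" using D_zero by (simp add: algebra_simps)
  then show ?thesis using assms by simp
qed

text \<open>The ratio is unbounded since \<open>D\<close> is bounded.\<close>

lemma ratio_large: obtains t where "0 < t" "\<beta> < \<rho> t"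
proof -
  define t where "t = (2 * \<bar>M\<bar> + 1) * (\<bar>\<beta>\<bar> + 1)"
  have t: "0 < t" by (simp add: t_def)
  have "(2 * \<bar>M\<bar> + 1) * (\<bar>\<beta>\<bar> + 1) / (2 * \<bar>M\<bar> + 1) \<le> \<rho> t"
    unfolding t_def[symmetric] using t D_pos[OF t] D_bound[OF t] by (intro frac_le) auto
  moreover have "(2 * \<bar>M\<bar> + 1) * (\<bar>\<beta>\<bar> + 1) / (2 * \<bar>M\<bar> + 1) = \<bar>\<beta>\<bar> + 1"
    by (rule nonzero_mult_div_cancel_left) linarith
  ultimately show ?thesis using that[OF t] by linarith
qed

lemma solution_iff: "0 < t \<Longrightarrow> t = \<beta> * D t \<longleftrightarrow> \<rho> t = \<beta>"
  using D_pos[of t] by (auto simp: field_simps)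

lemma ratio_less_iff: "0 < s \<Longrightarrow> 0 < t \<Longrightarrow> \<rho> s < \<rho> t \<longleftrightarrow> s < t"
  using ratio_less[of s t] ratio_less[of t s] by (cases s t rule: linorder_cases) auto

lemma solution_unique: assumes "1 / a < \<beta>" shows "\<exists>!t. 0 < t \<and> t = \<beta> * D t"
proof -
  obtain u where u: "0 < u" "\<beta> < \<rho> u" by (rule ratio_large)
  have "\<forall>\<^sub>F s in at_right 0. \<rho> s < \<beta> \<and> 0 < s \<and> s < u"
    using order_tendstoD(2)[OF ratio_tendsto assms] ev_pos
      eventually_at_right_less[of 0]
    by (intro eventually_conj) (auto simp: eventually_at_right_field u intro!: exI[of _ u])
  then obtain s where s: "\<rho> s < \<beta>" "0 < s" "s < u"
    using eventually_happens'[OF trivial_limit_at_right_real] by blast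
  have "continuous_on {s..u} \<rho>"
    using ratio_cont s(2) by (intro continuous_at_imp_continuous_on) auto
  then obtain t where "s \<le> t" "t \<le> u" "\<rho> t = \<beta>"
    using IVT'[of \<rho> s \<beta> u] s u by auto
  then have t: "0 < t" "\<rho> t = \<beta>" using s(2) by auto
  show ?thesis
  proof (rule ex1I[of _ t])
    show "0 < t \<and> t = \<beta> * D t" using t solution_iff by blast
    fix x assume "0 < x \<and> x = \<beta> * D x"
    then have "0 < x" "\<rho> x = \<beta>" using solution_iff by blast+
    then show "x = t" using t ratio_less[of x t] ratio_less[of t x] by (cases x t rule: linorder_cases) auto
  qed
qed

text \<open>The nonnegative maximizer: \<open>0\<close> up to the critical value \<open>1 / a\<close>, the positive solution of the
  self-consistency equation beyond it. Treating both phases as one function makes the statements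
  below uniform in \<open>\<beta>\<close>.\<close>

definition Y :: "real \<Rightarrow> real" where
  "Y \<beta> = (if \<beta> \<le> 1 / a then 0 else THE t. 0 < t \<and> t = \<beta> * D t)"

lemma Y_zero: "\<beta> \<le> 1 / a \<Longrightarrow> Y \<beta> = 0" by (simp add: Y_def)

lemma Y_solution: assumes "1 / a < \<beta>" shows "0 < Y \<beta>" "Y \<beta> = \<beta> * D (Y \<beta>)" "\<rho> (Y \<beta>) = \<beta>"
proof -
  have "0 < Y \<beta> \<and> Y \<beta> = \<beta> * D (Y \<beta>)"
    using theI'[OF solution_unique[OF assms]] assms by (simp add: Y_def)
  then show "0 < Y \<beta>" "Y \<beta> = \<beta> * D (Y \<beta>)" "\<rho> (Y \<beta>) = \<beta>" using solution_iff by blast+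
qed

lemma Y_nonneg: "0 \<le> Y \<beta>" using Y_zero[of \<beta>] Y_solution(1)[of \<beta>] by (cases "\<beta> \<le> 1 / a") auto

lemma Y_fixed: "Y \<beta> = \<beta> * D (Y \<beta>)"
  using Y_zero[of \<beta>] Y_solution(2)[of \<beta>] D_zero by (cases "\<beta> \<le> 1 / a") auto

lemma less_Y_iff: assumes "0 < t" shows "t < Y \<beta> \<longleftrightarrow> \<rho> t < \<beta>"
proof (cases "\<beta> \<le> 1 / a")
  case True
  then show ?thesis using Y_zero[OF True] ratio_gt[OF assms] assms by simp
next
  case False
  then have b: "1 / a < \<beta>" by simp
  show ?thesis using ratio_less_iff[OF assms Y_solution(1)[OF b]] Y_solution(3)[OF b] by simp
qed

lemma Y_less_iff: assumes "0 < t" shows "Y \<beta> < t \<longleftrightarrow> \<beta> < \<rho> t"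
proof (cases "\<beta> \<le> 1 / a")
  case True
  then show ?thesis using Y_zero[OF True] ratio_gt[OF assms] assms by simp
next
  case False
  then have b: "1 / a < \<beta>" by simp
  show ?thesis using ratio_less_iff[OF Y_solution(1)[OF b] assms] Y_solution(3)[OF b] by simp
qed

lemma Y_cont: "isCont Y \<beta>"
  unfolding isCont_def
proof (rule order_tendstoI)
  fix q assume q: "q < Y \<beta>"
  show "\<forall>\<^sub>F x in at \<beta>. q < Y x"
  proof (cases "q < 0")
    case True
    then show ?thesis using Y_nonneg by (intro always_eventually) (auto intro: less_le_trans)
  next
    case False
    define t where "t = (q + Y \<beta>) / 2"
    have t: "0 < t" "q < t" "t < Y \<beta>" using q False by (auto simp: t_def)
    then have "\<rho> t < \<beta>" using less_Y_iff by blast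
    then have "\<forall>\<^sub>F x in at \<beta>. \<rho> t < x" by (intro order_tendstoD(1)[OF tendsto_ident_at])
    then show ?thesis using t less_Y_iff[OF t(1)] by (auto elim!: eventually_mono intro: less_trans)
  qed
next
  fix q assume q: "Y \<beta> < q"
  then have q0: "0 < q" using Y_nonneg[of \<beta>] by linarith
  then have "\<beta> < \<rho> q" using Y_less_iff q by blast
  then have "\<forall>\<^sub>F x in at \<beta>. x < \<rho> q" by (intro order_tendstoD(2)[OF tendsto_ident_at])
  then show "\<forall>\<^sub>F x in at \<beta>. Y x < q" using Y_less_iff[OF q0] by (auto elim!: eventually_mono)
qed

lemma objective_deriv:
  assumes "0 < \<beta>"
  shows "((\<lambda>t. P t - t\<^sup>2 / (2 * \<beta>)) has_real_derivative D t - t / \<beta>) (at t)"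
  using assms by (auto intro!: derivative_eq_intros deriv)

lemma objective_slope:
  assumes "0 < \<beta>" "0 < t" shows "D t - t / \<beta> = D t / \<beta> * (\<beta> - \<rho> t)"
  using assms D_pos[OF assms(2)] by (simp add: field_simps)

text \<open>For \<open>t > 0\<close> the derivative of the objective has the sign of \<open>\<beta> - \<rho> t\<close>, that is, of \<open>Y \<beta> - t\<close>.\<close>

lemma objective_max_pos:
  assumes \<beta>: "0 < \<beta>" and t: "0 \<le> t" "t \<noteq> Y \<beta>"
  shows "P t - t\<^sup>2 / (2 * \<beta>) < P (Y \<beta>) - (Y \<beta>)\<^sup>2 / (2 * \<beta>)"
proof -
  let ?G = "\<lambda>t. P t - t\<^sup>2 / (2 * \<beta>)"
  have cont: "continuous_on S ?G" for S
    using objective_deriv[OF \<beta>] by (intro continuous_at_imp_continuous_on ballI DERIV_isCont)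
  consider "t < Y \<beta>" | "Y \<beta> < t" using t(2) by linarith
  then show ?thesis
  proof cases
    case 1
    show ?thesis
    proof (rule DERIV_pos_imp_increasing_open[OF 1 _ cont])
      fix x assume x: "t < x" "x < Y \<beta>"
      then have "0 < x" using t by linarith
      then have "\<rho> x < \<beta>" using x(2) by (simp only: less_Y_iff)
      then have "0 < D x / \<beta> * (\<beta> - \<rho> x)" using D_pos[OF \<open>0 < x\<close>] \<beta> by simp
      then show "\<exists>y. (?G has_real_derivative y) (at x) \<and> 0 < y"
        using objective_deriv[OF \<beta>, of x] objective_slope[OF \<beta> \<open>0 < x\<close>] by auto
    qed
  next
    case 2
    show ?thesis
    proof (rule DERIV_neg_imp_decreasing_open[OF 2 _ cont])
      fix x assume x: "Y \<beta> < x" "x < t"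
      then have "0 < x" using Y_nonneg[of \<beta>] by linarith
      then have "\<beta> < \<rho> x" using x(1) by (simp only: Y_less_iff)
      then have "D x / \<beta> * (\<beta> - \<rho> x) < 0"
        using D_pos[OF \<open>0 < x\<close>] \<beta> by (intro mult_pos_neg divide_pos_pos) auto
      then show "\<exists>y. (?G has_real_derivative y) (at x) \<and> y < 0"
        using objective_deriv[OF \<beta>, of x] objective_slope[OF \<beta> \<open>0 < x\<close>] by auto
    qed
  qed
qed

lemma objective_max:
  assumes "0 < \<beta>"
  shows "P t - t\<^sup>2 / (2 * \<beta>) \<le> P (Y \<beta>) - (Y \<beta>)\<^sup>2 / (2 * \<beta>)"
    and "P t - t\<^sup>2 / (2 * \<beta>) = P (Y \<beta>) - (Y \<beta>)\<^sup>2 / (2 * \<beta>) \<longleftrightarrow> \<bar>t\<bar> = Y \<beta>"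
proof -
  have e: "P t - t\<^sup>2 / (2 * \<beta>) = P \<bar>t\<bar> - \<bar>t\<bar>\<^sup>2 / (2 * \<beta>)" by (simp add: abs_if even)
  show "P t - t\<^sup>2 / (2 * \<beta>) \<le> P (Y \<beta>) - (Y \<beta>)\<^sup>2 / (2 * \<beta>)"
    "P t - t\<^sup>2 / (2 * \<beta>) = P (Y \<beta>) - (Y \<beta>)\<^sup>2 / (2 * \<beta>) \<longleftrightarrow> \<bar>t\<bar> = Y \<beta>"
    unfolding e using objective_max_pos[OF assms, of "\<bar>t\<bar>"] by (cases "\<bar>t\<bar> = Y \<beta>"; force)+
qed

text \<open>The same maximum in the variable \<open>s = t / \<beta>\<close>, in a form that includes \<open>\<beta> = 0\<close>.\<close>

lemma quadratic_objective:
  assumes \<beta>: "0 \<le> \<beta>"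
  shows "P (\<beta> * s) - \<beta> * s\<^sup>2 / 2 \<le> P (Y \<beta>) - \<beta> * (D (Y \<beta>))\<^sup>2 / 2"
    and "P (\<beta> * s) - \<beta> * s\<^sup>2 / 2 = P (Y \<beta>) - \<beta> * (D (Y \<beta>))\<^sup>2 / 2 \<Longrightarrow> \<bar>\<beta> * s\<bar> = Y \<beta>"
proof -
  have "P (\<beta> * s) - \<beta> * s\<^sup>2 / 2 \<le> P (Y \<beta>) - \<beta> * (D (Y \<beta>))\<^sup>2 / 2 \<and>
    (P (\<beta> * s) - \<beta> * s\<^sup>2 / 2 = P (Y \<beta>) - \<beta> * (D (Y \<beta>))\<^sup>2 / 2 \<longrightarrow> \<bar>\<beta> * s\<bar> = Y \<beta>)"
  proof (cases "\<beta> = 0")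
    case True
    then show ?thesis using a by (simp add: Y_zero)
  next
    case False
    then have b0: "0 < \<beta>" using \<beta> by simp
    have e: "(\<beta> * x)\<^sup>2 / (2 * \<beta>) = \<beta> * x\<^sup>2 / 2" for x using b0 by (simp add: power2_eq_square)
    have eY: "(Y \<beta>)\<^sup>2 / (2 * \<beta>) = \<beta> * (D (Y \<beta>))\<^sup>2 / 2"
      using e[of "D (Y \<beta>)"] Y_fixed[of \<beta>] by simp
    show ?thesis using objective_max[OF b0, of "\<beta> * s"] unfolding e eY by blast
  qed
  then show "P (\<beta> * s) - \<beta> * s\<^sup>2 / 2 \<le> P (Y \<beta>) - \<beta> * (D (Y \<beta>))\<^sup>2 / 2"
    "P (\<beta> * s) - \<beta> * s\<^sup>2 / 2 = P (Y \<beta>) - \<beta> * (D (Y \<beta>))\<^sup>2 / 2 \<Longrightarrow> \<bar>\<beta> * s\<bar> = Y \<beta>"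
    by blast+
qed

section \<open>Asymptotics at the critical point\<close>

lemma Y_filterlim: "filterlim Y (at_right 0) (at_right (1 / a))"
  unfolding filterlim_at
proof
  have "(Y \<longlongrightarrow> Y (1 / a)) (at_right (1 / a))"
    using Y_cont[of "1 / a"] unfolding isCont_def by (rule tendsto_within_subset) auto
  then show "(Y \<longlongrightarrow> 0) (at_right (1 / a))" by (simp add: Y_zero)
  show "\<forall>\<^sub>F x in at_right (1 / a). Y x \<in> {0<..} \<and> Y x \<noteq> 0"
    unfolding eventually_at_right_field using Y_solution(1)
    by (intro exI[of _ "1 / a + 1"]) (auto simp: less_imp_neq[symmetric])
qed

lemma ev_right: "\<forall>\<^sub>F \<beta> in at_right (1 / a). 1 / a < \<beta>"
  unfolding eventually_at_right_field by (intro exI[of _ "1 / a + 1"]) auto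

lemma gap_asymp: "(\<lambda>\<beta>. \<beta> - 1 / a) \<sim>[at_right (1 / a)] (\<lambda>\<beta>. b / a\<^sup>2 * Y \<beta> ^ (2 * k))"
  using asymp_equiv_compose'[OF ratio_asymp Y_filterlim]
proof (rule asymp_equiv_transfer)
  show "\<forall>\<^sub>F \<beta> in at_right (1 / a). \<rho> (Y \<beta>) - 1 / a = \<beta> - 1 / a"
    using ev_right by eventually_elim (simp only: Y_solution(3))
qed simp

lemma Y_asymp:
  "Y \<sim>[at_right (1 / a)] (\<lambda>\<beta>. (a\<^sup>2 / b) powr (1 / (2 * real k)) * (\<beta> - 1 / a) powr (1 / (2 * real k)))"
proof -
  have "(\<lambda>\<beta>. a\<^sup>2 / b * (\<beta> - 1 / a)) \<sim>[at_right (1 / a)] (\<lambda>\<beta>. a\<^sup>2 / b * (b / a\<^sup>2 * Y \<beta> ^ (2 * k)))"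
    by (intro asymp_equiv_intros gap_asymp)
  then have "(\<lambda>\<beta>. a\<^sup>2 / b * (\<beta> - 1 / a)) \<sim>[at_right (1 / a)] (\<lambda>\<beta>. Y \<beta> ^ (2 * k))"
    using a b by (simp add: mult.assoc[symmetric] power_mult)
  then have "(\<lambda>\<beta>. (a\<^sup>2 / b * (\<beta> - 1 / a)) powr (1 / (2 * real k)))
      \<sim>[at_right (1 / a)] (\<lambda>\<beta>. (Y \<beta> ^ (2 * k)) powr (1 / (2 * real k)))"
  proof (rule asymp_equiv_powr_real)
    show "\<forall>\<^sub>F x in at_right (1 / a). 0 \<le> a\<^sup>2 / b * (x - 1 / a)"
      using ev_right by eventually_elim (use b in simp)
  qed (simp add: Y_nonneg)
  then show ?thesis
  proof (subst asymp_equiv_sym, elim asymp_equiv_transfer)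
    show "\<forall>\<^sub>F \<beta> in at_right (1 / a). (a\<^sup>2 / b * (\<beta> - 1 / a)) powr (1 / (2 * real k)) =
        (a\<^sup>2 / b) powr (1 / (2 * real k)) * (\<beta> - 1 / a) powr (1 / (2 * real k))"
      using ev_right
    proof eventually_elim
      case (elim \<beta>)
      show ?case by (rule powr_mult)
    qed
    show "\<forall>\<^sub>F \<beta> in at_right (1 / a). (Y \<beta> ^ (2 * k)) powr (1 / (2 * real k)) = Y \<beta>"
      using ev_right
    proof eventually_elim
      case (elim \<beta>)
      then have "0 < Y \<beta>" by (rule Y_solution(1))
      then have "(Y \<beta> ^ (2 * k)) powr (1 / (2 * real k)) = Y \<beta> powr (real (2 * k) * (1 / (2 * real k)))"
        by (simp only: powr_powr powr_realpow[symmetric])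
      also have "\<dots> = Y \<beta>" using k \<open>0 < Y \<beta>\<close> by simp
      finally show ?case .
    qed
  qed
qed

lemma Z_asymp:
  "(\<lambda>\<beta>. D (Y \<beta>)) \<sim>[at_right (1 / a)]
     (\<lambda>\<beta>. a * (a\<^sup>2 / b) powr (1 / (2 * real k)) * (\<beta> - 1 / a) powr (1 / (2 * real k)))"
proof -
  have "(\<lambda>\<beta>. D (Y \<beta>)) \<sim>[at_right (1 / a)] (\<lambda>\<beta>. a * Y \<beta>)"
    by (rule asymp_equiv_compose'[OF D_asymp Y_filterlim])
  also have "(\<lambda>\<beta>. a * Y \<beta>) \<sim>[at_right (1 / a)]
      (\<lambda>\<beta>. a * ((a\<^sup>2 / b) powr (1 / (2 * real k)) * (\<beta> - 1 / a) powr (1 / (2 * real k))))"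
    by (intro asymp_equiv_intros Y_asymp)
  finally show ?thesis by (simp add: mult.assoc)
qed

text \<open>Inserting the maximizer for one parameter into the objective for another bounds the increments of
  \<open>\<Phi>\<close> on both sides. So \<open>\<Phi>\<close> is differentiable because \<open>Y\<close> is continuous; no derivative of \<open>Y\<close> is
  needed, and the critical point is not exceptional.\<close>

lemma envelope:
  assumes "0 < \<beta>" and \<Phi>: "\<forall>\<beta>>0. \<Phi> \<beta> = P (Y \<beta>) - (Y \<beta>)\<^sup>2 / (2 * \<beta>)"
  shows "(\<Phi> has_real_derivative (Y \<beta>)\<^sup>2 / (2 * \<beta>\<^sup>2)) (at \<beta>)"
proof -
  have inc: "(Y x)\<^sup>2 / 2 * (1 / x - 1 / y) \<le> \<Phi> y - \<Phi> x" if "0 < x" "0 < y" for x y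
  proof -
    have "(Y x)\<^sup>2 / 2 * (1 / x - 1 / y) = (Y x)\<^sup>2 / (2 * x) - (Y x)\<^sup>2 / (2 * y)"
      using that by (simp add: field_simps)
    then show ?thesis
      using objective_max(1)[OF that(2), of "Y x"] \<Phi>[rule_format, OF that(1)] \<Phi>[rule_format, OF that(2)] by linarith
  qed
  have sq: "min ((Y \<beta>)\<^sup>2) ((Y y)\<^sup>2) / (2 * \<beta> * y) \<le> (\<Phi> y - \<Phi> \<beta>) / (y - \<beta>) \<and>
      (\<Phi> y - \<Phi> \<beta>) / (y - \<beta>) \<le> max ((Y \<beta>)\<^sup>2) ((Y y)\<^sup>2) / (2 * \<beta> * y)"
    if y: "0 < y" "y \<noteq> \<beta>" for y
  proof -
    define w where "w = 1 / (2 * \<beta> * y)"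
    have w: "0 < w" using y assms(1) by (simp add: w_def)
    have e: "1 / \<beta> - 1 / y = 2 * w * (y - \<beta>)" "1 / y - 1 / \<beta> = - (2 * w * (y - \<beta>))"
      using y assms(1) by (simp_all add: w_def field_simps)
    have l: "(Y \<beta>)\<^sup>2 * w * (y - \<beta>) \<le> \<Phi> y - \<Phi> \<beta>"
      using inc[OF assms(1) y(1)] unfolding e by simp
    have u: "\<Phi> y - \<Phi> \<beta> \<le> (Y y)\<^sup>2 * w * (y - \<beta>)"
      using inc[OF y(1) assms(1)] unfolding e by simp
    have "min ((Y \<beta>)\<^sup>2) ((Y y)\<^sup>2) * w \<le> (\<Phi> y - \<Phi> \<beta>) / (y - \<beta>) \<and>
      (\<Phi> y - \<Phi> \<beta>) / (y - \<beta>) \<le> max ((Y \<beta>)\<^sup>2) ((Y y)\<^sup>2) * w"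
    proof (cases "\<beta> < y")
      case True
      then have "(Y \<beta>)\<^sup>2 * w \<le> (\<Phi> y - \<Phi> \<beta>) / (y - \<beta>)" "(\<Phi> y - \<Phi> \<beta>) / (y - \<beta>) \<le> (Y y)\<^sup>2 * w"
        using l u by (auto simp: le_divide_eq divide_le_eq)
      moreover have "min ((Y \<beta>)\<^sup>2) ((Y y)\<^sup>2) * w \<le> (Y \<beta>)\<^sup>2 * w" "(Y y)\<^sup>2 * w \<le> max ((Y \<beta>)\<^sup>2) ((Y y)\<^sup>2) * w"
        using w by auto
      ultimately show ?thesis by linarith
    next
      case False
      then have "y < \<beta>" using y by simp
      then have "(Y y)\<^sup>2 * w \<le> (\<Phi> y - \<Phi> \<beta>) / (y - \<beta>)" "(\<Phi> y - \<Phi> \<beta>) / (y - \<beta>) \<le> (Y \<beta>)\<^sup>2 * w"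
        using l u by (auto simp: le_divide_eq divide_le_eq)
      moreover have "min ((Y \<beta>)\<^sup>2) ((Y y)\<^sup>2) * w \<le> (Y y)\<^sup>2 * w" "(Y \<beta>)\<^sup>2 * w \<le> max ((Y \<beta>)\<^sup>2) ((Y y)\<^sup>2) * w"
        using w by auto
      ultimately show ?thesis by linarith
    qed
    then show ?thesis by (simp add: w_def)
  qed
  have ev: "\<forall>\<^sub>F y in at \<beta>. 0 < y \<and> y \<noteq> \<beta>"
    using order_tendstoD(1)[OF tendsto_ident_at assms(1)] eventually_neq_at_within[of \<beta> \<beta>]
    by (intro eventually_conj) auto
  have Yt: "((\<lambda>y. Y y) \<longlongrightarrow> Y \<beta>) (at \<beta>)" using Y_cont unfolding isCont_def .
  have lim: "(Y \<beta>)\<^sup>2 / (2 * \<beta>\<^sup>2) = min ((Y \<beta>)\<^sup>2) ((Y \<beta>)\<^sup>2) / (2 * \<beta> * \<beta>)"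
    "(Y \<beta>)\<^sup>2 / (2 * \<beta>\<^sup>2) = max ((Y \<beta>)\<^sup>2) ((Y \<beta>)\<^sup>2) / (2 * \<beta> * \<beta>)"
    by (simp_all add: power2_eq_square)
  have "((\<lambda>y. min ((Y \<beta>)\<^sup>2) ((Y y)\<^sup>2) / (2 * \<beta> * y)) \<longlongrightarrow> (Y \<beta>)\<^sup>2 / (2 * \<beta>\<^sup>2)) (at \<beta>)"
    unfolding lim(1) using assms(1) by (intro tendsto_intros tendsto_min Yt) auto
  moreover have "((\<lambda>y. max ((Y \<beta>)\<^sup>2) ((Y y)\<^sup>2) / (2 * \<beta> * y)) \<longlongrightarrow> (Y \<beta>)\<^sup>2 / (2 * \<beta>\<^sup>2)) (at \<beta>)"
    unfolding lim(2) using assms(1) by (intro tendsto_intros tendsto_max Yt) auto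
  ultimately show ?thesis unfolding has_field_derivative_iff
    by (rule tendsto_sandwich[rotated 2]) (use ev sq in \<open>auto elim!: eventually_mono\<close>)
qed

lemma Phi_deriv_eq:
  assumes \<Phi>: "\<forall>\<beta>>0. \<Phi> \<beta> = P (Y \<beta>) - (Y \<beta>)\<^sup>2 / (2 * \<beta>)" and "0 < \<beta>"
  shows "deriv \<Phi> \<beta> = (D (Y \<beta>))\<^sup>2 / 2"
proof -
  have "(Y \<beta>)\<^sup>2 / (2 * \<beta>\<^sup>2) = (\<beta> * D (Y \<beta>))\<^sup>2 / (2 * \<beta>\<^sup>2)" using Y_fixed[of \<beta>] by simp
  also have "\<dots> = (D (Y \<beta>))\<^sup>2 / 2" using assms(2) by (simp add: power_mult_distrib)
  finally show ?thesis using DERIV_imp_deriv[OF envelope[OF assms(2) \<Phi>]] by simp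
qed

text \<open>From here on \<open>\<Phi>\<close> is the maximum of the objective as a function of \<open>\<beta> > 0\<close>.\<close>

context
  fixes \<Phi> :: "real \<Rightarrow> real" and A C :: real
  assumes \<Phi>: "\<forall>\<beta>>0. \<Phi> \<beta> = P (Y \<beta>) - (Y \<beta>)\<^sup>2 / (2 * \<beta>)"
    and C: "C = a * (a\<^sup>2 / b) powr (1 / (2 * real k))" and A: "A = C\<^sup>2 / 2"
begin

lemma A_pos: "0 < A" unfolding A C using a b by simp

lemma deriv_Phi_asymp: "deriv \<Phi> \<sim>[at_right (1 / a)] (\<lambda>\<beta>. A * (\<beta> - 1 / a) powr (1 / real k))"
proof -
  have "(\<lambda>\<beta>. (D (Y \<beta>))\<^sup>2 / 2) \<sim>[at_right (1 / a)] (\<lambda>\<beta>. (C * (\<beta> - 1 / a) powr (1 / (2 * real k)))\<^sup>2 / 2)"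
    unfolding C by (intro asymp_equiv_intros Z_asymp)
  then show ?thesis
  proof (rule asymp_equiv_transfer)
    show "\<forall>\<^sub>F \<beta> in at_right (1 / a). (D (Y \<beta>))\<^sup>2 / 2 = deriv \<Phi> \<beta>"
      using ev_right
    proof eventually_elim
      case (elim \<beta>)
      then have "0 < \<beta>" using a by (auto intro: less_trans[of 0 "1 / a"])
      then show ?case using Phi_deriv_eq[OF \<Phi>] by simp
    qed
    show "\<forall>\<^sub>F \<beta> in at_right (1 / a). (C * (\<beta> - 1 / a) powr (1 / (2 * real k)))\<^sup>2 / 2 =
        A * (\<beta> - 1 / a) powr (1 / real k)"
      using ev_right
    proof eventually_elim
      case (elim \<beta>)
      have "((\<beta> - 1 / a) powr (1 / (2 * real k)))\<^sup>2 =
          (\<beta> - 1 / a) powr (1 / (2 * real k) + 1 / (2 * real k))"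
        by (simp only: powr_add power2_eq_square)
      also have "1 / (2 * real k) + 1 / (2 * real k) = 1 / real k" by simp
      finally show ?case by (simp add: A power_mult_distrib)
    qed
  qed
qed

lemma Phi_DERIV: "0 < \<beta> \<Longrightarrow> (\<Phi> has_real_derivative deriv \<Phi> \<beta>) (at \<beta>)"
  using envelope[OF _ \<Phi>] DERIV_imp_deriv by metis

lemma deriv_Phi_zero: "0 < \<beta> \<Longrightarrow> \<beta> \<le> 1 / a \<Longrightarrow> deriv \<Phi> \<beta> = 0"
  using Phi_deriv_eq[OF \<Phi>, of \<beta>] Y_zero[of \<beta>] D_zero by simp

lemma Phi_asymp:
  "(\<lambda>\<beta>. \<Phi> \<beta> - P 0) \<sim>[at_right (1 / a)]
     (\<lambda>\<beta>. real k / (real k + 1) * A * (\<beta> - 1 / a) powr (1 + 1 / real k))"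
proof -
  define c where "c = real k / (real k + 1) * A"
  have c: "0 < c" using A_pos k by (simp add: c_def)
  define g where "g \<beta> = c * (\<beta> - 1 / a) powr (1 + 1 / real k)" for \<beta>
  have evp: "\<forall>\<^sub>F \<beta> in at_right (1 / a). 0 < \<beta> \<and> 1 / a < \<beta>"
    using ev_right a by (auto elim!: eventually_mono intro: less_trans[of 0 "1 / a"])
  have "((\<lambda>\<beta>. (\<Phi> \<beta> - P 0) / g \<beta>) \<longlongrightarrow> 1) (at_right (1 / a))"
  proof (rule lhopital_right[where f' = "deriv \<Phi>" and g' = "\<lambda>\<beta>. A * (\<beta> - 1 / a) powr (1 / real k)"])
    have "isCont \<Phi> (1 / a)" using Phi_DERIV[of "1 / a"] a by (intro DERIV_isCont) auto
    then have "(\<Phi> \<longlongrightarrow> \<Phi> (1 / a)) (at_right (1 / a))"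
      unfolding isCont_def by (rule tendsto_within_subset) auto
    moreover have "\<Phi> (1 / a) = P 0" using \<Phi>[rule_format, of "1 / a"] a by (simp add: Y_zero)
    ultimately show "((\<lambda>\<beta>. \<Phi> \<beta> - P 0) \<longlongrightarrow> 0) (at_right (1 / a))" by (simp add: LIM_zero)
    have "((\<lambda>\<beta>. c * (\<beta> - 1 / a) powr (1 + 1 / real k)) \<longlongrightarrow> c * (1 / a - 1 / a) powr (1 + 1 / real k))
        (at_right (1 / a))"
    proof (intro tendsto_intros tendsto_powr')
      show "1 / a - 1 / a \<noteq> 0 \<or> 0 < 1 + 1 / real k \<and> (\<forall>\<^sub>F x in at_right (1 / a). 0 \<le> x - 1 / a)"
        using ev_right by (auto elim!: eventually_mono simp: add_pos_nonneg)
    qed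
    then show "(g \<longlongrightarrow> 0) (at_right (1 / a))" by (simp add: g_def[abs_def])
    show "\<forall>\<^sub>F x in at_right (1 / a). g x \<noteq> 0"
      using ev_right by eventually_elim (use c in \<open>simp add: g_def\<close>)
    show "\<forall>\<^sub>F x in at_right (1 / a). A * (x - 1 / a) powr (1 / real k) \<noteq> 0"
      using ev_right by eventually_elim (use A_pos in simp)
    show "\<forall>\<^sub>F x in at_right (1 / a). ((\<lambda>\<beta>. \<Phi> \<beta> - P 0) has_real_derivative deriv \<Phi> x) (at x)"
      using evp by eventually_elim (auto intro!: derivative_eq_intros Phi_DERIV)
    show "\<forall>\<^sub>F x in at_right (1 / a). (g has_real_derivative A * (x - 1 / a) powr (1 / real k)) (at x)"
      using ev_right
    proof eventually_elim
      case (elim x)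
      have k0: "real k \<noteq> 0" "real k + 1 \<noteq> 0" using k by auto
      then have k1: "1 + 1 / real k = (real k + 1) / real k" by (simp add: field_simps)
      have cA: "c * (1 + 1 / real k) = A" unfolding k1 c_def using k0 by simp
      have "((\<lambda>x. (x - 1 / a) powr (1 + 1 / real k)) has_real_derivative
          (1 + 1 / real k) * (x - 1 / a) powr (1 + 1 / real k - 1) * 1) (at x)"
      proof (rule DERIV_chain2[where f = "\<lambda>u. u powr (1 + 1 / real k)" and g = "\<lambda>x. x - 1 / a"])
        show "((\<lambda>u. u powr (1 + 1 / real k)) has_real_derivative
            (1 + 1 / real k) * (x - 1 / a) powr (1 + 1 / real k - 1)) (at (x - 1 / a))"
          using elim by (intro has_real_derivative_powr) simp
      qed (auto intro!: derivative_eq_intros)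
      from DERIV_cmult[OF this, of c] show ?case
        unfolding g_def[abs_def] cA[symmetric] by (simp add: mult.assoc)
    qed
    show "((\<lambda>x. deriv \<Phi> x / (A * (x - 1 / a) powr (1 / real k))) \<longlongrightarrow> 1) (at_right (1 / a))"
    proof (rule asymp_equivD_strong[OF deriv_Phi_asymp])
      show "\<forall>\<^sub>F x in at_right (1 / a). deriv \<Phi> x \<noteq> 0 \<or> A * (x - 1 / a) powr (1 / real k) \<noteq> 0"
        using ev_right by eventually_elim (use A_pos in simp)
    qed
  qed
  then show ?thesis unfolding g_def c_def by (rule asymp_equivI')
qed

lemma Phi_C1: "\<exists>e>0. \<Phi> C1_differentiable_on ball (1 / a) e"
proof (intro exI conjI)
  show "0 < 1 / a" using a by simp
  have pos: "0 < x" if "x \<in> ball (1 / a) (1 / a)" for x using that by (auto simp: dist_real_def abs_less_iff)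
  show "\<Phi> C1_differentiable_on ball (1 / a) (1 / a)" unfolding C1_differentiable_on_def
  proof (intro exI conjI ballI)
    show "(\<Phi> has_vector_derivative (Y x)\<^sup>2 / (2 * x\<^sup>2)) (at x)" if "x \<in> ball (1 / a) (1 / a)" for x
      using envelope[OF pos[OF that] \<Phi>] by (simp add: has_real_derivative_iff_has_vector_derivative)
    have "continuous_on (ball (1 / a) (1 / a)) Y" by (intro continuous_at_imp_continuous_on ballI Y_cont)
    then show "continuous_on (ball (1 / a) (1 / a)) (\<lambda>x. (Y x)\<^sup>2 / (2 * x\<^sup>2))"
      by (intro continuous_intros) (use pos in fastforce)+
  qed
qed

text \<open>The difference quotients of \<open>deriv \<Phi>\<close> vanish on the left of the critical point, whereas on the
  right they are asymptotically at least \<open>A > 0\<close>, because \<open>u \<le> u powr (1 / k)\<close> for \<open>0 < u < 1\<close>.\<close>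

lemma deriv_Phi_not_differentiable: "\<not> (deriv \<Phi> has_real_derivative d) (at (1 / a))"
proof
  assume d: "(deriv \<Phi> has_real_derivative d) (at (1 / a))"
  have z: "deriv \<Phi> (1 / a) = 0" using a by (simp add: deriv_Phi_zero)
  have q: "((\<lambda>y. deriv \<Phi> y / (y - 1 / a)) \<longlongrightarrow> d) (at (1 / a))"
    using d z unfolding has_field_derivative_iff by simp
  have "((\<lambda>y. deriv \<Phi> y / (y - 1 / a)) \<longlongrightarrow> d) (at_left (1 / a))"
    using q by (rule tendsto_within_subset) auto
  moreover have "\<forall>\<^sub>F y in at_left (1 / a). deriv \<Phi> y / (y - 1 / a) = 0"
    unfolding eventually_at_left_field using a deriv_Phi_zero by (intro exI[of _ 0]) auto
  then have "((\<lambda>y. deriv \<Phi> y / (y - 1 / a)) \<longlongrightarrow> 0) (at_left (1 / a))" by (rule tendsto_eventually)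
  ultimately have d0: "d = 0" by (intro tendsto_unique[OF trivial_limit_at_left_real])
  have r: "((\<lambda>y. deriv \<Phi> y / (y - 1 / a)) \<longlongrightarrow> 0) (at_right (1 / a))"
    using q unfolding d0 by (rule tendsto_within_subset) auto
  have "((\<lambda>x. deriv \<Phi> x / (A * (x - 1 / a) powr (1 / real k))) \<longlongrightarrow> 1) (at_right (1 / a))"
  proof (rule asymp_equivD_strong[OF deriv_Phi_asymp])
    show "\<forall>\<^sub>F x in at_right (1 / a). deriv \<Phi> x \<noteq> 0 \<or> A * (x - 1 / a) powr (1 / real k) \<noteq> 0"
      using ev_right by eventually_elim (use A_pos in simp)
  qed
  then have "((\<lambda>x. A * (deriv \<Phi> x / (A * (x - 1 / a) powr (1 / real k)))) \<longlongrightarrow> A * 1) (at_right (1 / a))"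
    by (intro tendsto_intros)
  moreover have "\<forall>\<^sub>F x in at_right (1 / a). A * (deriv \<Phi> x / (A * (x - 1 / a) powr (1 / real k))) \<le>
      deriv \<Phi> x / (x - 1 / a)"
  proof -
    have "\<forall>\<^sub>F x in at_right (1 / a). x < 1 / a + 1"
      unfolding eventually_at_right_field by (intro exI[of _ "1 / a + 1"]) auto
    then show ?thesis using ev_right
    proof eventually_elim
      case (elim x)
      define u where "u = x - 1 / a"
      have u: "0 < u" "u < 1" using elim by (auto simp: u_def)
      have "0 < x" using elim a by (auto intro: less_trans[of 0 "1 / a"])
      then have dp: "0 \<le> deriv \<Phi> x" by (simp add: Phi_deriv_eq[OF \<Phi>])
      have "u powr 1 \<le> u powr (1 / real k)" using u k by (intro powr_mono') auto
      then have "deriv \<Phi> x / u powr (1 / real k) \<le> deriv \<Phi> x / u"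
        using u dp by (intro divide_left_mono) auto
      then show ?case unfolding u_def[symmetric] using A_pos by simp
    qed
  qed
  ultimately have "A * 1 \<le> 0" using r by (intro tendsto_le[OF trivial_limit_at_right_real])
  then show False using A_pos by simp
qed

end

end

section \<open>The phase transition\<close>

theorem theorem6p8:
  fixes T :: "'a::metric_space \<Rightarrow> 'a set"
    and \<psi> :: "'a \<times> 'a \<Rightarrow> real"
    and P \<Phi> y z :: "real \<Rightarrow> real"
    and a b \<beta>\<^sub>c A C :: real
    and k :: nat
  assumes "compact (UNIV :: 'a set)"
    and "correspondence T"
    and "forward_expansive T"
    and "continuous_on (graph T) \<psi>"
    and "legendre_assumptions T \<psi>"
    and "unique_linear_eq_pairs T \<psi>"
    and P: "P = (\<lambda>t. linear_pressure T (\<lambda>r. t * \<psi> r))"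
    and "\<forall>v. v \<in> rotation_set T \<psi> \<longleftrightarrow> - v \<in> rotation_set T \<psi>"
    and "\<forall>t. P (- t) = P t"
    and "strict_mono_on {0<..} (\<lambda>t. t / deriv P t)"
    and "0 < a" "0 < b" "1 \<le> k"
    and "(\<lambda>t. deriv P t - (a * t - b * t ^ (2 * k + 1))) \<in> O[at 0](\<lambda>t. t ^ (2 * k + 3))"
    and \<Phi>: "\<Phi> = (\<lambda>\<beta>. top_pressure T (quadratic_energy \<psi> \<beta>))"
    and \<beta>c: "\<beta>\<^sub>c = 1 / a"
    and y: "y = positive_solution P"
    and z: "z = (\<lambda>\<beta>. deriv P (y \<beta>))"
    and C: "C = a * (a\<^sup>2 / b) powr (1 / (2 * real k))"
    and A: "A = C\<^sup>2 / 2"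
  shows "
    (\<forall>\<beta>. 0 \<le> \<beta> \<and> \<beta> \<le> \<beta>\<^sub>c \<longrightarrow>
        nonlinear_eq_pairs T (quadratic_energy \<psi> \<beta>) = linear_eq_pairs T (\<lambda>r. 0 * \<psi> r) \<and>
        num_pairs T (nonlinear_eq_pairs T (quadratic_energy \<psi> \<beta>)) = 1 \<and>
        (\<forall>p\<in>linear_eq_pairs T (\<lambda>r. 0 * \<psi> r). rotation_value T \<psi> p = 0)) \<and>
    (\<forall>\<beta>>\<beta>\<^sub>c.
        (\<exists>!t. 0 < t \<and> t = \<beta> * deriv P t) \<and>
        nonlinear_eq_pairs T (quadratic_energy \<psi> \<beta>) =
          linear_eq_pairs T (\<lambda>r. y \<beta> * \<psi> r) \<union> linear_eq_pairs T (\<lambda>r. - y \<beta> * \<psi> r) \<and>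
        num_pairs T (nonlinear_eq_pairs T (quadratic_energy \<psi> \<beta>)) = 2 \<and>
        (\<forall>p\<in>linear_eq_pairs T (\<lambda>r. y \<beta> * \<psi> r). rotation_value T \<psi> p = z \<beta>) \<and>
        (\<forall>p\<in>linear_eq_pairs T (\<lambda>r. - y \<beta> * \<psi> r). rotation_value T \<psi> p = - z \<beta>)) \<and>
    (y \<sim>[at_right \<beta>\<^sub>c]
        (\<lambda>\<beta>. (a\<^sup>2 / b) powr (1 / (2 * real k)) * (\<beta> - \<beta>\<^sub>c) powr (1 / (2 * real k)))) \<and>
    (z \<sim>[at_right \<beta>\<^sub>c] (\<lambda>\<beta>. C * (\<beta> - \<beta>\<^sub>c) powr (1 / (2 * real k)))) \<and>
    (\<forall>\<beta>\<ge>0. has_top_pressure T (quadratic_energy \<psi> \<beta>) (\<Phi> \<beta>)) \<and>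
    (\<forall>\<beta>. 0 \<le> \<beta> \<and> \<beta> \<le> \<beta>\<^sub>c \<longrightarrow> \<Phi> \<beta> = P 0) \<and>
    (\<forall>\<beta>>\<beta>\<^sub>c. \<Phi> \<beta> = P (y \<beta>) - \<beta> / 2 * (z \<beta>)\<^sup>2) \<and>
    (deriv \<Phi> \<sim>[at_right \<beta>\<^sub>c] (\<lambda>\<beta>. A * (\<beta> - \<beta>\<^sub>c) powr (1 / real k))) \<and>
    ((\<lambda>\<beta>. \<Phi> \<beta> - P 0) \<sim>[at_right \<beta>\<^sub>c]
        (\<lambda>\<beta>. real k / (real k + 1) * A * (\<beta> - \<beta>\<^sub>c) powr (1 + 1 / real k))) \<and>
    (\<exists>e>0. \<Phi> C1_differentiable_on ball \<beta>\<^sub>c e) \<and>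
    (\<not> (\<exists>e>0. \<Phi> C1_differentiable_on ball \<beta>\<^sub>c e \<and> deriv \<Phi> C1_differentiable_on ball \<beta>\<^sub>c e))"
proof -
  interpret L: legendre_pair T \<psi> P
    using assms(5,6) P by unfold_locales
  obtain M where M: "\<forall>t. P t \<le> P 0 + M * \<bar>t\<bar>" using linear_pressure_growth[OF assms(1-4) P] by blast
  interpret R: response_ratio P "deriv P" a b M k
    by unfold_locales (use assms(9-14) M L.deriv_P_homeo(1,2) in \<open>auto intro: L.P_deriv L.P_tangent\<close>)
  have bc: "0 < \<beta>\<^sub>c" using assms(11) by (simp add: \<beta>c)
  have yY: "y \<beta> = R.Y \<beta>" if "\<beta>\<^sub>c < \<beta>" for \<beta>
    using that by (simp add: y positive_solution_def R.Y_def \<beta>c)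
  define V where "V \<beta> = P (R.Y \<beta>) - \<beta> * (deriv P (R.Y \<beta>))\<^sup>2 / 2" for \<beta>
  have top: "has_top_pressure T (quadratic_energy \<psi> \<beta>) (V \<beta>)" if "0 \<le> \<beta>" for \<beta>
  proof (rule quadratic_pressure[OF assms(1-4) P that])
    show "P (\<beta> * s) - \<beta> * s\<^sup>2 / 2 \<le> V \<beta>" for s
      unfolding V_def by (rule R.quadratic_objective(1)[OF that])
    show "P (\<beta> * deriv P (R.Y \<beta>)) - \<beta> * (deriv P (R.Y \<beta>))\<^sup>2 / 2 = V \<beta>"
      unfolding V_def R.Y_fixed[of \<beta>, symmetric] ..
  qed
  have \<Phi>V: "\<Phi> \<beta> = V \<beta>" if "0 \<le> \<beta>" for \<beta>
    unfolding \<Phi> by (rule top_pressure_eq[OF top[OF that]])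
  have \<Phi>_pos: "\<Phi> \<beta> = P (R.Y \<beta>) - (R.Y \<beta>)\<^sup>2 / (2 * \<beta>)" if "0 < \<beta>" for \<beta>
  proof -
    have "(R.Y \<beta>)\<^sup>2 / (2 * \<beta>) = (\<beta> * deriv P (R.Y \<beta>))\<^sup>2 / (2 * \<beta>)" using R.Y_fixed[of \<beta>] by simp
    also have "\<dots> = \<beta> * (deriv P (R.Y \<beta>))\<^sup>2 / 2" using that by (simp add: power2_eq_square)
    finally show ?thesis using \<Phi>V[of \<beta>] that by (simp add: V_def)
  qed
  then have \<Phi>_pos': "\<forall>\<beta>>0. \<Phi> \<beta> = P (R.Y \<beta>) - (R.Y \<beta>)\<^sup>2 / (2 * \<beta>)" by blast
  have nl: "nonlinear_eq_pairs T (quadratic_energy \<psi> \<beta>) =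
      L.Eq (R.Y \<beta>) \<union> L.Eq (- R.Y \<beta>)" if "0 \<le> \<beta>" for \<beta>
  proof (rule L.nonlinear_eq_pairs_eq[OF that R.Y_fixed R.D_odd R.even])
    show "P (\<beta> * s) - \<beta> * s\<^sup>2 / 2 \<le> P (R.Y \<beta>) - \<beta> * (deriv P (R.Y \<beta>))\<^sup>2 / 2" for s
      by (rule R.quadratic_objective(1)[OF that])
    show "\<bar>\<beta> * s\<bar> = \<bar>R.Y \<beta>\<bar>"
      if "P (\<beta> * s) - \<beta> * s\<^sup>2 / 2 = P (R.Y \<beta>) - \<beta> * (deriv P (R.Y \<beta>))\<^sup>2 / 2" for s
      using R.quadratic_objective(2)[OF \<open>0 \<le> \<beta>\<close> that] R.Y_nonneg[of \<beta>] by simp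
  qed
  have sub: "nonlinear_eq_pairs T (quadratic_energy \<psi> \<beta>) = L.Eq 0"
    if "0 \<le> \<beta>" "\<beta> \<le> \<beta>\<^sub>c" for \<beta>
    using nl[OF that(1)] R.Y_zero[of \<beta>] that(2) unfolding \<beta>c by (simp only: minus_zero Un_absorb)
  have rot0: "L.rot p = 0" if "p \<in> L.Eq 0" for p using L.Eq_rotation[OF that] R.D_zero by simp
  have super: "(\<exists>!t. 0 < t \<and> t = \<beta> * deriv P t) \<and>
      nonlinear_eq_pairs T (quadratic_energy \<psi> \<beta>) = L.Eq (y \<beta>) \<union> L.Eq (- y \<beta>) \<and>
      num_pairs T (nonlinear_eq_pairs T (quadratic_energy \<psi> \<beta>)) = 2 \<and>
      (\<forall>p\<in>L.Eq (y \<beta>). L.rot p = z \<beta>) \<and> (\<forall>p\<in>L.Eq (- y \<beta>). L.rot p = - z \<beta>)"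
    if b: "\<beta>\<^sub>c < \<beta>" for \<beta>
  proof -
    have Ypos: "0 < R.Y \<beta>" using R.Y_solution(1) b unfolding \<beta>c by blast
    have r1: "L.rot p = z \<beta>" if "p \<in> L.Eq (y \<beta>)" for p
      unfolding z by (rule L.Eq_rotation[OF that])
    have r2: "L.rot p = - z \<beta>" if "p \<in> L.Eq (- y \<beta>)" for p
      unfolding z R.D_odd[symmetric] by (rule L.Eq_rotation[OF that])
    have zpos: "0 < z \<beta>" unfolding z yY[OF b] by (rule R.D_pos[OF Ypos])
    have e: "nonlinear_eq_pairs T (quadratic_energy \<psi> \<beta>) = L.Eq (y \<beta>) \<union> L.Eq (- y \<beta>)"
      unfolding yY[OF b] using bc b by (intro nl) simp
    have "num_pairs T (L.Eq (y \<beta>) \<union> L.Eq (- y \<beta>)) = 2"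
    proof (rule num_pairs_union[OF assms(1) _ _ L.Eq_num L.Eq_num])
      show "L.Eq (y \<beta>) \<subseteq> stationary_pairs T" "L.Eq (- y \<beta>) \<subseteq> stationary_pairs T"
        using L.Eq_iff by blast+
      show "z \<beta> \<noteq> - z \<beta>" using zpos by simp
    qed (fact r1 r2)+
    then show ?thesis using R.solution_unique[of \<beta>] b e r1 r2 unfolding \<beta>c by simp
  qed
  have evr: "\<forall>\<^sub>F \<beta> in at_right \<beta>\<^sub>c. R.Y \<beta> = y \<beta>"
    using R.ev_right unfolding \<beta>c[symmetric] by eventually_elim (simp add: yY)
  have ya: "y \<sim>[at_right \<beta>\<^sub>c]
        (\<lambda>\<beta>. (a\<^sup>2 / b) powr (1 / (2 * real k)) * (\<beta> - \<beta>\<^sub>c) powr (1 / (2 * real k)))"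
    using R.Y_asymp[folded \<beta>c] by (rule asymp_equiv_transfer) (use evr in auto)
  have za: "z \<sim>[at_right \<beta>\<^sub>c] (\<lambda>\<beta>. C * (\<beta> - \<beta>\<^sub>c) powr (1 / (2 * real k)))"
    using R.Z_asymp[folded \<beta>c] unfolding C
    by (rule asymp_equiv_transfer) (use evr in \<open>auto simp: z elim!: eventually_mono\<close>)
  have P0: "\<Phi> \<beta> = P 0" if "0 \<le> \<beta> \<and> \<beta> \<le> \<beta>\<^sub>c" for \<beta>
    using \<Phi>V[of \<beta>] R.Y_zero[of \<beta>] that R.D_zero by (simp add: V_def \<beta>c)
  have P1: "\<Phi> \<beta> = P (y \<beta>) - \<beta> / 2 * (z \<beta>)\<^sup>2" if "\<beta>\<^sub>c < \<beta>" for \<beta>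
    using \<Phi>V[of \<beta>] that bc by (simp add: V_def z yY)
  have nC2: "\<not> (\<exists>e>0. \<Phi> C1_differentiable_on ball \<beta>\<^sub>c e \<and> deriv \<Phi> C1_differentiable_on ball \<beta>\<^sub>c e)"
  proof
    assume "\<exists>e>0. \<Phi> C1_differentiable_on ball \<beta>\<^sub>c e \<and> deriv \<Phi> C1_differentiable_on ball \<beta>\<^sub>c e"
    then obtain e where "0 < e" "deriv \<Phi> C1_differentiable_on ball \<beta>\<^sub>c e" by blast
    then obtain d where "(deriv \<Phi> has_vector_derivative d \<beta>\<^sub>c) (at \<beta>\<^sub>c)"
      unfolding C1_differentiable_on_def by (metis centre_in_ball)
    then show False
      using R.deriv_Phi_not_differentiable[OF \<Phi>_pos' C A, of "d \<beta>\<^sub>c"]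
      by (simp add: has_real_derivative_iff_has_vector_derivative \<beta>c)
  qed
  have crit: "\<forall>\<beta>. 0 \<le> \<beta> \<and> \<beta> \<le> \<beta>\<^sub>c \<longrightarrow>
        nonlinear_eq_pairs T (quadratic_energy \<psi> \<beta>) = L.Eq 0 \<and>
        num_pairs T (nonlinear_eq_pairs T (quadratic_energy \<psi> \<beta>)) = 1 \<and>
        (\<forall>p\<in>L.Eq 0. L.rot p = 0)"
    using sub rot0 L.Eq_num[of 0] by metis
  have top': "has_top_pressure T (quadratic_energy \<psi> \<beta>) (\<Phi> \<beta>)" if "0 \<le> \<beta>" for \<beta>
    unfolding \<Phi>V[OF that] by (rule top[OF that])
  show ?thesis
    by (intro conjI crit ya za nC2
        R.deriv_Phi_asymp[OF \<Phi>_pos' C A, folded \<beta>c] R.Phi_asymp[OF \<Phi>_pos' C A, folded \<beta>c]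
        R.Phi_C1[OF \<Phi>_pos' C A, folded \<beta>c];
        intro allI impI; rule super top' P0 P1; assumption)
qed

end
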